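(* Let $F_{49}:=(6,\{03,04,05,12,13,45\})$. Then $\lambda_{F_{49}}=5/54$. Furthermore, the $F_{49}$-problem is perfectly $B$-stable with \[B:=(6,\{00,11,22,33,44,55,01,12,23,34,45,50\}),\] and the unique (up to automorphisms of $B$) maximiser of $p(F_{49},B(\boldsymbol x))$ over $\boldsymbol x\in\mathbb S_6$ is $\boldsymbol x=(1/6,1/6,1/6,1/6,1/6,1/6)$.
   Context: All graphs are finite and simple. $(m,E)$ denotes the graph or pattern with vertex set $\{0,\dots,m-1\}$ and edge set $E$; $ij$ abbreviates $\{i,j\}$ ($ii$ is a loop). For graphs $F,G$ with $\kappa\le n$ vertices, $p(F,G)$ is the number of $\kappa$-subsets of $V(G)$ inducing a subgraph isomorphic to $F$, divided by $\binom n\kappa$; $p(F,n)$ is the maximum of $p(F,G)$ over $n$-vertex graphs $G$; $\lambda_F=\lim_{n\to\infty}p(F,n)$ (the limit exists). A pattern is a graph in which loops are allowed; its automorphisms are the bijections of the vertex set preserving edges, non-edges, loops and non-loops. For a pattern $B$ on $\{0,\dots,m-1\}$ and disjoint (possibly empty) sets $V_0,\dots,V_{m-1}$, the blowup $B(V_0,\dots,V_{m-1})$ is the simple graph on $\bigcup V_i$ in which distinct $x\in V_i$, $y\in V_j$ are adjacent iff $\{i,j\}\in E(B)$ (so $V_i$ is a clique if $i$ has a loop and independent otherwise); $B()$ is the family of all blowups. $\mathbb S_m=\{\boldsymbol x\in\mathbb R^m:x_i\ge0,\sum x_i=1\}$, and $p(F,B(\boldsymbol x))$ is the limit as $n\to\infty$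 of $p(F,B(V_0,\dots,V_{m-1}))$ with $|V_i|=(x_i+o(1))n$. $\delta_{\mathrm{edit}}(G,B())$ is the minimum number of vertex pairs whose adjacency must be changed to turn $G$ into a graph isomorphic to a blowup of $B$ (of the same order). The $F$-problem is perfectly $B$-stable if there is $C>0$ such that every graph $G$ with $n\ge C$ vertices satisfies $\delta_{\mathrm{edit}}(G,B())\le C\,(p(F,n)-p(F,G))\,n^2$. *)

theory Defs
  imports "HOL-Analysis.Analysis"
begin

(* A loop at i is the singleton edge {i, i} = {i}, so graphs and patterns share one representation. *)
type_synonym 'a graph = "'a set \<times> 'a set set"

abbreviation verts :: "'a graph \<Rightarrow> 'a set" where
  "verts G \<equiv> fst G"

abbreviation edges :: "'a graph \<Rightarrow> 'a set set" where
  "edges G \<equiv> snd G"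

definition simple_graph :: "'a graph \<Rightarrow> bool" where
  "simple_graph G \<longleftrightarrow>
     finite (verts G) \<and> edges G \<subseteq> {{x, y} | x y. x \<in> verts G \<and> y \<in> verts G \<and> x \<noteq> y}"

(* Taking x = y in the edge condition, loops and non-loops are preserved as well. *)
definition graph_isomorphism :: "'a graph \<Rightarrow> 'b graph \<Rightarrow> ('a \<Rightarrow> 'b) \<Rightarrow> bool" where
  "graph_isomorphism G H f \<longleftrightarrow>
     bij_betw f (verts G) (verts H) \<and>
     (\<forall>x\<in>verts G. \<forall>y\<in>verts G. {x, y} \<in> edges G \<longleftrightarrow> {f x, f y} \<in> edges H)"

definition isomorphic :: "'a graph \<Rightarrow> 'b graph \<Rightarrow> bool" where
  "isomorphic G H \<longleftrightarrow> (\<exists>f. graph_isomorphism G H f)"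

definition automorphism :: "'a graph \<Rightarrow> ('a \<Rightarrow> 'a) \<Rightarrow> bool" where
  "automorphism B f \<longleftrightarrow> graph_isomorphism B B f"

definition induced :: "'a graph \<Rightarrow> 'a set \<Rightarrow> 'a graph" where
  "induced G S = (S, {e \<in> edges G. e \<subseteq> S})"

definition density :: "'a graph \<Rightarrow> 'b graph \<Rightarrow> real" where
  "density F G =
     real (card {S. S \<subseteq> verts G \<and> card S = card (verts F) \<and> isomorphic (induced G S) F})
       / real (card (verts G) choose card (verts F))"

(* Graphs on finite sets of naturals represent all isomorphism types of finite graphs. *)
definition max_density :: "'a graph \<Rightarrow> nat \<Rightarrow> real" where
  "max_density F n =
     Max {density F G | G :: nat graph. simple_graph G \<and> card (verts G) = n}"

definition blowup_parts :: "'b graph \<Rightarrow> ('b \<Rightarrow> 'a set) \<Rightarrow> bool" where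
  "blowup_parts B W \<longleftrightarrow> disjoint_family_on W (verts B) \<and> (\<forall>i\<in>verts B. finite (W i))"

definition blowup :: "'b graph \<Rightarrow> ('b \<Rightarrow> 'a set) \<Rightarrow> 'a graph" where
  "blowup B W =
     (\<Union>i\<in>verts B. W i,
      {{x, y} | x y i j. i \<in> verts B \<and> j \<in> verts B \<and> x \<in> W i \<and> y \<in> W j \<and> x \<noteq> y
                        \<and> {i, j} \<in> edges B})"

definition blowup_family :: "'b graph \<Rightarrow> 'a graph set" where
  "blowup_family B = {blowup B W | W. blowup_parts B W}"

(* Only the coordinates below m matter. *)
definition prob_simplex :: "nat \<Rightarrow> (nat \<Rightarrow> real) set" where
  "prob_simplex m = {x. (\<forall>i<m. 0 \<le> x i) \<and> (\<Sum>i<m. x i) = 1}"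

(* The common limit over all sequences of blowups whose i-th part has size (x i + o(1)) n. *)
definition blowup_density :: "'a graph \<Rightarrow> 'b graph \<Rightarrow> ('b \<Rightarrow> real) \<Rightarrow> real" where
  "blowup_density F B x =
     (THE L. \<forall>W :: nat \<Rightarrow> 'b \<Rightarrow> nat set.
        (\<forall>n. blowup_parts B (W n)) \<and>
        (\<forall>i\<in>verts B. (\<lambda>n. real (card (W n i)) / real n) \<longlonglongrightarrow> x i)
        \<longrightarrow> (\<lambda>n. density F (blowup B (W n))) \<longlonglongrightarrow> L)"

definition unique_maximiser_up_to_aut ::
    "'a graph \<Rightarrow> nat graph \<Rightarrow> nat \<Rightarrow> (nat \<Rightarrow> real) \<Rightarrow> bool" where
  "unique_maximiser_up_to_aut F B m x \<longleftrightarrow>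
     is_arg_max (blowup_density F B) (\<lambda>y. y \<in> prob_simplex m) x \<and>
     (\<forall>y. is_arg_max (blowup_density F B) (\<lambda>z. z \<in> prob_simplex m) y \<longrightarrow>
        (\<exists>f. automorphism B f \<and> (\<forall>i<m. y i = x (f i))))"

definition edit_distance :: "'a graph \<Rightarrow> 'b graph \<Rightarrow> nat" where
  "edit_distance G B =
     (LEAST k. \<exists>H :: 'a graph. simple_graph H \<and> verts H = verts G
        \<and> (\<exists>K \<in> (blowup_family B :: 'a graph set). isomorphic H K)
        \<and> k = card ((edges G - edges H) \<union> (edges H - edges G)))"

definition perfectly_stable :: "'a graph \<Rightarrow> 'b graph \<Rightarrow> bool" where
  "perfectly_stable F B \<longleftrightarrow>
     (\<exists>C::real. C > 0 \<and>
        (\<forall>G :: nat graph. simple_graph G \<and> real (card (verts G)) \<ge> C \<longrightarrow>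
           real (edit_distance G B)
             \<le> C * (max_density F (card (verts G)) - density F G) * (real (card (verts G)))\<^sup>2))"

definition F49 :: "nat graph" where
  "F49 = ({0..<6}, {{0,3}, {0,4}, {0,5}, {1,2}, {1,3}, {4,5}})"

definition B49 :: "nat graph" where
  "B49 = ({0..<6}, {{0,0}, {1,1}, {2,2}, {3,3}, {4,4}, {5,5},
                    {0,1}, {1,2}, {2,3}, {3,4}, {4,5}, {5,0}})"

end

theory Submission
  imports Defs "HOL-Real_Asymp.Real_Asymp"
begin

text \<open>
  The graph F49 is a triangle with a tail: an induced path a-b-c-d, and a triangle d, e, f two of whose
  vertices have no further neighbours. The proof is a flag algebra argument, carried out on finite weighted
  structures instead of limit objects, and followed by a reweighting step that yields perfect stability.

  Adjacency is replaced by the reflexive relation R of being equal or adjacent, and copies of F49 are replaced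
  by ordered 6-tuples on which R looks like F49 (\<open>is_F49\<close> below). Since the two end vertices of
  the triangle have the same neighbours, R allows them to coincide, and no other two entries of such a tuple
  can coincide. Every copy comes from exactly two tuples with distinct end vertices, and there are only O(n^5)
  tuples with equal ones. In a blowup of the hexagon with loops, the tuples are walks through five consecutive
  parts, the last of which receives two entries; with equal parts there are n^6/3888 of them, whence the
  density 720/(2*3888) = 5/54.

  The heart is the lemma key_inequality. For all nonnegative weights on a finite set of total weight S,
    116640 * (F49 tuples) + 2 * S * (misfits) + (imbalance) <= 30 * S^6.
  An induced path a-b-c sorts all vertices by their adjacency to a, b and c; six of the eight classes correspond
  to the positions on the hexagon. A misfit consists of such a path and of two vertices that have one of the
  other classes, or whose adjacency differs from the one in the hexagon. The imbalance measures, over all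
  induced paths on four vertices, how unequal the six corresponding sets of vertices are. The inequality is a
  sum of squares: the left side plus a sum of positive semidefinite quadratic forms in flag weights is at most
  the right side, because this holds for the sum over the 720 orderings of any six points (psum_slack_nonneg).
  That last statement is a finite check over graphs on six vertices, which are listed with a vertex of maximal
  degree last and with the other five in one of 34 canonical forms. Semidefiniteness follows from integer
  certificates (psd_cert_nonneg).

  Each term of the inequality has its role. The first one gives the upper bound for the limit density. Applied
  to the hexagon itself, the third one shows that the number of tuples drops when the parts are not equal
  (hexpoly_gap), which gives the unique maximiser. The second one gives stability (lemma stability): if G is
  nearly optimal, sort its vertices by an induced path with the fewest misfits, let H be the blowup with these
  parts, and let D be the number of ordered pairs on which G and H differ. Each of the order of n^3 induced
  paths has at least D misfits. The parts of H are nearly equal, so weights close to 1 turn them into exactly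
  equal ones; in these weights H has exactly n^6/3888 tuples, and the key inequality says that G has fewer by
  a constant times n^4 * D. The counts of G and H differ only in tuples that contain one of the D pairs, so
  that the return to weights 1 costs only a small multiple of n^4 * D. Thus H has more copies than G by a
  constant times n^4 * D, and H has at most the maximum number of copies.
\<close>

type_synonym 'a reln = "'a \<Rightarrow> 'a \<Rightarrow> bool"

section \<open>Sums over orderings and weighted sums over tuples\<close>

lemmas length_numeral_conv = eval_nat_numeral length_Suc_conv

fun picks :: "'a list \<Rightarrow> ('a \<times> 'a list) list" where
  "picks [] = []"
| "picks (x # xs) = (x, xs) # map (\<lambda>(y, ys). (y, x # ys)) (picks xs)"

primrec lsum :: "('a \<Rightarrow> 'b::comm_monoid_add) \<Rightarrow> 'a list \<Rightarrow> 'b" where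
  "lsum f [] = 0"
| "lsum f (x # xs) = f x + lsum f xs"

lemma lsum_add: "lsum (\<lambda>x. f x + g x) xs = lsum f xs + lsum g xs"
  by (induction xs) (simp_all add: algebra_simps)

lemma lsum_cong: "(\<And>x. x \<in> set xs \<Longrightarrow> f x = g x) \<Longrightarrow> lsum f xs = lsum g xs"
  by (induction xs) simp_all

lemma lsum_map: "lsum f (map g xs) = lsum (\<lambda>x. f (g x)) xs"
  by (induction xs) simp_all

lemma lsum_0: "lsum (\<lambda>x. 0) xs = 0"
  by (induction xs) simp_all

lemma lsum_const: "lsum (\<lambda>x. (c::int)) xs = int (length xs) * c"
  by (induction xs) (simp_all add: algebra_simps)

lemma lsum_upt: "lsum f [0..<n] = sum f {..<n}"
proof -
  have "lsum f (xs @ [x]) = lsum f xs + f x" for xs x by (induction xs) (simp_all add: algebra_simps)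
  then show ?thesis by (induction n) (simp_all add: lessThan_Suc algebra_simps)
qed

lemma picks_map: "picks (map f xs) = map (\<lambda>(y, ys). (f y, map f ys)) (picks xs)"
  by (induction xs) (auto simp: case_prod_unfold)

lemma picks_in:
  assumes "(y, ys) \<in> set (picks xs)"
  shows "mset xs = add_mset y (mset ys)" "y \<in> set xs" "set ys \<subseteq> set xs" "length xs = Suc (length ys)"
proof -
  have "mset xs = add_mset y (mset ys)"
    using assms by (induction xs arbitrary: y ys) auto
  then show "mset xs = add_mset y (mset ys)" "y \<in> set xs" "set ys \<subseteq> set xs" "length xs = Suc (length ys)"
    apply -
    subgoal by simp
    subgoal by (metis set_mset_mset union_single_eq_member)
    subgoal by (metis set_mset_mset set_mset_add_mset_insert subset_insertI)
    subgoal by (metis size_mset size_add_mset)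
    done
qed

lemma length_picks: "length (picks xs) = length xs"
  by (induction xs) simp_all

lemma lsum_picks_mset:
  "lsum (\<lambda>(y, ys). \<phi> y (mset ys)) (picks xs) = (\<Sum>y\<in>#mset xs. \<phi> y (mset xs - {#y#}))"
proof (induction xs arbitrary: \<phi>)
  case (Cons x xs)
  have "lsum (\<lambda>(y, ys). \<phi> y (mset ys)) (picks (x # xs))
      = \<phi> x (mset xs) + lsum (\<lambda>(y, ys). \<phi> y (add_mset x (mset ys))) (picks xs)"
    by (simp add: lsum_map case_prod_unfold)
  also have "lsum (\<lambda>(y, ys). \<phi> y (add_mset x (mset ys))) (picks xs)
      = (\<Sum>y\<in>#mset xs. \<phi> y (add_mset x (mset xs - {#y#})))"
    using Cons.IH[of "\<lambda>y M. \<phi> y (add_mset x M)"] .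
  also have "\<dots> = (\<Sum>y\<in>#mset xs. \<phi> y (mset (x # xs) - {#y#}))"
    by (intro arg_cong[where f=sum_mset] image_mset_cong) (auto simp: multiset_eq_iff)
  finally show ?case by simp
qed simp

text \<open>
  The sum of g over the injective ways to draw n entries from a list, that is over all orderings if n is the
  length. Drawing from a list can be executed; \<open>msum\<close> draws from a multiset instead and thereby
  shows that the order of the list is irrelevant.
\<close>
primrec psum :: "nat \<Rightarrow> ('a list \<Rightarrow> 'b::comm_monoid_add) \<Rightarrow> 'a list \<Rightarrow> 'b" where
  "psum 0 g xs = g []"
| "psum (Suc n) g xs = lsum (\<lambda>(y, ys). psum n (\<lambda>zs. g (y # zs)) ys) (picks xs)"

primrec msum :: "nat \<Rightarrow> ('a list \<Rightarrow> 'b::comm_monoid_add) \<Rightarrow> 'a multiset \<Rightarrow> 'b" where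
  "msum 0 g M = g []"
| "msum (Suc n) g M = (\<Sum>y\<in>#M. msum n (\<lambda>zs. g (y # zs)) (M - {#y#}))"

lemma psum_eq_msum: "psum n g xs = msum n g (mset xs)"
proof (induction n arbitrary: g xs)
  case (Suc n)
  show ?case
    using lsum_picks_mset[of "\<lambda>y. msum n (\<lambda>zs. g (y # zs))" xs] by (simp add: Suc)
qed simp

lemma psum_mset: "mset xs = mset ys \<Longrightarrow> psum n g xs = psum n g ys"
  by (simp add: psum_eq_msum)

lemma psum_add: "psum n (\<lambda>xs. f xs + g xs) xs = psum n f xs + psum n g xs"
  by (induction n arbitrary: f g xs) (simp_all add: lsum_add case_prod_unfold)

lemma psum_cong:
  "(\<And>zs. length zs = n \<Longrightarrow> f zs = g zs) \<Longrightarrow> psum n f xs = psum n g xs"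
proof (induction n arbitrary: f g xs)
  case (Suc n)
  have "psum n (\<lambda>zs. f (y # zs)) ys = psum n (\<lambda>zs. g (y # zs)) ys" for y ys
    by (rule Suc.IH) (simp add: Suc.prems)
  then show ?case by simp
qed simp

lemma psum_zero: "psum n (\<lambda>xs. 0) xs = 0"
  by (induction n arbitrary: xs) (simp_all add: lsum_0 case_prod_unfold)

lemma psum_cmult: "psum n (\<lambda>xs. (c::int) * f xs) xs = c * psum n f xs"
proof -
  have *: "lsum (\<lambda>x. c * f x) ys = c * lsum f ys" for f :: "'b \<Rightarrow> int" and ys by (induction ys) (simp_all add: algebra_simps)
  show ?thesis by (induction n arbitrary: f xs) (simp_all add: * case_prod_unfold)
qed

lemma psum_const: "length xs = n \<Longrightarrow> psum n (\<lambda>xs. (c::int)) xs = fact n * c"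
proof (induction n arbitrary: xs)
  case (Suc n)
  have "psum (Suc n) (\<lambda>xs. c) xs = lsum (\<lambda>(y, ys). psum n (\<lambda>zs. c) ys) (picks xs)" by simp
  also have "\<dots> = lsum (\<lambda>_. fact n * c) (picks xs)"
  proof (intro lsum_cong, clarify)
    fix y ys assume "(y, ys) \<in> set (picks xs)"
    from picks_in(4)[OF this] show "psum n (\<lambda>zs. c) ys = fact n * c"
      using Suc.prems by (intro Suc.IH) simp
  qed
  finally show ?case
    using Suc.prems by (simp add: lsum_const length_picks algebra_simps)
qed simp

lemma of_int_lsum: "of_int (lsum f xs) = lsum (\<lambda>x. of_int (f x)) xs"
  by (induction xs) simp_all

lemma of_int_psum: "of_int (psum n g xs) = psum n (\<lambda>xs. of_int (g xs)) xs"
  by (induction n arbitrary: g xs) (simp_all add: of_int_lsum case_prod_unfold)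

primrec wsum :: "'a set \<Rightarrow> ('a \<Rightarrow> real) \<Rightarrow> nat \<Rightarrow> ('a list \<Rightarrow> real) \<Rightarrow> real" where
  "wsum V w 0 f = f []"
| "wsum V w (Suc n) f = (\<Sum>x\<in>V. w x * wsum V w n (\<lambda>xs. f (x # xs)))"

lemma wsum_cong:
  "(\<And>xs. set xs \<subseteq> V \<Longrightarrow> length xs = n \<Longrightarrow> f xs = g xs) \<Longrightarrow> wsum V w n f = wsum V w n g"
proof (induction n arbitrary: f g)
  case (Suc n)
  have "wsum V w n (\<lambda>xs. f (x # xs)) = wsum V w n (\<lambda>xs. g (x # xs))" if "x \<in> V" for x
    by (rule Suc.IH) (use that in \<open>auto intro!: Suc.prems\<close>)
  then show ?case by simp
qed simp

lemma wsum_add: "wsum V w n (\<lambda>xs. f xs + g xs) = wsum V w n f + wsum V w n g"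
  by (induction n arbitrary: f g) (simp_all add: algebra_simps sum.distrib)

lemma wsum_cmult: "wsum V w n (\<lambda>xs. c * f xs) = c * wsum V w n f"
  by (induction n arbitrary: f) (simp_all add: algebra_simps sum_distrib_left)

lemma wsum_diff: "wsum V w n (\<lambda>xs. f xs - g xs) = wsum V w n f - wsum V w n g"
  using wsum_add[of V w n f "\<lambda>xs. (-1) * g xs"] by (simp only: wsum_cmult) simp

lemma wsum_const: "wsum V w n (\<lambda>xs. c) = c * sum w V ^ n"
  by (induction n) (simp_all add: sum_distrib_left sum_distrib_right algebra_simps)

lemma wsum_mono:
  assumes "\<And>x. x \<in> V \<Longrightarrow> 0 \<le> w x"
  shows "(\<And>xs. set xs \<subseteq> V \<Longrightarrow> length xs = n \<Longrightarrow> f xs \<le> g xs) \<Longrightarrow> wsum V w n f \<le> wsum V w n g"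
proof (induction n arbitrary: f g)
  case (Suc n)
  have "wsum V w n (\<lambda>xs. f (x # xs)) \<le> wsum V w n (\<lambda>xs. g (x # xs))" if "x \<in> V" for x
    by (rule Suc.IH) (use that in \<open>auto intro!: Suc.prems\<close>)
  then show ?case by (auto intro!: sum_mono mult_left_mono assms)
qed simp

lemma wsum_nonneg:
  assumes "\<And>x. x \<in> V \<Longrightarrow> 0 \<le> w x" "\<And>xs. set xs \<subseteq> V \<Longrightarrow> length xs = n \<Longrightarrow> 0 \<le> f xs"
  shows "0 \<le> wsum V w n f"
  using wsum_mono[of V w n "\<lambda>_. 0" f] assms by (simp add: wsum_const)

lemma wsum_picks:
  "wsum V w (Suc n) (\<lambda>xs. lsum (\<lambda>(y, ys). \<phi> y ys) (picks xs))
     = real (Suc n) * (\<Sum>y\<in>V. w y * wsum V w n (\<phi> y))"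
proof (induction n arbitrary: \<phi>)
  case (Suc n)
  have "wsum V w (Suc (Suc n)) (\<lambda>xs. lsum (\<lambda>(y, ys). \<phi> y ys) (picks xs))
      = (\<Sum>x\<in>V. w x * wsum V w (Suc n) (\<lambda>xs. \<phi> x xs + lsum (\<lambda>(y, ys). \<phi> y (x # ys)) (picks xs)))"
    by (subst wsum.simps) (simp add: lsum_map case_prod_unfold del: wsum.simps)
  also have "\<dots> = (\<Sum>x\<in>V. w x * wsum V w (Suc n) (\<phi> x))
      + (\<Sum>x\<in>V. w x * (real (Suc n) * (\<Sum>y\<in>V. w y * wsum V w n (\<lambda>ys. \<phi> y (x # ys)))))"
    by (simp only: wsum_add Suc.IH distrib_left sum.distrib)
  also have "(\<Sum>x\<in>V. w x * (real (Suc n) * (\<Sum>y\<in>V. w y * wsum V w n (\<lambda>ys. \<phi> y (x # ys)))))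
      = real (Suc n) * (\<Sum>x\<in>V. \<Sum>y\<in>V. w x * (w y * wsum V w n (\<lambda>ys. \<phi> y (x # ys))))"
    by (simp add: sum_distrib_left algebra_simps)
  also have "(\<Sum>x\<in>V. \<Sum>y\<in>V. w x * (w y * wsum V w n (\<lambda>ys. \<phi> y (x # ys))))
      = (\<Sum>y\<in>V. w y * (\<Sum>x\<in>V. w x * wsum V w n (\<lambda>ys. \<phi> y (x # ys))))"
    by (subst sum.swap) (simp add: sum_distrib_left algebra_simps)
  also have "(\<Sum>y\<in>V. w y * (\<Sum>x\<in>V. w x * wsum V w n (\<lambda>ys. \<phi> y (x # ys))))
      = (\<Sum>y\<in>V. w y * wsum V w (Suc n) (\<phi> y))"
    by simp
  finally show ?case by (simp add: algebra_simps del: wsum.simps)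
qed simp

text \<open>
  Averaging over orderings: a weighted sum over all tuples is invariant under permuting the positions, so that
  a pointwise bound is only needed after symmetrisation.
\<close>
lemma wsum_psum: "wsum V w n (psum n g) = fact n * wsum V w n g"
proof (induction n arbitrary: g)
  case (Suc n)
  have "wsum V w (Suc n) (psum (Suc n) g)
      = real (Suc n) * (\<Sum>y\<in>V. w y * wsum V w n (psum n (\<lambda>zs. g (y # zs))))"
    using wsum_picks[of V w n "\<lambda>y. psum n (\<lambda>zs. g (y # zs))"] by simp
  then show ?case by (simp add: Suc.IH sum_distrib_left algebra_simps)
qed simp

lemma wsum_append: "wsum V w (m + n) g = wsum V w m (\<lambda>xs. wsum V w n (\<lambda>ys. g (xs @ ys)))"
  by (induction m arbitrary: g) simp_all

lemma wsum_sum: "wsum V w n (\<lambda>xs. \<Sum>i\<in>I. f i xs) = (\<Sum>i\<in>I. wsum V w n (f i))"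
proof (induction n arbitrary: f)
  case (Suc n)
  show ?case by (simp add: Suc.IH sum_distrib_left) (rule sum.swap)
qed simp

lemma wsum2: "wsum V w 2 f = (\<Sum>x\<in>V. w x * (\<Sum>y\<in>V. w y * f [x, y]))"
  by (simp add: eval_nat_numeral)

lemma wsum_abs_le:
  assumes "\<And>x. x \<in> V \<Longrightarrow> 0 \<le> w x"
  shows "\<bar>wsum V w n f\<bar> \<le> wsum V w n (\<lambda>xs. \<bar>f xs\<bar>)"
proof -
  have "wsum V w n f \<le> wsum V w n (\<lambda>xs. \<bar>f xs\<bar>)" by (rule wsum_mono[OF assms]) auto
  moreover have "wsum V w n (\<lambda>xs. (-1) * f xs) \<le> wsum V w n (\<lambda>xs. \<bar>f xs\<bar>)" by (rule wsum_mono[OF assms]) auto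
  ultimately show ?thesis by (simp only: wsum_cmult)
qed

lemma wsum_le_const:
  assumes "\<And>xs. set xs \<subseteq> V \<Longrightarrow> length xs = n \<Longrightarrow> f xs \<le> c"
  shows "wsum V (\<lambda>_. 1) n f \<le> c * real (card V) ^ n"
  using wsum_mono[of V "\<lambda>_. 1" n f "\<lambda>_. c"] assms by (simp add: wsum_const)

text \<open>
  Telescoping over the n factors, each of which changes by at most a factor \<open>1 + \<theta>\<close>.
\<close>
lemma wsum_perturb:
  assumes w: "\<And>x. x \<in> V \<Longrightarrow> \<bar>w x - 1\<bar> \<le> \<theta>" and \<theta>: "0 \<le> \<theta>"
  shows "\<bar>wsum V w n f - wsum V (\<lambda>_. 1) n f\<bar> \<le> ((1 + \<theta>) ^ n - 1) * wsum V (\<lambda>_. 1) n (\<lambda>xs. \<bar>f xs\<bar>)"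
proof (induction n arbitrary: f)
  case (Suc n)
  let ?A = "\<lambda>x. wsum V w n (\<lambda>xs. f (x # xs))" and ?B = "\<lambda>x. wsum V (\<lambda>_. 1) n (\<lambda>xs. f (x # xs))"
    and ?C = "\<lambda>x. wsum V (\<lambda>_. 1) n (\<lambda>xs. \<bar>f (x # xs)\<bar>)"
  have each: "\<bar>w x * ?A x - ?B x\<bar> \<le> ((1 + \<theta>) ^ Suc n - 1) * ?C x" if x: "x \<in> V" for x
  proof -
    have C: "\<bar>?B x\<bar> \<le> ?C x" by (rule wsum_abs_le) simp
    have "w x * ?A x - ?B x = w x * (?A x - ?B x) + (w x - 1) * ?B x" by (simp add: algebra_simps)
    then have "\<bar>w x * ?A x - ?B x\<bar> \<le> \<bar>w x\<bar> * \<bar>?A x - ?B x\<bar> + \<bar>w x - 1\<bar> * \<bar>?B x\<bar>"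
      by (metis abs_mult abs_triangle_ineq)
    also have "\<dots> \<le> (1 + \<theta>) * (((1 + \<theta>) ^ n - 1) * ?C x) + \<theta> * ?C x"
      using w[OF x] Suc.IH C \<theta> by (intro add_mono mult_mono) auto
    also have "\<dots> = ((1 + \<theta>) ^ Suc n - 1) * ?C x" by (simp add: algebra_simps)
    finally show ?thesis .
  qed
  have "\<bar>wsum V w (Suc n) f - wsum V (\<lambda>_. 1) (Suc n) f\<bar> = \<bar>\<Sum>x\<in>V. w x * ?A x - ?B x\<bar>"
    by (simp add: sum_subtractf)
  also have "\<dots> \<le> (\<Sum>x\<in>V. \<bar>w x * ?A x - ?B x\<bar>)" by (rule sum_abs)
  also have "\<dots> \<le> (\<Sum>x\<in>V. ((1 + \<theta>) ^ Suc n - 1) * ?C x)" by (rule sum_mono) (rule each)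
  finally show ?case by (simp add: sum_distrib_left)
qed simp

lemma wsum_card:
  assumes "finite V"
  shows "wsum V (\<lambda>_. 1) n (\<lambda>xs. of_bool (P xs)) = real (card {xs. set xs \<subseteq> V \<and> length xs = n \<and> P xs})"
proof (induction n arbitrary: P)
  case 0
  have "{xs. set xs \<subseteq> V \<and> length xs = 0 \<and> P xs} = (if P [] then {[]} else {})" by auto
  then show ?case by simp
next
  case (Suc n)
  have "{xs. set xs \<subseteq> V \<and> length xs = Suc n \<and> P xs}
      = (\<Union>x\<in>V. (#) x ` {xs. set xs \<subseteq> V \<and> length xs = n \<and> P (x # xs)})"
    by (auto simp: length_Suc_conv)
  moreover have "card \<dots> = (\<Sum>x\<in>V. card ((#) x ` {xs. set xs \<subseteq> V \<and> length xs = n \<and> P (x # xs)}))"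
  proof (rule card_UN_disjoint[OF assms])
    show "\<forall>x\<in>V. finite ((#) x ` {xs. set xs \<subseteq> V \<and> length xs = n \<and> P (x # xs)})"
      using finite_lists_length_eq[OF assms, of n] by (auto intro!: finite_imageI intro: finite_subset[rotated])
  qed auto
  ultimately show ?case by (simp add: Suc.IH card_image)
qed

lemma lsum_nonneg: "(\<And>x. x \<in> set xs \<Longrightarrow> 0 \<le> f x) \<Longrightarrow> 0 \<le> lsum f xs" for f :: "'a \<Rightarrow> real"
  by (induction xs) auto

lemma lsum_member: "(\<And>x. 0 \<le> f x) \<Longrightarrow> y \<in> set xs \<Longrightarrow> f y \<le> lsum f xs" for f :: "'a \<Rightarrow> real"
proof (induction xs)
  case (Cons a xs)
  have "0 \<le> lsum f xs" using Cons.prems(1) by (intro lsum_nonneg) auto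
  then show ?case using Cons by (auto intro: add_increasing add_increasing2)
qed simp

primrec pair_sum :: "('a \<Rightarrow> 'a \<Rightarrow> real) \<Rightarrow> 'a list \<Rightarrow> real" where
  "pair_sum g [] = 0"
| "pair_sum g (x # xs) = lsum (g x) xs + pair_sum g xs"

lemma pair_sum_nonneg: "(\<And>x y. 0 \<le> g x y) \<Longrightarrow> 0 \<le> pair_sum g xs"
  by (induction xs) (auto intro!: add_nonneg_nonneg lsum_nonneg)

lemma wsum_lsum:
  "wsum V w n (lsum h) = real n * sum w V ^ (n - 1) * (\<Sum>x\<in>V. w x * h x)"
proof (induction n)
  case (Suc n)
  have "wsum V w (Suc n) (lsum h) = (\<Sum>x\<in>V. w x * (h x * sum w V ^ n + wsum V w n (lsum h)))"
    by (simp add: wsum_add wsum_const)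
  also have "\<dots> = sum w V ^ n * (\<Sum>x\<in>V. w x * h x) + sum w V * wsum V w n (lsum h)"
    by (simp add: sum.distrib distrib_left sum_distrib_left sum_distrib_right algebra_simps)
  also have "sum w V * wsum V w n (lsum h) = real n * sum w V ^ n * (\<Sum>x\<in>V. w x * h x)"
    unfolding Suc.IH by (cases n) simp_all
  finally show ?case by (simp add: algebra_simps)
qed simp

text \<open>
  This counts tuples with multiplicity according to how many of their pairs of entries lie in a given
  relation; it bounds the number of tuples that contain a pair on which two graphs differ.
\<close>
lemma wsum_pair_sum:
  "wsum V w n (pair_sum g) = real (n choose 2) * sum w V ^ (n - 2) * (\<Sum>x\<in>V. \<Sum>y\<in>V. w x * w y * g x y)"
proof (induction n)
  case (Suc n)
  let ?D = "\<Sum>x\<in>V. \<Sum>y\<in>V. w x * w y * g x y"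
  have "wsum V w (Suc n) (pair_sum g) = (\<Sum>x\<in>V. w x * (wsum V w n (lsum (g x)) + wsum V w n (pair_sum g)))"
    by (simp add: wsum_add)
  also have "\<dots> = real n * sum w V ^ (n - 1) * ?D + sum w V * wsum V w n (pair_sum g)"
    by (simp add: wsum_lsum sum.distrib distrib_left sum_distrib_left sum_distrib_right algebra_simps)
  also have "sum w V * wsum V w n (pair_sum g) = real (n choose 2) * sum w V ^ (n - 1) * ?D"
  proof (cases "n < 2")
    case False
    then obtain k where "n = Suc (Suc k)" by (metis add_2_eq_Suc le_add_diff_inverse not_less)
    then show ?thesis unfolding Suc.IH by simp
  qed (auto simp: Suc.IH less_2_cases_iff)
  finally show ?case by (simp add: eval_nat_numeral algebra_simps)
qed simp

section \<open>The pattern F49 and the hexagon in a reflexive relation\<close>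

datatype six = I0 | I1 | I2 | I3 | I4 | I5

primrec select6 :: "six \<Rightarrow> 'b \<Rightarrow> 'b \<Rightarrow> 'b \<Rightarrow> 'b \<Rightarrow> 'b \<Rightarrow> 'b \<Rightarrow> 'b" where
  "select6 I0 a b c d e f = a" | "select6 I1 a b c d e f = b" | "select6 I2 a b c d e f = c"
| "select6 I3 a b c d e f = d" | "select6 I4 a b c d e f = e" | "select6 I5 a b c d e f = f"

primrec hex :: "six \<Rightarrow> six \<Rightarrow> bool" where
  "hex I0 j = select6 j True True False False False True"
| "hex I1 j = select6 j True True True False False False"
| "hex I2 j = select6 j False True True True False False"
| "hex I3 j = select6 j False False True True True False"
| "hex I4 j = select6 j False False False True True True"
| "hex I5 j = select6 j True False False False True True"

text \<open>
  On the hexagon with corners 0, ..., 5, the induced path 0, 1, 2 distinguishes all corners by their adjacency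
  to it. The two adjacency patterns that no corner has, the middle vertex alone and the two ends without the
  middle, yield \<open>None\<close>.
\<close>
definition class_of_bits :: "bool \<Rightarrow> bool \<Rightarrow> bool \<Rightarrow> six option" where
  "class_of_bits a b c = (if a then (if b then (if c then Some I1 else Some I0) else (if c then None else Some I5))
     else (if b then (if c then Some I2 else None) else (if c then Some I3 else Some I4)))"

definition class_of :: "'a reln \<Rightarrow> 'a \<Rightarrow> 'a \<Rightarrow> 'a \<Rightarrow> 'a \<Rightarrow> six option" where
  "class_of R a b c x = class_of_bits (R a x) (R b x) (R c x)"

definition misfit :: "six option \<Rightarrow> six option \<Rightarrow> bool \<Rightarrow> bool" where
  "misfit i j b = (case i of None \<Rightarrow> True | Some i' \<Rightarrow> (case j of None \<Rightarrow> True | Some j' \<Rightarrow> b \<noteq> hex i' j'))"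

definition p3 :: "'a reln \<Rightarrow> 'a \<Rightarrow> 'a \<Rightarrow> 'a \<Rightarrow> bool" where
  "p3 R a b c \<longleftrightarrow> R a b \<and> R b c \<and> \<not> R a c"

text \<open>
  After an induced path a-b-c, this completes F49: d extends the path to an induced path on four vertices, and
  d, e, f form a triangle whose other two vertices have no neighbour on a-b-c. In terms of hexagon corners, d
  is at 3 and e, f are at 4. Nothing prevents e = f when R is reflexive.
\<close>
definition completes_F49 :: "'a reln \<Rightarrow> 'a \<Rightarrow> 'a \<Rightarrow> 'a \<Rightarrow> 'a \<Rightarrow> 'a \<Rightarrow> 'a \<Rightarrow> bool" where
  "completes_F49 R a b c d e f \<longleftrightarrow> class_of R a b c d = Some I3 \<and> class_of R a b c e = Some I4 \<and> class_of R a b c f = Some I4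
     \<and> R d e \<and> R d f \<and> R e f"

definition is_F49 :: "'a reln \<Rightarrow> 'a list \<Rightarrow> bool" where
  "is_F49 R xs = (case xs of [a,b,c,d,e,f] \<Rightarrow> p3 R a b c \<and> completes_F49 R a b c d e f | _ \<Rightarrow> False)"

definition misfit5 :: "'a reln \<Rightarrow> 'a list \<Rightarrow> bool" where
  "misfit5 R xs = (case xs of [a,b,c,e,f] \<Rightarrow> p3 R a b c \<and> misfit (class_of R a b c e) (class_of R a b c f) (R e f) | _ \<Rightarrow> False)"

abbreviation F49_sum :: "'a set \<Rightarrow> ('a \<Rightarrow> real) \<Rightarrow> 'a reln \<Rightarrow> real" where
  "F49_sum V w R \<equiv> wsum V w 6 (\<lambda>xs. of_bool (is_F49 R xs))"

abbreviation misfit_sum :: "'a set \<Rightarrow> ('a \<Rightarrow> real) \<Rightarrow> 'a reln \<Rightarrow> real" where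
  "misfit_sum V w R \<equiv> wsum V w 5 (\<lambda>xs. of_bool (misfit5 R xs))"

section \<open>The quadratic forms of the certificate\<close>

text \<open>
  A flag is the adjacency pattern of one or two further points over an ordered base. Flags are a datatype
  rather than numbers so that rewriting reaches the rows of the matrices below by constructor matching.
\<close>
datatype flag = F0 | F1 | F2 | F3 | F4 | F5 | F6 | F7 | F8 | F9 | F10 | F11 | F12 | F13 | F14 | F15 | F16 | F17 | F18 | F19

primrec pos :: "flag \<Rightarrow> nat" where
"pos F0 = 0"
| "pos F1 = Suc 0"
| "pos F2 = Suc (Suc 0)"
| "pos F3 = Suc (Suc (Suc 0))"
| "pos F4 = Suc (Suc (Suc (Suc 0)))"
| "pos F5 = Suc (Suc (Suc (Suc (Suc 0))))"
| "pos F6 = Suc (Suc (Suc (Suc (Suc (Suc 0)))))"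
| "pos F7 = Suc (Suc (Suc (Suc (Suc (Suc (Suc 0))))))"
| "pos F8 = Suc (Suc (Suc (Suc (Suc (Suc (Suc (Suc 0)))))))"
| "pos F9 = Suc (Suc (Suc (Suc (Suc (Suc (Suc (Suc (Suc 0))))))))"
| "pos F10 = Suc (Suc (Suc (Suc (Suc (Suc (Suc (Suc (Suc (Suc 0)))))))))"
| "pos F11 = Suc (Suc (Suc (Suc (Suc (Suc (Suc (Suc (Suc (Suc (Suc 0))))))))))"
| "pos F12 = Suc (Suc (Suc (Suc (Suc (Suc (Suc (Suc (Suc (Suc (Suc (Suc 0)))))))))))"
| "pos F13 = Suc (Suc (Suc (Suc (Suc (Suc (Suc (Suc (Suc (Suc (Suc (Suc (Suc 0))))))))))))"
| "pos F14 = Suc (Suc (Suc (Suc (Suc (Suc (Suc (Suc (Suc (Suc (Suc (Suc (Suc (Suc 0)))))))))))))"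
| "pos F15 = Suc (Suc (Suc (Suc (Suc (Suc (Suc (Suc (Suc (Suc (Suc (Suc (Suc (Suc (Suc 0))))))))))))))"
| "pos F16 = Suc (Suc (Suc (Suc (Suc (Suc (Suc (Suc (Suc (Suc (Suc (Suc (Suc (Suc (Suc (Suc 0)))))))))))))))"
| "pos F17 = Suc (Suc (Suc (Suc (Suc (Suc (Suc (Suc (Suc (Suc (Suc (Suc (Suc (Suc (Suc (Suc (Suc 0))))))))))))))))"
| "pos F18 = Suc (Suc (Suc (Suc (Suc (Suc (Suc (Suc (Suc (Suc (Suc (Suc (Suc (Suc (Suc (Suc (Suc (Suc 0)))))))))))))))))"
| "pos F19 = Suc (Suc (Suc (Suc (Suc (Suc (Suc (Suc (Suc (Suc (Suc (Suc (Suc (Suc (Suc (Suc (Suc (Suc (Suc 0))))))))))))))))))"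

definition flags16 :: "flag list" where
  "flags16 = [F0,F1,F2,F3,F4,F5,F6,F7,F8,F9,F10,F11,F12,F13,F14,F15]"

definition flags20 :: "flag list" where
  "flags20 = [F0,F1,F2,F3,F4,F5,F6,F7,F8,F9,F10,F11,F12,F13,F14,F15,F16,F17,F18,F19]"

text \<open>One point over a base of four points; the index has binary digits a, b, c, d, lowest first.\<close>
definition tflag :: "bool \<Rightarrow> bool \<Rightarrow> bool \<Rightarrow> bool \<Rightarrow> flag" where
  "tflag a b c d =
     (if a then (if b then (if c then (if d then F15 else F7) else (if d then F11 else F3)) else (if c then
     (if d then F13 else F5) else (if d then F9 else F1))) else (if b then (if c then (if d then F14 else F6)
     else (if d then F10 else F2)) else (if c then (if d then F12 else F4) else (if d then F8 else F0))))"

lemma pos_flags20: "pos x < length flags20" "flags20 ! pos x = x"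
  by (cases x; simp add: flags20_def)+

lemma pos_flags16: "x \<in> set flags16 \<Longrightarrow> pos x < length flags16 \<and> flags16 ! pos x = x"
  by (auto simp: flags16_def)

lemma tflag_in: "tflag a b c d \<in> set flags16"
  by (simp add: tflag_def flags16_def)

lemma pos_inj: "pos x = pos y \<longleftrightarrow> x = y"
  by (metis pos_flags20(2))

text \<open>
  An unordered pair of points over a base of two points. The first point has adjacencies a and b to the base,
  the second c and d, and e tells whether the two points are related. Two flags exist for each of the ten
  unordered pairs of adjacency patterns.
\<close>
definition pflag :: "bool \<Rightarrow> bool \<Rightarrow> bool \<Rightarrow> bool \<Rightarrow> bool \<Rightarrow> flag" where
  "pflag a b c d e =
     (if a then (if b then (if c then (if d then (if e then F19 else F18) else (if e then F13 else F12)) else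
     (if d then (if e then F17 else F16) else (if e then F7 else F6))) else (if c then (if d then (if e then
     F13 else F12) else (if e then F9 else F8)) else (if d then (if e then F11 else F10) else (if e then F3
     else F2)))) else (if b then (if c then (if d then (if e then F17 else F16) else (if e then F11 else
     F10)) else (if d then (if e then F15 else F14) else (if e then F5 else F4))) else (if c then (if d then
     (if e then F7 else F6) else (if e then F3 else F2)) else (if d then (if e then F5 else F4) else (if e
     then F1 else F0)))))"

lemma pflag_sym: "pflag a b c d e = pflag c d a b e"
  by (cases a; cases b; cases c; cases d; simp add: pflag_def)

text \<open>
  Only the lower triangle of each symmetric matrix is stored, so an entry beyond the end of a row is found in
  the other row.
\<close>
definition sym_nth :: "(flag \<Rightarrow> int list) \<Rightarrow> flag \<Rightarrow> flag \<Rightarrow> int" where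
  "sym_nth q x y = (case drop (pos y) (q x) of v # _ \<Rightarrow> v | [] \<Rightarrow> q y ! pos x)"

lemma sym_nth_commute:
  assumes len: "\<And>x. x \<in> A \<Longrightarrow> length (q x) = Suc (pos x)" and xy: "x \<in> A" "y \<in> A"
  shows "sym_nth q x y = sym_nth q y x"
proof -
  have *: "sym_nth q x y = q x ! pos y" "sym_nth q y x = q x ! pos y" if "x \<in> A" "y \<in> A" "pos y < pos x" for x y
  proof -
    have "drop (pos y) (q x) = q x ! pos y # drop (Suc (pos y)) (q x)"
      using len[OF that(1)] that(3) by (intro Cons_nth_drop_Suc[symmetric]) simp
    then show "sym_nth q x y = q x ! pos y" by (simp add: sym_nth_def)
    have "drop (pos x) (q y) = []" using len[OF that(2)] that(3) by simp
    then show "sym_nth q y x = q x ! pos y" by (simp add: sym_nth_def)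
  qed
  consider "pos y < pos x" | "pos x < pos y" | "x = y" using pos_inj by (metis nat_neq_iff)
  then show ?thesis using * xy by cases auto
qed

text \<open>
  The matrices come from a numerical solution of the semidefinite program of F49, rounded to integers such
  that the vectors that the extremal structure forces into the kernel stay there. Five of them have as base an
  induced path a-b-c together with a fourth point d, and are named after the graph on a, b, c, d: d is
  adjacent to no vertex (copaw), to b (claw), to c (path), to a and b (paw), or to a and c (cycle). The
  remaining two have as base a pair of unrelated or related points.
\<close>
primrec q_copaw :: "flag \<Rightarrow> int list" where
  "q_copaw F0 = [2691]"
| "q_copaw F1 = [-2745,4244]"
| "q_copaw F2 = [-500,-634,1191]"
| "q_copaw F3 = [-3377,6402,-1423,11065]"
| "q_copaw F4 = [-2297,3383,-445,4916,2741]"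
| "q_copaw F5 = [-1133,587,886,632,503,992]"
| "q_copaw F6 = [648,-1254,275,-2331,-924,-121,656]"
| "q_copaw F7 = [-380,540,225,1275,370,454,-248,538]"
| "q_copaw F8 = [877,693,-1209,2575,349,-710,-501,436,2408]"
| "q_copaw F9 = [-2508,3703,-464,5722,2902,550,-1462,378,316,4004]"
| "q_copaw F10 = [1727,-2353,-1206,-5808,-1581,-2233,1120,-2564,-2016,-1604,12453]"
| "q_copaw F11 = [1628,-2735,588,-4195,-2177,-217,818,-291,-616,-2371,1226,1805]"
| "q_copaw F12 = [4740,-10084,2596,-18306,-7613,-805,3886,-2379,-5234,-8958,10872,6655,30991]"
| "q_copaw F13 = [-1640,1707,341,2226,1411,756,-427,331,-424,1535,-1538,-1005,-3241,1033]"
| "q_copaw F14 = [1421,-2341,501,-3507,-1876,-178,665,-212,-457,-2001,869,1538,5512,-869,1332]"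
| "q_copaw F15 = [-1620,3090,-1118,4499,2493,-235,-866,-63,692,2699,552,-2109,-6961,926,-1833,2860]"

primrec q_claw :: "flag \<Rightarrow> int list" where
  "q_claw F0 = [204]"
| "q_claw F1 = [-73,1866]"
| "q_claw F2 = [-45,-35,23]"
| "q_claw F3 = [263,-697,-91,1506]"
| "q_claw F4 = [-73,150,-35,818,1866]"
| "q_claw F5 = [96,-107,19,-618,-107,1283]"
| "q_claw F6 = [263,818,-91,152,-697,-618,1506]"
| "q_claw F7 = [-312,539,110,-1542,539,1791,-1542,3885]"
| "q_claw F8 = [-73,150,-35,818,150,-1534,818,-2237,1866]"
| "q_claw F9 = [96,-107,19,-618,-1534,82,649,-529,-107,1283]"
| "q_claw F10 = [263,818,-91,152,818,649,152,923,-697,-618,1506]"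
| "q_claw F11 = [-312,539,110,-1542,-2237,-529,923,-641,539,1791,-1542,3885]"
| "q_claw F12 = [96,-1534,19,649,-107,82,-618,-529,-107,82,-618,-529,1283]"
| "q_claw F13 = [-99,-114,34,-224,-114,70,-224,268,-114,70,-224,268,70,93]"
| "q_claw F14 = [-312,-2237,110,923,539,-529,-1542,-641,539,-529,-1542,-641,1791,268,3885]"
| "q_claw F15 = [9,-238,16,-127,-238,190,-127,156,-238,190,-127,156,190,46,156,89]"

primrec q_path :: "flag \<Rightarrow> int list" where
  "q_path F0 = [8218]"
| "q_path F1 = [2888,18892]"
| "q_path F2 = [1926,1698,528]"
| "q_path F3 = [-368,892,-12,724]"
| "q_path F4 = [1423,-1620,212,-247,514]"
| "q_path F5 = [-877,-1750,-270,-359,50,486]"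
| "q_path F6 = [-550,-671,-220,560,-103,-377,1356]"
| "q_path F7 = [-556,-6806,-428,115,664,349,-348,5040]"
| "q_path F8 = [671,4218,355,5,-339,-429,-153,-1523,1176]"
| "q_path F9 = [-2902,69,-685,743,-696,-255,1462,-769,21,2401]"
| "q_path F10 = [-1105,-3256,-388,-171,161,437,-323,1792,-743,-260,881]"
| "q_path F11 = [-1362,-3185,-492,-718,140,753,-237,-20,-661,-81,510,1503]"
| "q_path F12 = [-2922,-15951,-1591,-761,1260,1443,1157,4760,-3517,687,2442,2989,14002]"
| "q_path F13 = [-318,3698,199,503,-522,-372,-481,72,779,-58,-169,-1133,-3659,1689]"
| "q_path F14 = [287,-1245,-22,-975,282,746,-545,-1586,-359,-751,-64,1595,1467,-1393,2698]"
| "q_path F15 = [-2427,9565,70,113,-1592,-171,-1290,-3185,2234,329,-925,-791,-8330,2660,-397,7921]"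

primrec q_paw :: "flag \<Rightarrow> int list" where
  "q_paw F0 = [2424]"
| "q_paw F1 = [-1978,4292]"
| "q_paw F2 = [-1031,1346,912]"
| "q_paw F3 = [419,-2177,-31,2175]"
| "q_paw F4 = [-2628,3429,2472,402,7819]"
| "q_paw F5 = [2377,-2904,-1317,964,-2997,2935]"
| "q_paw F6 = [-1281,1383,776,-289,1593,-1651,1046]"
| "q_paw F7 = [1694,-5876,-1557,3015,-4895,2946,-1107,9878]"
| "q_paw F8 = [-1978,123,1346,1649,3429,-1833,1383,1519,4292]"
| "q_paw F9 = [1043,-1627,-1087,-67,-2574,1742,-1193,1948,-1627,2011]"
| "q_paw F10 = [419,1649,-31,-1354,402,-21,-289,-3787,-2177,-67,2175]"
| "q_paw F11 = [-669,-212,-491,-707,-1937,-275,58,1417,-212,983,-707,1945]"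
| "q_paw F12 = [2377,-1833,-1317,-21,-2997,2650,-1651,1042,-2904,1742,964,-275,2935]"
| "q_paw F13 = [1132,-1129,-586,432,-1063,1374,-830,592,-1129,683,432,-443,1374,828]"
| "q_paw F14 = [1694,1519,-1557,-3787,-4895,1042,-1107,-3278,-5876,1948,3015,1417,2946,592,9878]"
| "q_paw F15 = [1111,-995,-639,242,-2273,804,-223,943,-995,-270,242,-380,804,521,943,2035]"

primrec q_cycle :: "flag \<Rightarrow> int list" where
  "q_cycle F0 = [9]"
| "q_cycle F1 = [0,1311]"
| "q_cycle F2 = [0,-1161,1311]"
| "q_cycle F3 = [0,-191,-191,738]"
| "q_cycle F4 = [0,1020,-1161,191,1311]"
| "q_cycle F5 = [0,-229,229,0,-229,54]"
| "q_cycle F6 = [0,191,-191,-212,-191,0,738]"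
| "q_cycle F7 = [0,561,-497,-87,561,-111,-87,310]"
| "q_cycle F8 = [0,-1161,1020,191,-1161,229,191,-626,1311]"
| "q_cycle F9 = [0,-191,191,-212,191,0,-304,87,-191,738]"
| "q_cycle F10 = [0,229,-229,0,229,-45,0,111,-229,0,54]"
| "q_cycle F11 = [0,-497,561,-87,-626,111,87,-271,561,-87,-111,310]"
| "q_cycle F12 = [0,191,191,-304,-191,0,-212,87,-191,-212,0,87,738]"
| "q_cycle F13 = [0,561,-626,87,561,-111,87,242,-497,-87,111,-271,-87,310]"
| "q_cycle F14 = [0,-626,561,87,-497,111,-87,-271,561,87,-111,242,-87,-271,310]"
| "q_cycle F15 = [0,0,0,0,0,0,0,0,0,0,0,0,0,0,0,9]"

primrec q_nonadj :: "flag \<Rightarrow> int list" where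
  "q_nonadj F0 = [120]"
| "q_nonadj F1 = [-232,1310]"
| "q_nonadj F2 = [-212,655,589]"
| "q_nonadj F3 = [-227,281,224,850]"
| "q_nonadj F4 = [16,318,-50,-145,529]"
| "q_nonadj F5 = [-288,106,560,618,-571,1398]"
| "q_nonadj F6 = [105,-852,-358,-187,-78,-2,770]"
| "q_nonadj F7 = [1,70,8,141,-203,110,-241,250]"
| "q_nonadj F8 = [232,-970,-352,-933,66,-316,969,-486,2039]"
| "q_nonadj F9 = [-11,191,103,-22,-69,59,-221,114,-225,122]"
| "q_nonadj F10 = [32,104,-17,-89,53,-183,-137,42,-108,38,68]"
| "q_nonadj F11 = [-310,-461,306,852,-448,1463,672,-190,210,-243,-359,2500]"
| "q_nonadj F12 = [150,-960,-242,-752,-20,25,996,-496,1936,-227,-154,656,2026]"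
| "q_nonadj F13 = [502,-1007,-1241,-742,486,-1762,521,-85,718,-191,133,-1423,304,3089]"
| "q_nonadj F14 = [437,-1055,-1051,-1009,802,-1714,998,-604,1790,-409,21,-814,1442,2737,3653]"
| "q_nonadj F15 = [-67,443,157,268,-29,51,-451,222,-773,122,56,-295,-805,-249,-723,362]"
| "q_nonadj F16 = [82,-314,-382,2,386,-586,380,-252,331,-250,-33,57,222,967,1340,-194,801]"
| "q_nonadj F17 = [34,-444,122,-119,-789,732,49,308,150,177,-28,278,214,-738,-1175,13,-782,1422]"
| "q_nonadj F18 = [-116,495,289,158,120,129,-287,-5,-344,53,17,-14,-310,-501,-433,143,-104,-188,213]"
| "q_nonadj F19 = [-36,-244,-3,-51,154,94,454,-330,688,-189,-114,659,774,-65,675,-349,338,-314,-27,546]"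

primrec q_adj :: "flag \<Rightarrow> int list" where
  "q_adj F0 = [670]"
| "q_adj F1 = [-443,444]"
| "q_adj F2 = [-744,318,1249]"
| "q_adj F3 = [1039,-157,-2155,4502]"
| "q_adj F4 = [-465,-112,1291,-2919,2031]"
| "q_adj F5 = [1749,-1264,-2015,2520,-1078,4956]"
| "q_adj F6 = [-248,171,230,-310,106,-614,144]"
| "q_adj F7 = [1587,-1349,-1299,1304,-160,4202,-802,5249]"
| "q_adj F8 = [204,-95,-341,540,-323,587,-55,332,109]"
| "q_adj F9 = [-687,557,681,-718,206,-1938,264,-1859,-198,822]"
| "q_adj F10 = [720,-240,-1237,2359,-1452,1785,-278,1382,316,-595,1392]"
| "q_adj F11 = [-360,291,325,-367,96,-956,168,-1108,-85,412,-333,248]"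
| "q_adj F12 = [567,-765,54,-933,1032,1567,-347,2599,-13,-846,-117,-518,1934]"
| "q_adj F13 = [-452,562,107,494,-608,-1346,215,-1727,-47,648,15,358,-1239,898]"
| "q_adj F14 = [-11,246,-382,1146,-888,-155,36,-556,86,179,493,96,-781,519,496]"
| "q_adj F15 = [-481,233,719,-1292,742,-1230,176,-1011,-184,442,-763,240,-114,112,-203,478]"
| "q_adj F16 = [584,-806,59,-1006,1091,1647,-349,2687,-12,-891,-139,-540,1999,-1308,-830,-111,2107]"
| "q_adj F17 = [-154,93,163,-337,166,-328,91,-513,-28,145,-231,109,-177,75,-30,145,-177,97]"
| "q_adj F18 = [111,-317,220,-987,834,564,39,235,-14,-278,-516,-49,605,-525,-487,172,643,123,1008]"
| "q_adj F19 = [-191,202,114,17,-114,-570,59,-567,-39,253,-52,123,-361,274,142,81,-382,27,-215,120]"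

definition q_pair :: "bool \<Rightarrow> flag \<Rightarrow> flag \<Rightarrow> int" where
  "q_pair t = sym_nth (if t then q_adj else q_nonadj)"

definition q_quad :: "bool \<Rightarrow> bool \<Rightarrow> bool \<Rightarrow> flag \<Rightarrow> flag \<Rightarrow> int" where
  "q_quad a b c x y =
     (if a then (if b then (if c then 0 else sym_nth q_paw x y) else (if c then sym_nth q_cycle x y else 0))
      else (if b then (if c then 0 else sym_nth q_claw x y)
        else (if c then sym_nth q_path x y else sym_nth q_copaw x y)))"

definition pair_entry :: "'a reln \<Rightarrow> 'a \<Rightarrow> 'a \<Rightarrow> 'a \<Rightarrow> 'a \<Rightarrow> 'a \<Rightarrow> 'a \<Rightarrow> int" where
  "pair_entry R a b c d e f =
     q_pair (R a b) (pflag (R a c) (R b c) (R a d) (R b d) (R c d)) (pflag (R a e) (R b e) (R a f) (R b f) (R e f))"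

definition quad_entry :: "'a reln \<Rightarrow> 'a \<Rightarrow> 'a \<Rightarrow> 'a \<Rightarrow> 'a \<Rightarrow> 'a \<Rightarrow> 'a \<Rightarrow> int" where
  "quad_entry R a b c d e f =
     q_quad (R a d) (R b d) (R c d) (tflag (R a e) (R b e) (R c e) (R d e)) (tflag (R a f) (R b f) (R c f) (R d f))"

lemma q_quad_sym:
  assumes "x \<in> set flags16" "y \<in> set flags16"
  shows "q_quad a b c x y = q_quad a b c y x"
proof -
  have "sym_nth q x y = sym_nth q y x" if "q \<in> {q_copaw, q_claw, q_path, q_paw, q_cycle}" for q
    by (rule sym_nth_commute[OF _ assms]) (use that in \<open>auto simp: flags16_def\<close>)
  then show ?thesis by (simp add: q_quad_def)
qed

lemma q_pair_sym: "q_pair t x y = q_pair t y x"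
proof -
  have "length (q_adj x) = Suc (pos x) \<and> length (q_nonadj x) = Suc (pos x)" for x by (cases x) simp_all
  then show ?thesis unfolding q_pair_def by (intro sym_nth_commute[of UNIV]) auto
qed

text \<open>
  Over an induced path on four vertices, the six corners of the hexagon are the flags 1, 3, 7, 14, 12, 8 in
  cyclic order: adjacent to the first vertex, the first two, the first three, the last three, the last two, and
  the last. The remaining flags do not occur in a blowup of the hexagon.
\<close>
definition next_sector :: "flag \<Rightarrow> flag" where
  "next_sector x = (case x of F1 \<Rightarrow> F3 | F3 \<Rightarrow> F7 | F7 \<Rightarrow> F14 | F14 \<Rightarrow> F12 | F12 \<Rightarrow> F8 | F8 \<Rightarrow> F1 | _ \<Rightarrow> x)"

text \<open>
  The Laplacian of this cycle. It is subtracted from the matrix of the path type before semidefiniteness is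
  certified, which leaves the imbalance of the corners as a surplus in the key inequality.
\<close>
definition hex_laplacian :: "flag \<Rightarrow> flag \<Rightarrow> int" where
  "hex_laplacian x y = (if x = y then (if next_sector x = x then 0 else 2)
     else if next_sector x = y \<or> next_sector y = x then -1 else 0)"

definition matrix_of :: "flag list \<Rightarrow> (flag \<Rightarrow> flag \<Rightarrow> int) \<Rightarrow> int list list" where
  "matrix_of fs f = map (\<lambda>x. map (f x) fs) fs"

lemma matrix_of_nth:
  "x \<in> set flags16 \<Longrightarrow> y \<in> set flags16 \<Longrightarrow> matrix_of flags16 f ! pos x ! pos y = f x y"
  "matrix_of flags20 f ! pos x ! pos y = f x y"
  using pos_flags16[of x] pos_flags16[of y] pos_flags20 by (simp_all add: matrix_of_def)

primrec dot :: "int list \<Rightarrow> int list \<Rightarrow> int" where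
  "dot [] v = 0"
| "dot (x # u) v = (case v of [] \<Rightarrow> 0 | y # v' \<Rightarrow> x * y + dot u v')"

text \<open>
  A certificate that the form of a symmetric integer matrix A is nonnegative. Each entry \<open>(p, v)\<close>
  of K consists of a kernel vector v of A and of a pivot p at which v, and no other listed kernel vector, is
  nonzero; subtracting multiples of these vectors makes the pivot coordinates vanish and does not change the
  value of the form. On the other coordinates, \<open>s * A\<close> is the Gram matrix of the rows of U, which
  are rounded Cholesky factors, plus a diagonally dominant matrix that absorbs the rounding errors.
\<close>
definition psd_cert :: "int list list \<Rightarrow> int \<Rightarrow> int list list \<Rightarrow> (nat \<times> int list) list \<Rightarrow> bool" where
  "psd_cert A s U K = (let idx = [0..<length A]; P = map fst K in
     0 < s \<and> length U = length A
     \<and> list_all (\<lambda>r. length r = length A) A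
     \<and> list_all (\<lambda>i. list_all (\<lambda>j. A ! i ! j = A ! j ! i) idx) idx
     \<and> list_all (\<lambda>(p,v). p < length A \<and> length v = length A \<and> v ! p \<noteq> 0
          \<and> list_all (\<lambda>q. if q = p then True else v ! q = 0) P \<and> list_all (\<lambda>r. dot r v = 0) A) K
     \<and> list_all (\<lambda>i. if i \<in> set P then True else
          lsum (\<lambda>j. if i = j then 0 else if j \<in> set P then 0 else \<bar>s * A ! i ! j - dot (U ! i) (U ! j)\<bar>) idx
            \<le> s * A ! i ! i - dot (U ! i) (U ! i)) idx)"

definition u_copaw :: "int list list" where
  "u_copaw = [
     [4689], [-4795,3423], [-873,-2741,1195], [], [-4013,2475,-307,283], [-1979,-1368,1490,77,243],
     [1132,-1415,-533,1100,96,730], [-664,362,1888,180,306,15,302], [1532,3804,1557,247,334,98,408,284],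
     [-4381,2724,-135,-2088,-322,-1242,-165,-144,244], [3017,-1405,-9282,-789,-1455,-230,-1253,-456,-96,389],
     [2844,-2561,236,-40,1,36,-21,-42,-5,-39,152], [8280,-12532,-4893,1312,-650,1009,-883,-399,-190,194,76,280],
     [-2865,72,408,39,41,25,-22,-33,-8,-38,-2,-23,148], [2482,-2125,375,-118,-7,-54,-12,-21,14,-21,29,-11,-24,143],
     [-2830,3430,-1865,15,-235,-33,-156,-3,10,88,-10,-68,8,-27,165]]"

definition u_claw :: "int list list" where
  "u_claw = [
     [635], [-235,1937], [-145,-55,96], [848,-634,-1026,948], [-235,130,-1032,948,1331], [309,-76,833,-761,1086,245],
     [848,968,-111,98,-1173,-58,119], [-1005,448,1087,-957,2133,258,-68,116],
     [-235,130,-1032,948,-1299,-273,13,-38,84], [309,-76,833,-761,-1110,-6,36,-6,1,70],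
     [848,968,-111,98,1158,201,42,33,-6,-28,87], [-1005,448,1087,-957,-2139,-205,20,-49,15,25,-51,99],
     [309,-1584,-29,35,-2,23,-23,-6,1,19,-16,1,65], [-319,-159,153,-139,2,-24,-23,-1,-15,-14,-5,-8,-12,69],
     [-1005,-2487,-590,592,16,-145,-102,-49,15,21,-52,-25,8,-13,95],
     [29,-248,245,-201,-4,33,0,0,-5,6,-1,-2,4,-12,-4,64]]"

definition u_path :: "int list list" where
  "u_path = [
     [8202], [], [1924,760], [-368,801,2256], [1421,-1312,-200,618], [-876,-693,-1200,818,760],
     [-549,-981,2292,-1444,-419,1511], [-555,-3208,1469,3742,-1510,-3241,1294],
     [670,2130,-629,-1715,-1056,-181,-87,300], [-2898,-47,2242,-1936,-509,1449,-139,59,245],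
     [-1104,-1389,-308,1624,-62,-1052,374,-67,-43,185], [-1360,-1860,-2168,335,1068,918,-281,-199,5,33,195],
     [-2918,-9762,226,2762,673,1357,625,-544,168,100,123,348],
     [-318,2949,728,306,-866,-1861,245,216,-75,-24,-34,-104,180],
     [287,-963,-3152,18,2498,2014,-808,-333,-30,45,71,93,-3,134],
     [-2424,6889,-2430,-1687,-376,-1433,-518,429,-135,-46,-44,-198,7,104,194]]"

definition u_paw :: "int list list" where
  "u_paw = [
     [], [2962], [931,992], [-1505,1348,596], [2371,2878,861,1162], [-2008,-835,129,787,793],
     [956,705,-171,-762,-316,65], [-4063,597,-1251,-889,-964,1,254], [85,2698,-220,-650,-997,20,122,77],
     [-1125,-1188,-384,987,-517,-121,106,3,95], [1140,-1133,790,604,911,8,-170,-27,-37,56],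
     [-147,-876,-819,-339,-1534,-118,100,29,89,-44,74], [-1267,-1529,185,955,1047,-17,-48,-28,-19,-6,-41,42],
     [-781,-477,592,463,514,-6,-106,-25,6,7,0,-5,35], [1050,-4198,-866,271,803,-19,-35,-71,-10,4,-47,-15,-45,63],
     [-688,-674,617,-1391,905,124,-215,-49,-114,31,41,20,-21,27,78]]"

definition u_cycle :: "int list list" where
  "u_cycle = [
     [44], [0,1155], [0,-1029,526], [0,-169,-703,475], [0,904,-492,5,525], [0,-203,49,0,-51,42],
     [0,169,-41,-457,-697,12,152], [0,497,5,-3,243,-12,-33,52], [0,-1029,-27,5,-518,9,65,-25,50],
     [0,-169,41,-457,707,0,18,12,-19,95], [0,203,-49,0,51,3,-3,9,1,0,41], [0,-440,231,-3,-246,8,-1,3,0,-5,-10,46],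
     [0,169,703,446,-10,-12,-131,12,-19,-51,-1,4,80], [0,497,-246,0,7,-8,2,0,-5,-1,10,5,-2,45],
     [0,-555,7,0,-8,8,-1,3,0,4,-10,-4,-2,6,45], [0,0,0,0,0,0,0,0,0,0,0,0,0,0,0,44]]"

definition u_nonadj :: "int list list" where
  "u_nonadj = [
     [981], [-1938,2637], [-1771,733,1063], [-1896,-521,-1075,1385], [134,1086,-912,-973,1156],
     [-2406,-1439,1300,828,-694,845], [877,-2002,83,-593,793,173,700], [8,224,-79,868,-981,-64,-318,385],
     [1938,-1589,1613,-2210,1148,376,908,-407,682], [-92,526,278,158,-621,114,-192,103,-65,376], [], [],
     [1253,-2061,1645,-2231,1070,833,685,-585,250,28,601], [4194,-46,-2545,-638,457,-303,29,185,19,-108,-411,539],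
     [3651,-594,-1607,-2439,2498,-319,776,-458,302,-183,-101,354,521],
     [-560,965,-388,880,-612,-224,-275,285,15,-68,-178,23,-45,391],
     [685,-472,-1477,-374,1620,-565,401,-196,146,-242,-164,82,280,-1,437],
     [284,-1171,2221,968,-1957,-61,-341,218,64,80,-37,-335,-154,90,-272,276],
     [-969,825,43,-48,180,26,-40,-16,12,28,-5,14,20,8,-45,-43,241],
     [-301,-979,151,-965,1353,211,468,-369,117,0,182,47,108,-78,47,-293,-31,248]]"

definition u_adj :: "int list list" where
  "u_adj = [
     [4678], [-3103,2201], [-5212,-2614,2619], [7278,7924,-4571,3285], [-3257,-6260,3423,-2038,903],
     [12252,-1544,-2370,-1583,-208,1291], [], [], [1429,600,-823,-374,-125,65,508],
     [-4813,1507,448,488,-33,-301,100,943], [5044,3538,-1909,1166,-103,-422,-196,-404,1480],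
     [-2522,777,-177,-193,6,36,261,373,-565,703], [3972,-5789,2803,-244,474,80,-700,-963,1220,-1120,1308],
     [-3166,3902,-1068,1044,-30,-134,310,11,-402,599,-591,940],
     [-77,3553,-1386,1101,-128,-170,117,165,31,129,-106,77,539],
     [-3369,-1282,1011,-923,-31,-55,85,182,-272,174,-40,-241,17,714],
     [4091,-6231,2661,-367,240,3,-816,-1102,1206,-1188,834,-432,-187,-176,665],
     [-1079,-136,-244,-981,-104,83,237,372,-504,337,-231,-290,80,-112,-374,156],
     [778,-3623,684,-1877,1127,1742,976,1238,-2011,1433,-1034,-256,-186,162,-657,-272,805],
     [-1338,1121,-118,267,-146,-343,-63,-18,246,-12,69,85,72,34,6,199,189,656]]"

lemma psd_copaw: "psd_cert (matrix_of flags16 (sym_nth q_copaw)) 8192 u_copaw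
     [(pos F3, [0,0,0,1,0,0,1,1,1,1,0,0,1,0,0,0])]"
  by code_simp

lemma psd_claw: "psd_cert (matrix_of flags16 (sym_nth q_claw)) 2048 u_claw []"
  by code_simp

lemma psd_path: "psd_cert (matrix_of flags16 (\<lambda>x y. sym_nth q_path x y - hex_laplacian x y)) 8192 u_path
     [(pos F1, [0,1,0,1,0,0,0,1,1,0,0,0,1,0,1,0])]"
  by code_simp

lemma psd_paw: "psd_cert (matrix_of flags16 (sym_nth q_paw)) 2048 u_paw
     [(pos F0, [1,0,0,0,1,0,1,0,0,1,0,1,0,0,0,1])]"
  by code_simp

lemma psd_cycle: "psd_cert (matrix_of flags16 (sym_nth q_cycle)) 1024 u_cycle []"
  by code_simp

lemma psd_nonadj: "psd_cert (matrix_of flags20 (sym_nth q_nonadj)) 8192 u_nonadj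
     [(pos F10, [0,1,2,2,2,2,2,0,0,4,8,0,2,2,0,4,2,2,0,1]),
      (pos F11, [0,-7,-14,-14,-14,-14,-14,0,8,0,0,16,-14,-14,8,0,-14,-14,0,-7])]"
  by code_simp

lemma psd_adj: "psd_cert (matrix_of flags20 (sym_nth q_adj)) 32768 u_adj
     [(pos F6, [0,4,2,2,2,2,8,0,0,1,2,0,2,2,0,1,2,2,0,4]),
      (pos F7, [8,0,-14,-14,-14,-14,0,16,0,-7,-14,0,-14,-14,0,-7,-14,-14,8,0])]"
  by code_simp

definition form :: "int list list \<Rightarrow> (nat \<Rightarrow> real) \<Rightarrow> real" where
  "form A z = (\<Sum>i<length A. \<Sum>j<length A. of_int (A ! i ! j) * (z i * z j))"

lemma dot_eq:
  "length u \<le> n \<Longrightarrow> length v \<le> n \<Longrightarrow>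
    dot u v = (\<Sum>t<n. (if t < length u then u ! t else 0) * (if t < length v then v ! t else 0))"
proof (induction u arbitrary: v n)
  case (Cons x u)
  show ?case
  proof (cases v)
    case (Cons y v')
    obtain n' where n: "n = Suc n'" using Cons.prems by (cases n) auto
    have "dot u v' = (\<Sum>t<n'. (if t < length u then u ! t else 0) * (if t < length v' then v' ! t else 0))"
      using Cons.IH[of n' v'] Cons.prems n Cons by simp
    then show ?thesis unfolding Cons n by (subst sum.lessThan_Suc_shift) (simp cong: if_cong)
  qed simp
qed simp

text \<open>
  By \<open>2 \<bar>z i * z j\<bar> \<le> (z i)\<^sup>2 + (z j)\<^sup>2\<close> the off-diagonal terms are
  absorbed by the diagonal. In the rows and columns in P, z vanishes.
\<close>
lemma diag_dominant_nonneg: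
  fixes r :: "nat \<Rightarrow> nat \<Rightarrow> real"
  assumes sym: "\<And>i j. i < n \<Longrightarrow> j < n \<Longrightarrow> r i j = r j i"
    and dom: "\<And>i. i < n \<Longrightarrow> i \<notin> P \<Longrightarrow> (\<Sum>j<n. if i = j then 0 else if j \<in> P then 0 else \<bar>r i j\<bar>) \<le> r i i"
    and zero: "\<And>i. i \<in> P \<Longrightarrow> z i = 0"
  shows "0 \<le> (\<Sum>i<n. \<Sum>j<n. r i j * (z i * z j))"
proof -
  define a where "a i j = (if i = j then 0 else if i \<in> P \<or> j \<in> P then 0 else \<bar>r i j\<bar>)" for i j
  have asym: "a i j = a j i" if "i < n" "j < n" for i j using sym[OF that] by (auto simp: a_def)
  have low: "r i j * (z i * z j) \<ge> (if i = j then r i i * (z i)\<^sup>2 else 0) - a i j * ((z i)\<^sup>2 + (z j)\<^sup>2) / 2"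
    if "i < n" "j < n" for i j
  proof (cases "i = j \<or> i \<in> P \<or> j \<in> P")
    case True then show ?thesis using zero by (auto simp: a_def power2_eq_square)
  next
    case False
    have "\<bar>z i * z j\<bar> \<le> ((z i)\<^sup>2 + (z j)\<^sup>2) / 2"
      using sum_squares_bound[of "\<bar>z i\<bar>" "\<bar>z j\<bar>"] by (simp add: abs_mult)
    then have "\<bar>r i j\<bar> * \<bar>z i * z j\<bar> \<le> \<bar>r i j\<bar> * (((z i)\<^sup>2 + (z j)\<^sup>2) / 2)" by (rule mult_left_mono) simp
    then have "- (r i j * (z i * z j)) \<le> \<bar>r i j\<bar> * (((z i)\<^sup>2 + (z j)\<^sup>2) / 2)"
      by (metis abs_ge_minus_self abs_mult order_trans)
    then show ?thesis using False by (simp add: a_def)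
  qed
  have "(\<Sum>i<n. \<Sum>j<n. r i j * (z i * z j))
      \<ge> (\<Sum>i<n. \<Sum>j<n. (if i = j then r i i * (z i)\<^sup>2 else 0) - a i j * ((z i)\<^sup>2 + (z j)\<^sup>2) / 2)"
    by (intro sum_mono low) auto
  also have "(\<Sum>i<n. \<Sum>j<n. (if i = j then r i i * (z i)\<^sup>2 else 0) - a i j * ((z i)\<^sup>2 + (z j)\<^sup>2) / 2)
      = (\<Sum>i<n. r i i * (z i)\<^sup>2) - (\<Sum>i<n. \<Sum>j<n. a i j * (z i)\<^sup>2)"
  proof -
    have "(\<Sum>i<n. \<Sum>j<n. a i j * (z j)\<^sup>2) = (\<Sum>i<n. \<Sum>j<n. a i j * (z i)\<^sup>2)"
      by (subst sum.swap) (intro sum.cong refl, simp add: asym)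
    moreover have "(\<Sum>i<n. \<Sum>j<n. a i j * ((z i)\<^sup>2 + (z j)\<^sup>2) / 2)
        = ((\<Sum>i<n. \<Sum>j<n. a i j * (z i)\<^sup>2) + (\<Sum>i<n. \<Sum>j<n. a i j * (z j)\<^sup>2)) / 2"
      by (simp add: sum.distrib[symmetric] sum_divide_distrib distrib_left)
    ultimately have "(\<Sum>i<n. \<Sum>j<n. a i j * ((z i)\<^sup>2 + (z j)\<^sup>2) / 2) = (\<Sum>i<n. \<Sum>j<n. a i j * (z i)\<^sup>2)"
      by simp
    moreover have "(\<Sum>i<n. \<Sum>j<n. if i = j then r i i * (z i)\<^sup>2 else 0) = (\<Sum>i<n. r i i * (z i)\<^sup>2)"
      by (intro sum.cong refl) (simp add: sum.delta')
    ultimately show ?thesis by (simp add: sum_subtractf)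
  qed
  also have "\<dots> = (\<Sum>i<n. (r i i - (\<Sum>j<n. a i j)) * (z i)\<^sup>2)"
    by (simp add: sum_subtractf left_diff_distrib sum_distrib_right)
  finally have "(\<Sum>i<n. (r i i - (\<Sum>j<n. a i j)) * (z i)\<^sup>2) \<le> (\<Sum>i<n. \<Sum>j<n. r i j * (z i * z j))" .
  moreover have "0 \<le> (\<Sum>i<n. (r i i - (\<Sum>j<n. a i j)) * (z i)\<^sup>2)"
  proof (intro sum_nonneg)
    fix i assume i: "i \<in> {..<n}"
    show "0 \<le> (r i i - (\<Sum>j<n. a i j)) * (z i)\<^sup>2"
    proof (cases "i \<in> P")
      case False
      then have "(\<Sum>j<n. a i j) = (\<Sum>j<n. if i = j then 0 else if j \<in> P then 0 else \<bar>r i j\<bar>)"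
        by (intro sum.cong) (auto simp: a_def)
      then show ?thesis using dom[of i] i False by simp
    qed (simp add: zero)
  qed
  ultimately show ?thesis by linarith
qed

lemma form_shift:
  assumes sym: "\<And>i j. i < length A \<Longrightarrow> j < length A \<Longrightarrow> A ! i ! j = A ! j ! i"
    and ker: "\<And>i. i < length A \<Longrightarrow> (\<Sum>j<length A. A ! i ! j * v ! j) = 0"
  shows "form A (\<lambda>i. z i - t * of_int (v ! i)) = form A z"
proof -
  let ?n = "length A"
  let ?a = "\<lambda>i j. real_of_int (A ! i ! j)"
  have k: "(\<Sum>j<?n. ?a i j * of_int (v ! j)) = 0" if "i < ?n" for i
    using ker[OF that] by (metis (no_types, lifting) of_int_0 of_int_mult of_int_sum sum.cong)
  have 1: "(\<Sum>i<?n. \<Sum>j<?n. ?a i j * (x i * of_int (v ! j))) = 0" for x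
  proof -
    have "(\<Sum>i<?n. \<Sum>j<?n. ?a i j * (x i * of_int (v ! j))) = (\<Sum>i<?n. x i * (\<Sum>j<?n. ?a i j * of_int (v ! j)))"
      by (simp add: sum_distrib_left algebra_simps)
    also have "\<dots> = 0" by (simp add: k)
    finally show ?thesis .
  qed
  have 2: "(\<Sum>i<?n. \<Sum>j<?n. ?a i j * (of_int (v ! i) * x j)) = 0" for x
  proof -
    have "(\<Sum>i<?n. \<Sum>j<?n. ?a i j * (of_int (v ! i) * x j)) = (\<Sum>j<?n. \<Sum>i<?n. ?a i j * (of_int (v ! i) * x j))"
      by (rule sum.swap)
    also have "\<dots> = (\<Sum>j<?n. \<Sum>i<?n. ?a j i * (x j * of_int (v ! i)))"
      by (intro sum.cong refl) (simp add: sym)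
    also have "\<dots> = 0" by (rule 1)
    finally show ?thesis .
  qed
  have "form A (\<lambda>i. z i - t * of_int (v ! i))
     = (\<Sum>i<?n. \<Sum>j<?n. ?a i j * (z i * z j)) - t * (\<Sum>i<?n. \<Sum>j<?n. ?a i j * (of_int (v ! i) * z j))
       - t * (\<Sum>i<?n. \<Sum>j<?n. ?a i j * ((z i - t * of_int (v ! i)) * of_int (v ! j)))"
    by (simp add: form_def sum_distrib_left sum_subtractf[symmetric] algebra_simps)
  then show ?thesis using 1[of "\<lambda>i. z i - t * of_int (v ! i)"] 2[of z] by (simp add: form_def)
qed

lemma clear_pivots:
  assumes sym: "\<And>i j. i < length A \<Longrightarrow> j < length A \<Longrightarrow> A ! i ! j = A ! j ! i"
    and K: "\<And>p v. (p, v) \<in> set K \<Longrightarrow> v ! p \<noteq> 0 \<and> (\<forall>q\<in>fst ` set K. q \<noteq> p \<longrightarrow> v ! q = 0)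
        \<and> (\<forall>i<length A. (\<Sum>j<length A. A ! i ! j * v ! j) = 0)"
  shows "\<exists>z'. form A z' = form A z \<and> (\<forall>p\<in>fst ` set K. z' p = 0)"
proof -
  have "\<exists>z'. form A z' = form A z \<and> (\<forall>p\<in>fst ` set L. z' p = 0)" if "set L \<subseteq> set K" for L
    using that
  proof (induction L)
    case (Cons x L)
    obtain p v where x: "x = (p, v)" by (cases x)
    obtain z' where z': "form A z' = form A z" "\<forall>p\<in>fst ` set L. z' p = 0" using Cons by auto
    have pv: "(p, v) \<in> set K" using Cons.prems x by simp
    let ?z = "\<lambda>i. z' i - (z' p / of_int (v ! p)) * of_int (v ! i)"
    have "form A ?z = form A z" using form_shift[OF sym, of v z'] K[OF pv] z'(1) by metis
    moreover have "?z q = 0" if "q \<in> fst ` set (x # L)" for q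
    proof (cases "q = p")
      case True then show ?thesis using K[OF pv] by simp
    next
      case False
      then have "z' q = 0" "q \<in> fst ` set K" using that x z'(2) Cons.prems by auto
      moreover from this K[OF pv] False have "v ! q = 0" by blast
      ultimately show ?thesis by simp
    qed
    ultimately show ?case by blast
  qed (auto intro: exI[of _ z])
  then show ?thesis by blast
qed

lemma psd_cert_nonneg:
  assumes c: "psd_cert A s U K"
  shows "0 \<le> form A z"
proof -
  let ?n = "length A"
  define P where "P = fst ` set K"
  have c': "0 < s \<and> length U = ?n \<and> (\<forall>r\<in>set A. length r = ?n)
     \<and> (\<forall>i<?n. \<forall>j<?n. A ! i ! j = A ! j ! i)
     \<and> (\<forall>x\<in>set K. case x of (p,v) \<Rightarrow> p < ?n \<and> length v = ?n \<and> v ! p \<noteq> 0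
          \<and> (\<forall>q\<in>P. if q = p then True else v ! q = 0) \<and> (\<forall>r\<in>set A. dot r v = 0))
     \<and> (\<forall>i<?n. if i \<in> P then True else
          (\<Sum>j<?n. if i = j then 0 else if j \<in> P then 0 else \<bar>s * A ! i ! j - dot (U ! i) (U ! j)\<bar>)
            \<le> s * A ! i ! i - dot (U ! i) (U ! i))"
    using c unfolding psd_cert_def Let_def list_all_iff lsum_upt set_upt set_map P_def[symmetric]
    unfolding atLeast0LessThan Ball_def lessThan_iff .
  note s = c'[THEN conjunct1] and lU = c'[THEN conjunct2, THEN conjunct1]
    and lr = c'[THEN conjunct2, THEN conjunct2, THEN conjunct1, rule_format]
    and sym = c'[THEN conjunct2, THEN conjunct2, THEN conjunct2, THEN conjunct1, rule_format]
    and K' = c'[THEN conjunct2, THEN conjunct2, THEN conjunct2, THEN conjunct2, THEN conjunct1, rule_format]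
    and dom' = c'[THEN conjunct2, THEN conjunct2, THEN conjunct2, THEN conjunct2, THEN conjunct2, rule_format]
  have K: "length v = ?n \<and> v ! p \<noteq> 0 \<and> (\<forall>q\<in>P. q \<noteq> p \<longrightarrow> v ! q = 0) \<and> (\<forall>r\<in>set A. dot r v = 0)"
    if "(p, v) \<in> set K" for p v
    using K'[OF that] by (simp split: if_splits)
  have dom: "(\<Sum>j<?n. if i = j then 0 else if j \<in> P then 0 else \<bar>s * A ! i ! j - dot (U ! i) (U ! j)\<bar>)
         \<le> s * A ! i ! i - dot (U ! i) (U ! i)" if "i < ?n" "i \<notin> P" for i
    using dom'[OF that(1)] that(2) by (simp only: if_False)
  have "\<exists>z'. form A z' = form A z \<and> (\<forall>p\<in>fst ` set K. z' p = 0)"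
  proof (rule clear_pivots[OF sym])
    fix p v assume pv: "(p, v) \<in> set K"
    have "(\<Sum>j<?n. A ! i ! j * v ! j) = 0" if "i < ?n" for i
    proof -
      have "length (A ! i) = ?n" "dot (A ! i) v = 0" "length v = ?n" using lr K[OF pv] that by auto
      then show ?thesis using dot_eq[of "A ! i" ?n v] by simp
    qed
    then show "v ! p \<noteq> 0 \<and> (\<forall>q\<in>fst ` set K. q \<noteq> p \<longrightarrow> v ! q = 0) \<and> (\<forall>i<?n. (\<Sum>j<?n. A ! i ! j * v ! j) = 0)"
      using K[OF pv] by (simp add: P_def)
  qed auto
  then obtain y where y: "form A y = form A z" "\<And>p. p \<in> P \<Longrightarrow> y p = 0" by (auto simp: P_def)
  \<comment> \<open>The rows of U are padded with zeros to a common length T.\<close>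
  define T where "T = Max (insert 0 (length ` set U))"
  define u where "u i t = (if t < length (U ! i) then real_of_int (U ! i ! t) else 0)" for i t
  have T: "length (U ! i) \<le> T" if "i < ?n" for i
    unfolding T_def using that lU by (intro Max_ge) auto
  have d: "real_of_int (dot (U ! i) (U ! j)) = (\<Sum>t<T. u i t * u j t)" if "i < ?n" "j < ?n" for i j
    unfolding dot_eq[OF T[OF that(1)] T[OF that(2)]] of_int_sum by (intro sum.cong refl) (simp add: u_def)
  define r where "r i j = s * real_of_int (A ! i ! j) - (\<Sum>t<T. u i t * u j t)" for i j
  have r: "r i j = of_int (s * A ! i ! j - dot (U ! i) (U ! j))" if "i < ?n" "j < ?n" for i j
    by (simp add: r_def d[OF that])
  have "0 \<le> (\<Sum>i<?n. \<Sum>j<?n. r i j * (y i * y j))"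
  proof (rule diag_dominant_nonneg[where P=P])
    show "r i j = r j i" if "i < ?n" "j < ?n" for i j
      using sym[OF that] by (simp add: r_def mult.commute)
    show "(\<Sum>j<?n. if i = j then 0 else if j \<in> P then 0 else \<bar>r i j\<bar>) \<le> r i i" if i: "i < ?n" "i \<notin> P" for i
    proof -
      have "(\<Sum>j<?n. if i = j then 0 else if j \<in> P then 0 else \<bar>r i j\<bar>)
         = of_int (\<Sum>j<?n. if i = j then 0 else if j \<in> P then 0 else \<bar>s * A ! i ! j - dot (U ! i) (U ! j)\<bar>)"
        unfolding of_int_sum by (intro sum.cong refl) (use r i in auto)
      also have "\<dots> \<le> of_int (s * A ! i ! i - dot (U ! i) (U ! i))"
        using dom[OF i] of_int_le_iff by blast
      finally show ?thesis using r[OF i(1) i(1)] by simp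
    qed
  qed (rule y(2))
  moreover have "(\<Sum>i<?n. \<Sum>j<?n. r i j * (y i * y j)) = s * form A y - (\<Sum>t<T. (\<Sum>i<?n. u i t * y i)\<^sup>2)"
  proof -
    have "(\<Sum>t<T. (\<Sum>i<?n. u i t * y i)\<^sup>2) = (\<Sum>t<T. \<Sum>i<?n. \<Sum>j<?n. u i t * u j t * (y i * y j))"
      by (simp add: power2_eq_square sum_product algebra_simps)
    also have "\<dots> = (\<Sum>i<?n. \<Sum>j<?n. (\<Sum>t<T. u i t * u j t) * (y i * y j))"
      by (subst sum.swap, rule sum.cong[OF refl], subst sum.swap) (simp add: sum_distrib_right)
    finally show ?thesis
      by (simp add: r_def form_def sum_distrib_left sum_subtractf left_diff_distrib algebra_simps)
  qed
  moreover have "0 \<le> (\<Sum>t<T. (\<Sum>i<?n. u i t * y i)\<^sup>2)" by (simp add: sum_nonneg)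
  ultimately have "0 \<le> s * form A y" by linarith
  then show ?thesis using s y(1) by (simp add: zero_le_mult_iff)
qed

lemma form_matrix_diff:
  "form (matrix_of fs (\<lambda>x y. f x y - g x y)) z = form (matrix_of fs f) z - form (matrix_of fs g) z"
  by (simp add: form_def matrix_of_def left_diff_distrib sum_subtractf)

section \<open>The inequality on six points\<close>

text \<open>
  The summand of the identity behind the key inequality, for an ordered tuple of six points: a constant, minus
  the pair forms over the base (a, b), minus the F49 tuples, the misfits and the forms over four points based
  on a path a-b-c. A misfit takes its pair from (e, f), so that summation over d gives a factor S. The value
  itself can be negative; its sum over all orderings is not.
\<close>
definition slack :: "'a reln \<Rightarrow> 'a list \<Rightarrow> int" where
  "slack R xs = (case xs of [a,b,c,d,e,f] \<Rightarrow> 120 - pair_entry R a b c d e f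
     - (if p3 R a b c then 466560 * of_bool (completes_F49 R a b c d e f)
          + 8 * of_bool (misfit (class_of R a b c e) (class_of R a b c f) (R e f)) + 4 * quad_entry R a b c d e f else 0)
   | _ \<Rightarrow> 0)"

text \<open>
  The sum of the slack over the 720 orderings is 8 * (10800 - cost), where 10800 = 720 * 120 / 8 and the cost
  has an eighth of the terms. For a fixed base (a, b), the pair form depends only on the splitting of the
  remaining points into two pairs; there are three splittings of eight orderings each. For a fixed path a-b-c,
  the other terms depend only on the choice of d and have a common factor 4; two orderings share each choice.
\<close>
definition tri_entry :: "'a reln \<Rightarrow> 'a \<Rightarrow> 'a \<Rightarrow> 'a \<Rightarrow> 'a \<Rightarrow> 'a \<Rightarrow> 'a \<Rightarrow> int" where
  "tri_entry R a b c d e f =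
     (if completes_F49 R a b c d e f then 116640 else 0)
     + (if misfit (class_of R a b c e) (class_of R a b c f) (R e f) then 2 else 0)
     + quad_entry R a b c d e f"

definition split3 :: "('a \<Rightarrow> 'a \<Rightarrow> 'a \<Rightarrow> int) \<Rightarrow> 'a list \<Rightarrow> int" where
  "split3 g xs = (case xs of [d,e,f] \<Rightarrow> g d e f + g e d f + g f d e | _ \<Rightarrow> 0)"

definition split22 :: "('a \<Rightarrow> 'a \<Rightarrow> 'a \<Rightarrow> 'a \<Rightarrow> int) \<Rightarrow> 'a list \<Rightarrow> int" where
  "split22 g xs = (case xs of [c,d,e,f] \<Rightarrow> g c d e f + g c e d f + g c f d e | _ \<Rightarrow> 0)"

definition path_cost :: "'a reln \<Rightarrow> 'a \<Rightarrow> 'a \<Rightarrow> 'a list \<Rightarrow> int" where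
  "path_cost R a b r = (if R a b then
     lsum (\<lambda>(c, s). if R b c then (if R a c then 0 else split3 (tri_entry R a b c) s) else 0) (picks r) else 0)"

definition cost :: "'a reln \<Rightarrow> 'a list \<Rightarrow> int" where
  "cost R xs = lsum (\<lambda>(a, r). lsum (\<lambda>(b, r'). split22 (pair_entry R a b) r' + path_cost R a b r') (picks r)) (picks xs)"

lemma misfit_sym:
  assumes "symp R" shows "misfit i j (R x y) = misfit j i (R y x)"
proof -
  have "hex k l = hex l k" for k l by (cases k; cases l; simp)
  moreover have "R x y = R y x" using assms by (auto dest: sympD)
  ultimately show ?thesis by (auto simp: misfit_def split: option.splits)
qed

lemma pair_entry_sym:
  assumes "symp R"
  shows "pair_entry R a b d c e f = pair_entry R a b c d e f"
    "pair_entry R a b c d f e = pair_entry R a b c d e f"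
    "pair_entry R a b e f c d = pair_entry R a b c d e f"
proof -
  have "R x y = R y x" for x y using assms by (auto dest: sympD)
  note s = this
  show "pair_entry R a b d c e f = pair_entry R a b c d e f"
    unfolding pair_entry_def s[of d c] by (subst pflag_sym) (rule refl)
  show "pair_entry R a b c d f e = pair_entry R a b c d e f"
    unfolding pair_entry_def s[of f e] by (subst (2) pflag_sym) (rule refl)
  show "pair_entry R a b e f c d = pair_entry R a b c d e f"
    unfolding pair_entry_def by (rule q_pair_sym)
qed

lemma quad_entry_sym: "quad_entry R a b c d f e = quad_entry R a b c d e f"
  unfolding quad_entry_def by (rule q_quad_sym) (rule tflag_in)+

lemma completes_F49_sym: assumes "symp R" shows "completes_F49 R a b c d f e = completes_F49 R a b c d e f"
  using assms by (auto simp: completes_F49_def dest: sympD)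

lemma psum3:
  assumes "length s = 3" "\<And>d e f. g d f e = g d e f"
  shows "psum 3 (\<lambda>zs. case zs of [d,e,f] \<Rightarrow> g d e f | _ \<Rightarrow> 0) s = 2 * split3 g s"
proof -
  obtain d e f where s: "s = [d,e,f]"
    using assms(1) by (auto simp: length_numeral_conv)
  show ?thesis unfolding s
    by (simp add: eval_nat_numeral split3_def assms(2)[of d f e] assms(2)[of e f d] assms(2)[of f e d])
qed

lemma psum22:
  assumes "length s = 4" "\<And>c d e f. g d c e f = g c d e f" "\<And>c d e f. g c d f e = g c d e f" "\<And>c d e f. g e f c d = g c d e f"
  shows "psum 4 (\<lambda>zs. case zs of [c,d,e,f] \<Rightarrow> g c d e f | _ \<Rightarrow> 0) s = 8 * split22 g s"
proof -
  obtain c d e f where s: "s = [c,d,e,f]"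
    using assms(1) by (auto simp: length_numeral_conv)
  have 1: "g d c e f = g c d e f" "g c d f e = g c d e f" "g d c f e = g c d e f"
    "g e f c d = g c d e f" "g f e c d = g c d e f" "g e f d c = g c d e f" "g f e d c = g c d e f" for c d e f
    by (simp_all only: assms)
  show ?thesis unfolding s
    by (simp add: eval_nat_numeral split22_def 1[where c=c and d=d and e=e and f=f]
        1[where c=c and d=e and e=d and f=f] 1[where c=c and d=f and e=d and f=e])
qed

lemma psum_slack:
  assumes R: "symp R" and len: "length xs = 6"
  shows "psum 6 (slack R) xs = 8 * (10800 - cost R xs)"
proof -
  define T where "T = (\<lambda>a b c d e f. 466560 * of_bool (completes_F49 R a b c d e f)
          + 8 * of_bool (misfit (class_of R a b c e) (class_of R a b c f) (R e f)) + 4 * quad_entry R a b c d e f)"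
  define T3 where "T3 a b c zs = (case zs of [d,e,f] \<Rightarrow> T a b c d e f | _ \<Rightarrow> 0)" for a b c zs
  have Tsym: "T a b c d f e = T a b c d e f" for a b c d e f
    unfolding T_def using completes_F49_sym[OF R, of a b c d f e] quad_entry_sym[of R a b c d f e]
      misfit_sym[OF R, of "class_of R a b c f" "class_of R a b c e" f e] by simp
  have Ttri: "T a b c d e f = 4 * tri_entry R a b c d e f" for a b c d e f
    by (simp add: T_def tri_entry_def)
  have three: "psum 3 (\<lambda>zs. - (if p3 R a b c then T3 a b c zs else 0)) s
      = - 8 * (if p3 R a b c then split3 (tri_entry R a b c) s else 0)" if "length s = 3" for a b c s
  proof (cases "p3 R a b c")
    case True
    have "psum 3 (T3 a b c) s = 2 * split3 (T a b c) s"
      unfolding T3_def[abs_def] by (rule psum3[OF that]) (rule Tsym)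
    also have "split3 (T a b c) s = 4 * split3 (tri_entry R a b c) s"
      by (simp add: split3_def Ttri split: list.split)
    finally show ?thesis using psum_cmult[of 3 "-1" "T3 a b c" s] True by simp
  qed (simp add: psum_zero)
  have lin: "lsum (\<lambda>x. k - 8 * f x) ys = int (length ys) * k - 8 * lsum f ys" for f :: "'c \<Rightarrow> int" and ys k
    by (induction ys) (simp_all add: algebra_simps)
  have four: "psum 4 (\<lambda>zs. slack R (a # b # zs)) r = 24 * 120 - 8 * (split22 (pair_entry R a b) r + path_cost R a b r)"
    if r: "length r = 4" for a b r
  proof -
    let ?P = "\<lambda>zs. case zs of [c,d,e,f] \<Rightarrow> pair_entry R a b c d e f | _ \<Rightarrow> 0"
    let ?T = "\<lambda>zs. case zs of c # zs' \<Rightarrow> - (if p3 R a b c then T3 a b c zs' else 0) | _ \<Rightarrow> 0"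
    let ?S = "\<lambda>(c, s). if p3 R a b c then split3 (tri_entry R a b c) s else 0"
    have "psum 4 (\<lambda>zs. slack R (a # b # zs)) r = psum 4 (\<lambda>zs. 120 + ((-1) * ?P zs + ?T zs)) r"
      by (rule psum_cong) (auto simp: length_numeral_conv slack_def T3_def T_def)
    also have "\<dots> = 24 * 120 - psum 4 ?P r + psum (Suc 3) ?T r"
      unfolding psum_add psum_cmult using psum_const[OF r, of 120] by (simp add: eval_nat_numeral)
    also have "psum 4 ?P r = 8 * split22 (pair_entry R a b) r"
      by (rule psum22[OF r]) (rule pair_entry_sym[OF R])+
    also have "psum (Suc 3) ?T r = lsum (\<lambda>x. 0 - 8 * ?S x) (picks r)"
      unfolding psum.simps list.case
    proof (rule lsum_cong, clarify)
      fix c s assume "(c, s) \<in> set (picks r)"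
      from picks_in(4)[OF this] have "length s = 3" using r by simp
      from three[OF this] show "psum 3 (\<lambda>zs. - (if p3 R a b c then T3 a b c zs else 0)) s
          = 0 - 8 * (if p3 R a b c then split3 (tri_entry R a b c) s else 0)" by simp
    qed
    also have "\<dots> = - 8 * lsum ?S (picks r)" unfolding lin by simp
    also have "lsum ?S (picks r) = path_cost R a b r"
    proof (cases "R a b")
      case True
      then show ?thesis unfolding path_cost_def if_P[OF True] by (intro lsum_cong) (simp add: case_prod_unfold p3_def)
    qed (simp add: path_cost_def p3_def lsum_0 case_prod_unfold)
    finally show ?thesis by simp
  qed
  define G where "G a b r = split22 (pair_entry R a b) r + path_cost R a b r" for a b r
  have "psum 6 (slack R) xs = lsum (\<lambda>(a, r). lsum (\<lambda>(b, r'). psum 4 (\<lambda>zs. slack R (a # b # zs)) r') (picks r)) (picks xs)"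
    by (simp add: eval_nat_numeral)
  also have "\<dots> = lsum (\<lambda>(a, r). lsum (\<lambda>(b, r'). 24 * 120 - 8 * G a b r') (picks r)) (picks xs)"
  proof (intro lsum_cong, clarify, intro lsum_cong, clarify)
    fix a r b r' assume "(a, r) \<in> set (picks xs)" "(b, r') \<in> set (picks r)"
    from this[THEN picks_in(4)] have "length r' = 4" using len by simp
    then show "psum 4 (\<lambda>zs. slack R (a # b # zs)) r' = 24 * 120 - 8 * G a b r'" unfolding G_def by (rule four)
  qed
  also have "\<dots> = lsum (\<lambda>(a, r). 5 * (24 * 120) - 8 * lsum (\<lambda>(b, r'). G a b r') (picks r)) (picks xs)"
  proof (intro lsum_cong, clarify)
    fix a r assume "(a, r) \<in> set (picks xs)"
    from picks_in(4)[OF this] have "length r = 5" using len by simp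
    then show "lsum (\<lambda>(b, r'). 24 * 120 - 8 * G a b r') (picks r) = 5 * (24 * 120) - 8 * lsum (\<lambda>(b, r'). G a b r') (picks r)"
      using lin[of "24*120" "\<lambda>(b, r'). G a b r'" "picks r"] by (simp add: length_picks case_prod_unfold)
  qed
  also have "\<dots> = 8 * (10800 - cost R xs)"
    using lin[of "5*(24*120)" "\<lambda>(a, r). lsum (\<lambda>(b, r'). G a b r') (picks r)" "picks xs"] len
    by (simp add: length_picks case_prod_unfold cost_def G_def)
  finally show ?thesis .
qed

lemma cost_map: "cost R (map \<phi> xs) = cost (\<lambda>x y. R (\<phi> x) (\<phi> y)) xs"
proof -
  have 1: "pair_entry R (\<phi> a) (\<phi> b) (\<phi> c) (\<phi> d) (\<phi> e) (\<phi> f) = pair_entry (\<lambda>x y. R (\<phi> x) (\<phi> y)) a b c d e f"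
   and 2: "tri_entry R (\<phi> a) (\<phi> b) (\<phi> c) (\<phi> d) (\<phi> e) (\<phi> f) = tri_entry (\<lambda>x y. R (\<phi> x) (\<phi> y)) a b c d e f" for a b c d e f
    by (simp_all add: pair_entry_def tri_entry_def quad_entry_def completes_F49_def class_of_def)
  have 3: "split22 (pair_entry R (\<phi> a) (\<phi> b)) (map \<phi> r) = split22 (pair_entry (\<lambda>x y. R (\<phi> x) (\<phi> y)) a b) r" for a b r
    by (auto simp: split22_def 1 split: list.split)
  have 4: "split3 (tri_entry R (\<phi> a) (\<phi> b) (\<phi> c)) (map \<phi> r) = split3 (tri_entry (\<lambda>x y. R (\<phi> x) (\<phi> y)) a b c) r" for a b c r
    by (auto simp: split3_def 2 split: list.split)
  have 5: "path_cost R (\<phi> a) (\<phi> b) (map \<phi> r) = path_cost (\<lambda>x y. R (\<phi> x) (\<phi> y)) a b r" for a b r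
    by (simp add: path_cost_def picks_map lsum_map case_prod_unfold 4 cong: if_cong)
  show ?thesis unfolding cost_def picks_map lsum_map
    by (intro lsum_cong) (clarsimp simp: picks_map lsum_map 3 5 intro!: lsum_cong)
qed

lemma split22_cong:
  assumes "\<And>c d e f. {c,d,e,f} \<subseteq> set r \<Longrightarrow> g c d e f = g' c d e f" shows "split22 g r = split22 g' r"
  using assms by (auto simp: split22_def split: list.split)

lemma split3_cong:
  assumes "\<And>d e f. {d,e,f} \<subseteq> set r \<Longrightarrow> g d e f = g' d e f" shows "split3 g r = split3 g' r"
  using assms by (auto simp: split3_def split: list.split)

lemma cost_cong:
  assumes "\<And>x y. x \<in> set xs \<Longrightarrow> y \<in> set xs \<Longrightarrow> R x y = R' x y"
  shows "cost R xs = cost R' xs"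
  unfolding cost_def
proof (intro lsum_cong, clarify, intro lsum_cong, clarify)
  fix a r b r' assume "(a, r) \<in> set (picks xs)" "(b, r') \<in> set (picks r)"
  from this[THEN picks_in(2)] this[THEN picks_in(3)]
  have in2: "a \<in> set xs" "b \<in> set xs" "set r' \<subseteq> set xs" by auto
  have "split22 (pair_entry R a b) r' = split22 (pair_entry R' a b) r'"
  proof (rule split22_cong)
    fix c d e f assume "{c,d,e,f} \<subseteq> set r'"
    then have "{a,b,c,d,e,f} \<subseteq> set xs" using in2 by auto
    then show "pair_entry R a b c d e f = pair_entry R' a b c d e f"
      by (simp add: pair_entry_def assms)
  qed
  moreover have "path_cost R a b r' = path_cost R' a b r'"
    unfolding path_cost_def
  proof (intro if_cong lsum_cong refl, goal_cases)
    case (2 x)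
    obtain c s where x: "x = (c, s)" by (cases x)
    have in3: "c \<in> set xs" "set s \<subseteq> set xs"
      using picks_in(2,3)[of c s r'] 2 x in2 by auto
    have "split3 (tri_entry R a b c) s = split3 (tri_entry R' a b c) s"
    proof (rule split3_cong)
      fix d e f assume "{d,e,f} \<subseteq> set s"
      then have "{a,b,c,d,e,f} \<subseteq> set xs" using in2 in3 by auto
      then show "tri_entry R a b c d e f = tri_entry R' a b c d e f"
        by (simp add: tri_entry_def quad_entry_def completes_F49_def class_of_def assms)
    qed
    then show ?case using in2 in3 assms by (simp add: x)
  qed (use in2 assms in auto)
  ultimately show "split22 (pair_entry R a b) r' + path_cost R a b r' = split22 (pair_entry R' a b) r' + path_cost R' a b r'"
    by simp
qed

text \<open>
  A point of a concrete reflexive relation on six points carries its own row of the adjacency matrix, so that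
  adjacency is evaluated without access to the whole matrix.
\<close>
datatype vert = Vert six bool bool bool bool bool bool

primrec vert_row :: "vert \<Rightarrow> six \<Rightarrow> bool" where "vert_row (Vert i a b c d e f) j = select6 j a b c d e f"

primrec vert_index :: "vert \<Rightarrow> six" where "vert_index (Vert i a b c d e f) = i"

definition vert_adj :: "vert \<Rightarrow> vert \<Rightarrow> bool" where "vert_adj x y = vert_row x (vert_index y)"

text \<open>
  The relation with upper triangle \<open>p @ f\<close>, column by column; f is the column of the last point.
\<close>
definition mk_pattern :: "bool list \<Rightarrow> bool list \<Rightarrow> vert list" where
 "mk_pattern p f = (case p of [b01,b02,b12,b03,b13,b23,b04,b14,b24,b34] \<Rightarrow> (case f of [b05,b15,b25,b35,b45] \<Rightarrow>
   [Vert I0 True b01 b02 b03 b04 b05, Vert I1 b01 True b12 b13 b14 b15, Vert I2 b02 b12 True b23 b24 b25,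
    Vert I3 b03 b13 b23 True b34 b35, Vert I4 b04 b14 b24 b34 True b45, Vert I5 b05 b15 b25 b35 b45 True]))"

definition count_nb :: "'a reln \<Rightarrow> 'a \<Rightarrow> 'a list \<Rightarrow> nat" where
  "count_nb R v xs = length (filter (R v) xs)"

definition last_max :: "'a reln \<Rightarrow> 'a list \<Rightarrow> bool" where
  "last_max R xs = (let k = count_nb R (last xs) xs in list_all (\<lambda>v. count_nb R v xs \<le> k) xs)"

definition code4 :: "'a reln \<Rightarrow> 'a list \<Rightarrow> bool list" where
  "code4 R xs = (case xs of [a,b,c,d] \<Rightarrow> [R a b, R a c, R b c, R a d, R b d, R c d])"

definition nbr_code :: "'a reln \<Rightarrow> 'a list \<Rightarrow> 'a list \<Rightarrow> bool list" where
  "nbr_code R xs ys = (case xs of [a,b,c,d] \<Rightarrow> (case ys of [e] \<Rightarrow> [R a e, R b e, R c e, R d e]))"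

text \<open>
  The next functions search and compare by conditionals rather than by boolean connectives: conditionals are
  evaluated lazily under rewriting. Lists take the place of numbers where a function recurses on a length, as
  in the first argument of \<open>some_arrangement\<close>.
\<close>
primrec list_some :: "('a \<Rightarrow> bool) \<Rightarrow> 'a list \<Rightarrow> bool" where
  "list_some P [] = False"
| "list_some P (x # xs) = (if P x then True else list_some P xs)"

primrec some_arrangement :: "'b list \<Rightarrow> ('a list \<Rightarrow> 'a list \<Rightarrow> bool) \<Rightarrow> 'a list \<Rightarrow> bool" where
  "some_arrangement [] P xs = P [] xs"
| "some_arrangement (_ # n) P xs = list_some (\<lambda>(y, ys). some_arrangement n (\<lambda>zs. P (y # zs)) ys) (picks xs)"

primrec same_bits :: "bool list \<Rightarrow> bool list \<Rightarrow> bool" where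
  "same_bits [] q = (case q of [] \<Rightarrow> True | _ # _ \<Rightarrow> False)"
| "same_bits (x # p) q = (case q of [] \<Rightarrow> False | y # q' \<Rightarrow>
     (if x then (if y then same_bits p q' else False) else (if y then False else same_bits p q')))"

primrec bit_lists :: "'b list \<Rightarrow> bool list list" where
  "bit_lists [] = [[]]"
| "bit_lists (_ # n) = concat (map (\<lambda>p. [True # p, False # p]) (bit_lists n))"

primrec lookup_ext :: "bool list \<Rightarrow> (bool list \<times> 'b list) list \<Rightarrow> 'b list" where
  "lookup_ext q [] = []"
| "lookup_ext q (x # r) = (if same_bits q (fst x) then snd x else lookup_ext q r)"

text \<open>
  Representatives of the isomorphism types of graphs on five vertices: each of the eleven graphs on four
  vertices comes with possible neighbourhoods of a fifth vertex.
\<close>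
definition fives :: "(bool list \<times> bool list list) list" where
  "fives = [
   ([False,False,False,False,False,False],
     [[False,False,False,False], [False,False,False,True], [False,False,True,True],
      [False,True,True,True], [True,True,True,True]]),
   ([False,False,False,False,False,True],
     [[False,False,True,True], [False,True,False,False], [False,True,False,True],
      [False,True,True,True], [True,True,False,False], [True,True,False,True], [True,True,True,True]]),
   ([False,False,False,False,True,True],
     [[False,True,True,False], [False,True,True,True], [True,False,True,False], [True,False,True,True],
      [True,True,True,False], [True,True,True,True]]),
   ([False,False,False,True,True,True],
     [[True,True,True,False], [True,True,True,True]]),
   ([False,False,True,False,True,True],
     [[False,True,True,True], [True,False,False,False], [True,False,False,True], [True,False,True,True],
      [True,True,True,True]]),
   ([False,False,True,True,False,False],
     [[True,True,True,True]]),
   ([False,False,True,True,False,True],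
     [[True,True,False,False], [True,True,False,True], [True,True,True,True]]),
   ([False,False,True,True,True,True],
     [[True,True,True,False], [True,True,True,True]]),
   ([False,True,True,True,True,False],
     [[True,True,True,True]]),
   ([False,True,True,True,True,True],
     [[True,True,True,True]]),
   ([True,True,True,True,True,True],
     [[True,True,True,True]])]"

text \<open>
  A sixth point needs to be tested only if it has maximal degree, as any vertex of a six-vertex graph may be
  taken to be the last.
\<close>
definition extensions_ok :: "bool list \<Rightarrow> bool" where
  "extensions_ok p = list_all (\<lambda>f. let vs = mk_pattern p f in if last_max vert_adj vs then cost vert_adj vs \<le> 10800 else True)
     (bit_lists [I0, I1, I2, I3, I4])"

text \<open>
  Every graph on four vertices can be arranged as one of the eleven, and every one-vertex extension of these
  as one of the 34 representatives. The patterns are cut down to their first four, respectively five, points.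
\<close>
lemma fours_complete:
  "list_all (\<lambda>p. some_arrangement [I0,I0,I0,I0] (\<lambda>zs r. case lookup_ext (code4 vert_adj zs) fives of [] \<Rightarrow> False | _ # _ \<Rightarrow> True)
      (butlast (butlast (mk_pattern (p @ [True,True,True,True]) [True,True,True,True,True]))))
    (bit_lists [I0,I0,I0,I0,I0,I0])"
  by code_simp

lemma fives_complete:
  "list_all (\<lambda>(p, fs). list_all (\<lambda>f. some_arrangement [I0,I0,I0,I0]
         (\<lambda>zs r. list_some (same_bits (nbr_code vert_adj zs r)) (lookup_ext (code4 vert_adj zs) fives))
      (butlast (mk_pattern (p @ f) [True,True,True,True,True]))) (bit_lists [I0,I0,I0,I0])) fives"
  by code_simp

lemma extensions_of_fives_ok: "list_all (\<lambda>(p, fs). list_all (\<lambda>f. extensions_ok (p @ f)) fs) fives"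
  by code_simp

lemma list_some_iff: "list_some P xs \<longleftrightarrow> (\<exists>x\<in>set xs. P x)"
  by (induction xs) auto

lemma same_bits_iff: "same_bits p q \<longleftrightarrow> p = q"
  by (induction p arbitrary: q) (auto split: list.splits)

lemma some_arrangement_sound:
  "some_arrangement n P xs \<Longrightarrow> length n \<le> length xs \<Longrightarrow>
    \<exists>zs r. mset (zs @ r) = mset xs \<and> length zs = length n \<and> P zs r"
proof (induction n arbitrary: P xs)
  case (Cons x n)
  then obtain y ys where ys: "(y, ys) \<in> set (picks xs)" "some_arrangement n (\<lambda>zs. P (y # zs)) ys"
    by (auto simp: list_some_iff)
  from picks_in(1,4)[OF ys(1)] have m: "mset xs = add_mset y (mset ys)" "length xs = Suc (length ys)" .
  obtain zs r where "mset (zs @ r) = mset ys" "length zs = length n" "P (y # zs) r"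
    using Cons.IH[OF ys(2)] Cons.prems(2) m(2) by auto
  then show ?case by (intro exI[of _ "y # zs"] exI[of _ r]) (simp add: m)
qed (auto intro: exI[of _ xs])

lemma bit_lists_complete: "length p = length n \<Longrightarrow> p \<in> set (bit_lists n)"
proof (induction n arbitrary: p)
  case (Cons x n)
  obtain b q where "p = b # q" "length q = length n" using Cons.prems by (cases p) auto
  then show ?case using Cons.IH[of q] by (cases b) (auto intro!: bexI[of _ q])
qed simp

lemma lookup_ext_in: "f \<in> set (lookup_ext q r) \<Longrightarrow> \<exists>fs. (q, fs) \<in> set r \<and> f \<in> set fs"
  by (induction r) (auto simp: same_bits_iff split: if_splits)

definition slot :: "'a list \<Rightarrow> vert \<Rightarrow> 'a" where
  "slot xs v = select6 (vert_index v) (xs ! 0) (xs ! 1) (xs ! 2) (xs ! 3) (xs ! 4) (xs ! 5)"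

definition pattern_of :: "'a reln \<Rightarrow> 'a list \<Rightarrow> vert list" where
  "pattern_of R xs = (case xs of [a,b,c,d,e,f] \<Rightarrow>
     mk_pattern [R a b, R a c, R b c, R a d, R b d, R c d, R a e, R b e, R c e, R d e] [R a f, R b f, R c f, R d f, R e f])"

lemma pattern_of_facts:
  assumes "symp R" "reflp R" "length xs = 6"
  shows "map (slot xs) (pattern_of R xs) = xs"
    "\<And>u v. u \<in> set (pattern_of R xs) \<Longrightarrow> v \<in> set (pattern_of R xs) \<Longrightarrow> vert_adj u v = R (slot xs u) (slot xs v)"
proof -
  have s: "R x y = R y x" and r: "R x x" for x y using assms by (auto dest: sympD reflpD)
  obtain a b c d e f where xs: "xs = [a,b,c,d,e,f]"
    using assms(3) by (auto simp: length_numeral_conv)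
  show "map (slot xs) (pattern_of R xs) = xs"
    by (simp add: xs pattern_of_def mk_pattern_def slot_def)
  show "vert_adj u v = R (slot xs u) (slot xs v)" if "u \<in> set (pattern_of R xs)" "v \<in> set (pattern_of R xs)" for u v
    using that unfolding xs pattern_of_def mk_pattern_def
    by (auto simp: slot_def vert_adj_def r s[of b a] s[of c a] s[of c b] s[of d a] s[of d b] s[of d c]
        s[of e a] s[of e b] s[of e c] s[of e d] s[of f a] s[of f b] s[of f c] s[of f d] s[of f e])
qed

lemma code4_transfer:
  assumes "\<And>u v. u \<in> set vs \<Longrightarrow> v \<in> set vs \<Longrightarrow> vert_adj u v = R (\<phi> u) (\<phi> v)" "length vs = 4"
  shows "code4 vert_adj vs = code4 R (map \<phi> vs)"
proof -
  obtain a b c d where "vs = [a,b,c,d]" using assms(2) by (auto simp: length_numeral_conv)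
  then show ?thesis using assms(1) by (simp add: code4_def)
qed

lemma nbr_code_transfer:
  assumes "\<And>u v. u \<in> set (vs @ ws) \<Longrightarrow> v \<in> set (vs @ ws) \<Longrightarrow> vert_adj u v = R (\<phi> u) (\<phi> v)" "length vs = 4" "length ws = 1"
  shows "nbr_code vert_adj vs ws = nbr_code R (map \<phi> vs) (map \<phi> ws)"
proof -
  obtain a b c d e where "vs = [a,b,c,d]" "ws = [e]" using assms(2,3) by (auto simp: length_numeral_conv)
  then show ?thesis using assms(1) by (simp add: nbr_code_def)
qed

text \<open>
  The tests speak about patterns of concrete points, which \<open>slot\<close> translates into the given ones.
  Patterns have six points; where fewer are given, the last ones are dropped and the relation is padded
  arbitrarily.
\<close>
lemma arrange4:
  assumes R: "symp R" "reflp R" and len: "length xs = 4"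
  shows "\<exists>zs p fs. mset zs = mset xs \<and> code4 R zs = p \<and> (p, fs) \<in> set fives"
proof -
  obtain a b c d where xs: "xs = [a,b,c,d]" using len by (auto simp: length_numeral_conv)
  define ys where "ys = [a,b,c,d,a,a]"
  define vs where "vs = butlast (butlast (mk_pattern (code4 R xs @ [True,True,True,True]) [True,True,True,True,True]))"
  have vs: "vs = [Vert I0 True (R a b) (R a c) (R a d) True True, Vert I1 (R a b) True (R b c) (R b d) True True,
     Vert I2 (R a c) (R b c) True (R c d) True True, Vert I3 (R a d) (R b d) (R c d) True True True]"
    by (simp add: vs_def xs code4_def mk_pattern_def)
  have s: "R x y = R y x" and r: "R x x" for x y using R by (auto dest: sympD reflpD)
  have m: "map (slot ys) vs = xs" by (simp add: vs ys_def slot_def xs)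
  have ad: "vert_adj u v = R (slot ys u) (slot ys v)" if "u \<in> set vs" "v \<in> set vs" for u v
    using that unfolding vs ys_def
    by (auto simp: slot_def vert_adj_def r s[of b a] s[of c a] s[of c b] s[of d a] s[of d b] s[of d c])
  have "code4 R xs \<in> set (bit_lists [I0,I0,I0,I0,I0,I0])"
    by (rule bit_lists_complete) (simp add: xs code4_def)
  with fours_complete have "some_arrangement [I0,I0,I0,I0] (\<lambda>zs r. case lookup_ext (code4 vert_adj zs) fives of [] \<Rightarrow> False | _ # _ \<Rightarrow> True) vs"
    unfolding vs_def list_all_iff by blast
  from some_arrangement_sound[OF this] obtain zs r where z': "mset (zs @ r) = mset vs" "length zs = length [I0,I0,I0,I0]"
    "case lookup_ext (code4 vert_adj zs) fives of [] \<Rightarrow> False | _ # _ \<Rightarrow> True" by (simp add: vs) blast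
  from z' have z: "mset (zs @ r) = mset vs" "length zs = 4" "lookup_ext (code4 vert_adj zs) fives \<noteq> []"
    by (auto split: list.splits)
  have "r = []" using mset_eq_length[OF z(1)] z(2) by (simp add: vs)
  then have zv: "mset zs = mset vs" using z(1) by simp
  then have "set zs = set vs" by (metis set_mset_mset)
  then have "code4 vert_adj zs = code4 R (map (slot ys) zs)"
    using ad z(2) by (intro code4_transfer) auto
  moreover have "\<exists>fs. (code4 vert_adj zs, fs) \<in> set fives"
    using z(3) lookup_ext_in by (metis list.set_intros(1) neq_Nil_conv)
  moreover have "mset (map (slot ys) zs) = mset xs" using zv m by (metis mset_map)
  ultimately show ?thesis by metis
qed

lemma arrange5:
  assumes R: "symp R" "reflp R" and len: "length xs = 5"
  shows "\<exists>zs e p fs. mset (zs @ [e]) = mset xs \<and> length zs = 4 \<and> code4 R zs = p \<and> (p, fs) \<in> set fives \<and> nbr_code R zs [e] \<in> set fs"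
proof -
  obtain x xs' where x: "xs = x # xs'" "length xs' = 4" using len by (cases xs) auto
  obtain zs0 p fs where z0: "mset zs0 = mset xs'" "code4 R zs0 = p" "(p, fs) \<in> set fives"
    using arrange4[OF R x(2)] by blast
  have "length zs0 = 4" using mset_eq_length[OF z0(1)] x by simp
  then obtain a b c d where zs0: "zs0 = [a,b,c,d]" by (auto simp: length_numeral_conv)
  define ys where "ys = [a,b,c,d,x,x]"
  define vs where "vs = butlast (mk_pattern (p @ nbr_code R zs0 [x]) [True,True,True,True,True])"
  have vs: "vs = [Vert I0 True (R a b) (R a c) (R a d) (R a x) True, Vert I1 (R a b) True (R b c) (R b d) (R b x) True,
     Vert I2 (R a c) (R b c) True (R c d) (R c x) True, Vert I3 (R a d) (R b d) (R c d) True (R d x) True,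
     Vert I4 (R a x) (R b x) (R c x) (R d x) True True]"
    by (simp add: vs_def zs0 z0(2)[symmetric] code4_def nbr_code_def mk_pattern_def)
  have s: "R x y = R y x" and r: "R x x" for x y using R by (auto dest: sympD reflpD)
  have m: "map (slot ys) vs = zs0 @ [x]" by (simp add: vs ys_def slot_def zs0)
  have ad: "vert_adj u v = R (slot ys u) (slot ys v)" if "u \<in> set vs" "v \<in> set vs" for u v
    using that unfolding vs ys_def
    by (auto simp: slot_def vert_adj_def r s[of b a] s[of c a] s[of c b] s[of d a] s[of d b] s[of d c] s[of x a] s[of x b] s[of x c] s[of x d])
  have "nbr_code R zs0 [x] \<in> set (bit_lists [I0,I0,I0,I0])"
    by (rule bit_lists_complete) (simp add: zs0 nbr_code_def)
  with fives_complete z0(3) have "some_arrangement [I0,I0,I0,I0] (\<lambda>zs r. list_some (same_bits (nbr_code vert_adj zs r)) (lookup_ext (code4 vert_adj zs) fives)) vs"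
    unfolding vs_def list_all_iff by fast
  from some_arrangement_sound[OF this] obtain zs r where z': "mset (zs @ r) = mset vs" "length zs = length [I0,I0,I0,I0]"
    "list_some (same_bits (nbr_code vert_adj zs r)) (lookup_ext (code4 vert_adj zs) fives)" by (simp add: vs) blast
  from z' have z: "mset (zs @ r) = mset vs" "length zs = 4" "nbr_code vert_adj zs r \<in> set (lookup_ext (code4 vert_adj zs) fives)"
    by (auto simp: list_some_iff same_bits_iff)
  have lr: "length r = 1" using mset_eq_length[OF z(1)] z(2) by (simp add: vs)
  have "set (zs @ r) = set vs" using z(1) by (metis set_mset_mset)
  then have c: "code4 vert_adj zs = code4 R (map (slot ys) zs)" "nbr_code vert_adj zs r = nbr_code R (map (slot ys) zs) (map (slot ys) r)"
    using ad z(2) lr by (intro code4_transfer nbr_code_transfer; auto)+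
  obtain fs' where "(code4 vert_adj zs, fs') \<in> set fives" "nbr_code vert_adj zs r \<in> set fs'"
    using lookup_ext_in[OF z(3)] by blast
  moreover obtain e where e: "map (slot ys) r = [e]" using lr by (cases r) auto
  moreover have "mset (map (slot ys) zs @ [e]) = mset xs"
  proof -
    have "mset (map (slot ys) (zs @ r)) = mset (map (slot ys) vs)" using z(1) by (metis mset_map)
    then show ?thesis using e m z0(1) x by simp
  qed
  ultimately show ?thesis using c z(2) by (metis length_map)
qed

lemma count_nb_mset: "mset xs = mset ys \<Longrightarrow> count_nb R v xs = count_nb R v ys"
  unfolding count_nb_def by (metis mset_filter size_mset)

lemma arrange6:
  assumes R: "symp R" "reflp R" and len: "length xs = 6"
  shows "\<exists>a b c d e f p fs. mset [a,b,c,d,e,f] = mset xs \<and> (p, fs) \<in> set fives \<and> code4 R [a,b,c,d] = p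
      \<and> nbr_code R [a,b,c,d] [e] \<in> set fs \<and> last_max R [a,b,c,d,e,f]"
proof -
  have "set xs \<noteq> {}" "finite (set xs)" using len by auto
  then have "Max ((\<lambda>v. count_nb R v xs) ` set xs) \<in> (\<lambda>v. count_nb R v xs) ` set xs"
    by (intro Max_in) auto
  then obtain f where f: "f \<in> set xs" "count_nb R f xs = Max ((\<lambda>v. count_nb R v xs) ` set xs)" by auto
  then have f2: "count_nb R v xs \<le> count_nb R f xs" if "v \<in> set xs" for v
    using that by simp
  have "length (remove1 f xs) = 5" using f len by (simp add: length_remove1)
  from arrange5[OF R this] obtain zs e p fs where z: "mset (zs @ [e]) = mset (remove1 f xs)" "length zs = 4"
    "code4 R zs = p" "(p, fs) \<in> set fives" "nbr_code R zs [e] \<in> set fs" by blast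
  obtain a b c d where zs: "zs = [a,b,c,d]" using z(2) by (auto simp: length_numeral_conv)
  have m: "mset [a,b,c,d,e,f] = mset xs" 
  proof -
    have "mset xs = add_mset f (mset (remove1 f xs))" using f(1) by simp
    also have "\<dots> = mset [a,b,c,d,e,f]" unfolding z(1)[symmetric] zs by (simp add: add_mset_commute)
    finally show ?thesis ..
  qed
  have "set [a,b,c,d,e,f] = set xs" using m by (metis set_mset_mset)
  then have "last_max R [a,b,c,d,e,f]"
    unfolding last_max_def Let_def list_all_iff using f2 by (simp add: count_nb_mset[OF m])
  then show ?thesis using z m zs by blast
qed

text \<open>
  Arrange the six points canonically, with a vertex of maximal degree last. The resulting pattern has been
  checked, and the sum over orderings depends neither on the arrangement nor on the names of the points.
\<close>
lemma psum_slack_nonneg: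
  assumes R: "symp R" "reflp R" and len: "length xs = 6"
  shows "0 \<le> psum 6 (slack R) xs"
proof -
  obtain a b c d e f p fs where y: "mset [a,b,c,d,e,f] = mset xs" "(p, fs) \<in> set fives" "code4 R [a,b,c,d] = p"
      "nbr_code R [a,b,c,d] [e] \<in> set fs" "last_max R [a,b,c,d,e,f]"
    using arrange6[OF R len] by blast
  define ys where "ys = [a,b,c,d,e,f]"
  define vs where "vs = pattern_of R ys"
  have ly: "length ys = 6" by (simp add: ys_def)
  note pf = pattern_of_facts[OF R ly, folded vs_def]
  have vs: "vs = mk_pattern (p @ nbr_code R [a,b,c,d] [e]) [R a f, R b f, R c f, R d f, R e f]"
    by (simp add: vs_def pattern_of_def ys_def y(3)[symmetric] code4_def nbr_code_def)
  have "extensions_ok (p @ nbr_code R [a,b,c,d] [e])"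
    using extensions_of_fives_ok y(2,4) unfolding list_all_iff by fast
  moreover have "[R a f, R b f, R c f, R d f, R e f] \<in> set (bit_lists [I0,I1,I2,I3,I4])"
    by (rule bit_lists_complete) simp
  ultimately have g: "last_max vert_adj vs \<Longrightarrow> cost vert_adj vs \<le> 10800"
    unfolding extensions_ok_def list_all_iff Let_def vs by metis
  have cnt: "count_nb vert_adj v vs = count_nb R (slot ys v) ys" if "v \<in> set vs" for v
  proof -
    have "count_nb R (slot ys v) ys = count_nb R (slot ys v) (map (slot ys) vs)" using pf(1) by simp
    also have "\<dots> = length (filter (\<lambda>u. R (slot ys v) (slot ys u)) vs)"
      by (simp add: count_nb_def filter_map o_def)
    also have "filter (\<lambda>u. R (slot ys v) (slot ys u)) vs = filter (vert_adj v) vs"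
      by (rule filter_cong) (use pf(2) that in auto)
    finally show ?thesis by (simp add: count_nb_def)
  qed
  have ne: "vs \<noteq> []" using pf(1) ly by auto
  have "last_max vert_adj vs"
    unfolding last_max_def Let_def list_all_iff
  proof
    fix v assume v: "v \<in> set vs"
    have "slot ys (last vs) = last ys" using pf(1) ne by (metis last_map)
    moreover have "slot ys v \<in> set ys" using v pf(1) by (metis imageI set_map)
    ultimately show "count_nb vert_adj v vs \<le> count_nb vert_adj (last vs) vs"
      using y(5) cnt[OF v] cnt[OF last_in_set[OF ne]] by (simp add: last_max_def Let_def list_all_iff ys_def[symmetric])
  qed
  with g have "cost vert_adj vs \<le> 10800" by simp
  moreover have "cost vert_adj vs = cost (\<lambda>x y. R (slot ys x) (slot ys y)) vs"
    by (rule cost_cong) (rule pf(2))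
  moreover have "\<dots> = cost R ys" using cost_map[of R "slot ys" vs] pf(1) by simp
  ultimately have "0 \<le> psum 6 (slack R) ys" using psum_slack[OF R(1) ly] by simp
  then show ?thesis using psum_mset[OF y(1), of 6 "slack R"] by (simp add: ys_def)
qed

lemma wsum_slack_nonneg:
  assumes "symp R" "reflp R" "\<And>x. x \<in> V \<Longrightarrow> 0 \<le> w x"
  shows "0 \<le> wsum V w 6 (\<lambda>xs. of_int (slack R xs))"
proof -
  have "0 \<le> wsum V w 6 (psum 6 (\<lambda>xs. of_int (slack R xs)))"
    by (rule wsum_nonneg[OF assms(3)]) (simp_all add: of_int_psum[symmetric] psum_slack_nonneg[OF assms(1,2)])
  moreover have "(0::real) < fact 6" by simp
  ultimately show ?thesis unfolding wsum_psum by (metis mult_nonneg_nonpos2 mult_pos_neg less_le_not_le linorder_not_less)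
qed

section \<open>The key inequality\<close>

text \<open>
  Summing entries of A over pairs of tuples is evaluating the form of A at the vector of flag weights.
\<close>
lemma wsum_form:
  assumes "\<And>xs. set xs \<subseteq> V \<Longrightarrow> length xs = n \<Longrightarrow> g xs < length A"
  shows "wsum V w n (\<lambda>xs. wsum V w n (\<lambda>ys. of_int (A ! g xs ! g ys)))
     = form A (\<lambda>k. wsum V w n (\<lambda>xs. of_bool (g xs = k)))"
proof -
  let ?n = "length A"
  have "wsum V w n (\<lambda>xs. wsum V w n (\<lambda>ys. of_int (A ! g xs ! g ys)))
     = wsum V w n (\<lambda>xs. wsum V w n (\<lambda>ys. \<Sum>i<?n. \<Sum>j<?n. of_int (A ! i ! j) * (of_bool (g xs = i) * of_bool (g ys = j))))"
  proof (intro wsum_cong)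
    fix xs ys assume "set xs \<subseteq> V" "length xs = n" "set ys \<subseteq> V" "length ys = n"
    then have lt: "g xs < ?n" "g ys < ?n" using assms by auto
    have "(\<Sum>j<?n. real_of_int (A ! i ! j) * (of_bool (g xs = i) * of_bool (g ys = j)))
        = of_int (A ! i ! (g ys)) * of_bool (g xs = i)" for i
      using lt by (simp add: of_bool_def if_distrib[where f="\<lambda>x. _ * x"] sum.delta cong: if_cong)
    then show "real_of_int (A ! g xs ! g ys) = (\<Sum>i<?n. \<Sum>j<?n. of_int (A ! i ! j) * (of_bool (g xs = i) * of_bool (g ys = j)))"
      using lt by (simp add: of_bool_def if_distrib[where f="\<lambda>x. _ * x"] sum.delta cong: if_cong)
  qed
  also have "\<dots> = form A (\<lambda>k. wsum V w n (\<lambda>xs. of_bool (g xs = k)))"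
  proof -
    have "wsum V w n (\<lambda>xs. f xs * d) = wsum V w n f * d" for d f
      using wsum_cmult[of V w n d f] by (simp add: mult.commute)
    then show ?thesis
      by (simp add: form_def wsum_sum wsum_cmult)
  qed
  finally show ?thesis .
qed

definition sector :: "'a set \<Rightarrow> 'a reln \<Rightarrow> ('a \<Rightarrow> real) \<Rightarrow> 'a \<Rightarrow> 'a \<Rightarrow> 'a \<Rightarrow> 'a \<Rightarrow> flag \<Rightarrow> real" where
  "sector V R w a b c d k = (\<Sum>e\<in>V. w e * of_bool (tflag (R a e) (R b e) (R c e) (R d e) = k))"

definition sector_variation :: "(flag \<Rightarrow> real) \<Rightarrow> real" where
  "sector_variation z = (\<Sum>f\<leftarrow>[F1, F3, F7, F14, F12, F8]. (z f - z (next_sector f))\<^sup>2)"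

lemma form_hex_laplacian: "form (matrix_of flags16 hex_laplacian) z = sector_variation (\<lambda>f. z (pos f))"
proof -
  let ?A = "matrix_of flags16 hex_laplacian"
  have l: "{..<length ?A} = {0,1,2,3,4,5,6,7,8,9,10,11,12,13,14,15}"
    by (auto simp: matrix_of_def flags16_def) presburger
  have p: "pos F1 = 1" "pos F3 = 3" "pos F7 = 7" "pos F8 = 8" "pos F12 = 12" "pos F14 = 14" by simp_all
  show ?thesis
    unfolding form_def l sector_variation_def
    by (simp add: matrix_of_def flags16_def hex_laplacian_def next_sector_def p power2_eq_square algebra_simps
        del: pos.simps)
qed

definition imbalance4 :: "'a set \<Rightarrow> 'a reln \<Rightarrow> ('a \<Rightarrow> real) \<Rightarrow> 'a list \<Rightarrow> real" where
  "imbalance4 V R w xs = (case xs of [a,b,c,d] \<Rightarrow>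
      if p3 R a b c \<and> class_of R a b c d = Some I3 then sector_variation (sector V R w a b c d) else 0 | _ \<Rightarrow> 0)"

lemma pair_form_nonneg:
  "0 \<le> wsum V w 2 (\<lambda>xs. wsum V w 2 (\<lambda>ys. of_int (case (xs, ys) of ([c,d],[e,f]) \<Rightarrow> pair_entry R a b c d e f | _ \<Rightarrow> 0)))"
proof -
  define g where "g xs = (case xs of [c,d] \<Rightarrow> pos (pflag (R a c) (R b c) (R a d) (R b d) (R c d)) | _ \<Rightarrow> 0)" for xs
  define A where "A = matrix_of flags20 (q_pair (R a b))"
  have "wsum V w 2 (\<lambda>xs. wsum V w 2 (\<lambda>ys. of_int (case (xs, ys) of ([c,d],[e,f]) \<Rightarrow> pair_entry R a b c d e f | _ \<Rightarrow> 0)))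
      = wsum V w 2 (\<lambda>xs. wsum V w 2 (\<lambda>ys. of_int (A ! g xs ! g ys)))"
  proof (intro wsum_cong arg_cong[where f=of_int])
    fix xs ys :: "'a list" assume "length xs = 2" "length ys = 2"
    then obtain c d e f where "xs = [c,d]" "ys = [e,f]" by (auto simp: length_numeral_conv)
    then show "(case (xs, ys) of ([c,d],[e,f]) \<Rightarrow> pair_entry R a b c d e f | _ \<Rightarrow> 0) = A ! g xs ! g ys"
      by (simp add: g_def A_def pair_entry_def matrix_of_nth)
  qed
  also have "\<dots> = form A (\<lambda>k. wsum V w 2 (\<lambda>xs. of_bool (g xs = k)))"
  proof (rule wsum_form)
    fix xs :: "'a list" assume "length xs = 2"
    then obtain c d where "xs = [c,d]" by (auto simp: length_numeral_conv)
    then show "g xs < length A" using pos_flags20(1) by (simp add: g_def A_def matrix_of_def)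
  qed
  also have "\<dots> \<ge> 0"
    unfolding A_def q_pair_def using psd_cert_nonneg[OF psd_adj] psd_cert_nonneg[OF psd_nonadj] by auto
  finally show ?thesis .
qed

lemma quad_form_lower:
  "(if class_of R a b c d = Some I3 then sector_variation (sector V R w a b c d) else 0)
    \<le> wsum V w 1 (\<lambda>xs. wsum V w 1 (\<lambda>ys. of_int (case (xs, ys) of ([e],[f]) \<Rightarrow> quad_entry R a b c d e f | _ \<Rightarrow> 0)))"
  (is "_ \<le> ?rhs")
proof -
  define fl where "fl e = tflag (R a e) (R b e) (R c e) (R d e)" for e
  define g where "g xs = (case xs of [e] \<Rightarrow> pos (fl e) | _ \<Rightarrow> 0)" for xs
  define z where "z k = wsum V w 1 (\<lambda>xs. of_bool (g xs = k))" for k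
  define Q where "Q = q_quad (R a d) (R b d) (R c d)"
  have "?rhs = wsum V w 1 (\<lambda>xs. wsum V w 1 (\<lambda>ys. of_int (matrix_of flags16 Q ! g xs ! g ys)))"
  proof (intro wsum_cong arg_cong[where f=of_int])
    fix xs ys :: "'a list" assume "length xs = 1" "length ys = 1"
    then obtain e f where "xs = [e]" "ys = [f]" by (auto simp: length_Suc_conv)
    then show "(case (xs, ys) of ([e],[f]) \<Rightarrow> quad_entry R a b c d e f | _ \<Rightarrow> 0) = matrix_of flags16 Q ! g xs ! g ys"
      by (simp add: g_def Q_def quad_entry_def fl_def matrix_of_nth tflag_in)
  qed
  also have "\<dots> = form (matrix_of flags16 Q) z"
    unfolding z_def
  proof (rule wsum_form)
    fix xs :: "'a list" assume "length xs = 1"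
    then obtain e where "xs = [e]" by (auto simp: length_Suc_conv)
    then show "g xs < length (matrix_of flags16 Q)"
      using pos_flags16[OF tflag_in] by (simp add: g_def fl_def matrix_of_def)
  qed
  finally have rhs: "?rhs = form (matrix_of flags16 Q) z" .
  show ?thesis
  proof (cases "class_of R a b c d = Some I3")
    case True
    then have "Q = sym_nth q_path" by (auto simp: Q_def q_quad_def class_of_def class_of_bits_def fun_eq_iff split: if_splits)
    moreover have "form (matrix_of flags16 hex_laplacian) z = sector_variation (sector V R w a b c d)"
    proof -
      have "(\<lambda>f. z (pos f)) = sector V R w a b c d"
        by (simp add: fun_eq_iff z_def sector_def g_def fl_def pos_inj)
      then show ?thesis by (simp add: form_hex_laplacian)
    qed
    ultimately show ?thesis
      using True rhs psd_cert_nonneg[OF psd_path, of z] unfolding form_matrix_diff by simp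
  next
    case False
    then have "Q \<in> {sym_nth q_copaw, sym_nth q_claw, sym_nth q_paw, sym_nth q_cycle, \<lambda>x y. 0}"
      by (cases "R a d"; cases "R b d"; cases "R c d")
        (simp_all add: Q_def q_quad_def[abs_def] class_of_def class_of_bits_def)
    moreover have "form (matrix_of flags16 (\<lambda>x y. 0)) z = 0" by (simp add: form_def matrix_of_def)
    ultimately have "0 \<le> form (matrix_of flags16 Q) z"
      using psd_cert_nonneg[OF psd_copaw, of z] psd_cert_nonneg[OF psd_claw, of z]
        psd_cert_nonneg[OF psd_paw, of z] psd_cert_nonneg[OF psd_cycle, of z] by auto
    then show ?thesis using False rhs by simp
  qed
qed

text \<open>
  Sum the slack over all 6-tuples and divide by four. The pair forms are nonnegative, the forms over four
  points are at least the imbalance, and the free entry d of a misfit contributes a factor S.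
\<close>
lemma key_inequality:
  assumes R: "symp R" "reflp R" and w: "\<And>x. x \<in> V \<Longrightarrow> 0 \<le> w x"
  shows "116640 * F49_sum V w R + 2 * sum w V * misfit_sum V w R
     + wsum V w 4 (imbalance4 V R w) \<le> 30 * sum w V ^ 6"
proof -
  define P where "P xs = (case xs of [a,b,c,d,e,f] \<Rightarrow> pair_entry R a b c d e f | _ \<Rightarrow> 0)" for xs
  define Q where "Q xs = (case xs of [a,b,c,d,e,f] \<Rightarrow> if p3 R a b c then quad_entry R a b c d e f else 0 | _ \<Rightarrow> 0)" for xs
  define B where "B xs = (case xs of [a,b,c,d,e,f] \<Rightarrow> misfit5 R [a,b,c,e,f] | _ \<Rightarrow> False)" for xs
  have "0 \<le> wsum V w 6 (\<lambda>xs. of_int (slack R xs))" by (rule wsum_slack_nonneg[OF R w])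
  also have "wsum V w 6 (\<lambda>xs. of_int (slack R xs))
      = wsum V w 6 (\<lambda>xs. 120 - (of_int (P xs) + (466560 * of_bool (is_F49 R xs) + (8 * of_bool (B xs) + 4 * of_int (Q xs)))))"
  proof (rule wsum_cong)
    fix xs :: "'a list" assume "length xs = 6"
    then obtain a b c d e f where "xs = [a,b,c,d,e,f]" by (auto simp: length_numeral_conv)
    then show "real_of_int (slack R xs)
        = 120 - (of_int (P xs) + (466560 * of_bool (is_F49 R xs) + (8 * of_bool (B xs) + 4 * of_int (Q xs))))"
      by (simp add: slack_def P_def Q_def B_def is_F49_def misfit5_def)
  qed
  also have "\<dots> = 120 * sum w V ^ 6 - (wsum V w 6 (\<lambda>xs. of_int (P xs)) + (466560 * F49_sum V w R
      + (8 * wsum V w 6 (\<lambda>xs. of_bool (B xs)) + 4 * wsum V w 6 (\<lambda>xs. of_int (Q xs)))))"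
    by (simp only: wsum_diff wsum_add wsum_cmult wsum_const)
  finally have main: "wsum V w 6 (\<lambda>xs. of_int (P xs)) + 466560 * F49_sum V w R
      + 8 * wsum V w 6 (\<lambda>xs. of_bool (B xs)) + 4 * wsum V w 6 (\<lambda>xs. of_int (Q xs)) \<le> 120 * sum w V ^ 6" by simp
  have "0 \<le> wsum V w 6 (\<lambda>xs. of_int (P xs))"
  proof -
    have "wsum V w (2 + (2 + 2)) (\<lambda>xs. of_int (P xs))
       = wsum V w 2 (\<lambda>us. wsum V w 2 (\<lambda>xs. wsum V w 2 (\<lambda>ys. of_int (P (us @ xs @ ys)))))"
      by (simp only: wsum_append)
    also have "\<dots> \<ge> 0"
    proof (rule wsum_nonneg[OF w])
      fix us :: "'a list" assume "length us = 2"
      then obtain a b where us: "us = [a,b]" by (auto simp: length_numeral_conv)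
      have "wsum V w 2 (\<lambda>xs. wsum V w 2 (\<lambda>ys. real_of_int (P (us @ xs @ ys))))
         = wsum V w 2 (\<lambda>xs. wsum V w 2 (\<lambda>ys. of_int (case (xs, ys) of ([c,d],[e,f]) \<Rightarrow> pair_entry R a b c d e f | _ \<Rightarrow> 0)))"
      proof (intro wsum_cong arg_cong[where f=of_int])
        fix xs ys :: "'a list" assume "length xs = 2" "length ys = 2"
        then obtain c d e f where "xs = [c,d]" "ys = [e,f]" by (auto simp: length_numeral_conv)
        then show "P (us @ xs @ ys) = (case (xs, ys) of ([c,d],[e,f]) \<Rightarrow> pair_entry R a b c d e f | _ \<Rightarrow> 0)"
          by (simp add: P_def us)
      qed
      then show "0 \<le> wsum V w 2 (\<lambda>xs. wsum V w 2 (\<lambda>ys. real_of_int (P (us @ xs @ ys))))"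
        using pair_form_nonneg by simp
    qed
    finally show ?thesis by simp
  qed
  moreover have "wsum V w 4 (imbalance4 V R w) \<le> wsum V w 6 (\<lambda>xs. of_int (Q xs))"
  proof -
    have "wsum V w (4 + (1 + 1)) (\<lambda>xs. of_int (Q xs))
       = wsum V w 4 (\<lambda>us. wsum V w 1 (\<lambda>xs. wsum V w 1 (\<lambda>ys. of_int (Q (us @ xs @ ys)))))"
      by (simp only: wsum_append)
    also have "\<dots> \<ge> wsum V w 4 (imbalance4 V R w)"
    proof (rule wsum_mono[OF w])
      fix us :: "'a list" assume "length us = 4"
      then obtain a b c d where us: "us = [a,b,c,d]" by (auto simp: length_numeral_conv)
      have e: "wsum V w 1 (\<lambda>xs. wsum V w 1 (\<lambda>ys. real_of_int (Q (us @ xs @ ys))))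
         = wsum V w 1 (\<lambda>xs. wsum V w 1 (\<lambda>ys. of_int (if p3 R a b c then (case (xs, ys) of ([e],[f]) \<Rightarrow> quad_entry R a b c d e f | _ \<Rightarrow> 0) else 0)))"
      proof (intro wsum_cong arg_cong[where f=of_int])
        fix xs ys :: "'a list" assume "length xs = 1" "length ys = 1"
        then obtain e f where "xs = [e]" "ys = [f]" by (auto simp: length_Suc_conv)
        then show "Q (us @ xs @ ys) = (if p3 R a b c then (case (xs, ys) of ([e],[f]) \<Rightarrow> quad_entry R a b c d e f | _ \<Rightarrow> 0) else 0)"
          by (simp add: Q_def us)
      qed
      show "imbalance4 V R w us \<le> wsum V w 1 (\<lambda>xs. wsum V w 1 (\<lambda>ys. real_of_int (Q (us @ xs @ ys))))"
      proof (cases "p3 R a b c")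
        case True
        then show ?thesis unfolding e using quad_form_lower[of R a b c d V w] by (simp add: us imbalance4_def)
      next
        case False
        then show ?thesis unfolding e by (simp add: us imbalance4_def)
      qed
    qed
    finally show ?thesis by simp
  qed
  moreover have "wsum V w 6 (\<lambda>xs. of_bool (B xs)) = sum w V * misfit_sum V w R"
  proof -
    have "wsum V w (3 + (1 + 2)) (\<lambda>xs. of_bool (B xs))
       = wsum V w 3 (\<lambda>us. sum w V * wsum V w 2 (\<lambda>ys. of_bool (misfit5 R (us @ ys))))"
      unfolding wsum_append
    proof (rule wsum_cong)
      fix us :: "'a list" assume "length us = 3"
      then obtain a b c where us: "us = [a,b,c]" by (auto simp: length_numeral_conv)
      have "wsum V w 1 (\<lambda>xs. wsum V w 2 (\<lambda>ys. of_bool (B (us @ xs @ ys))))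
         = wsum V w 1 (\<lambda>xs. wsum V w 2 (\<lambda>ys. of_bool (misfit5 R (us @ ys))))"
      proof (intro wsum_cong)
        fix xs ys :: "'a list" assume "length xs = 1" "length ys = 2"
        then obtain d e f where "xs = [d]" "ys = [e,f]" by (auto simp: length_numeral_conv)
        then show "(of_bool (B (us @ xs @ ys)) :: real) = of_bool (misfit5 R (us @ ys))" by (simp add: B_def us)
      qed
      then show "wsum V w 1 (\<lambda>xs. wsum V w 2 (\<lambda>ys. (of_bool (B (us @ xs @ ys)) :: real)))
          = sum w V * wsum V w 2 (\<lambda>ys. of_bool (misfit5 R (us @ ys)))"
        by (simp add: wsum_const)
    qed
    also have "\<dots> = sum w V * wsum V w (3 + 2) (\<lambda>xs. of_bool (misfit5 R xs))"
      by (simp only: wsum_cmult wsum_append)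
    finally show ?thesis by simp
  qed
  ultimately show ?thesis using main by simp
qed

section \<open>The weighted hexagon\<close>

lemma UNIV_six: "(UNIV :: six set) = {I0, I1, I2, I3, I4, I5}"
  using six.exhaust by blast

lemma finite_six: "finite (UNIV :: six set)"
  by (simp add: UNIV_six)

lemma card_six: "CARD(six) = 6"
  by (simp add: UNIV_six)

lemma sum_six: "(\<Sum>i\<in>UNIV. f i) = f I0 + f I1 + f I2 + f I3 + f I4 + (f I5 :: real)"
  by (simp add: UNIV_six algebra_simps)

primrec nxt :: "six \<Rightarrow> six" where
  "nxt I0 = I1" | "nxt I1 = I2" | "nxt I2 = I3" | "nxt I3 = I4" | "nxt I4 = I5" | "nxt I5 = I0"

primrec prv :: "six \<Rightarrow> six" where
  "prv I0 = I5" | "prv I1 = I0" | "prv I2 = I1" | "prv I3 = I2" | "prv I4 = I3" | "prv I5 = I4"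

lemma hex_sym: "symp hex"
proof (rule sympI)
  show "hex i j \<Longrightarrow> hex j i" for i j by (cases i; cases j; simp)
qed

lemma hex_refl: "reflp hex"
proof (rule reflpI)
  show "hex i i" for i by (cases i; simp)
qed

lemma p3_hex: "p3 hex a b c \<longleftrightarrow> (b = nxt a \<and> c = nxt b) \<or> (b = prv a \<and> c = prv b)"
  by (cases a; cases b; cases c; simp add: p3_def)

lemma class_of_hex_nxt:
  "class_of hex a (nxt a) (nxt (nxt a)) d = Some I3 \<longleftrightarrow> d = nxt (nxt (nxt a))"
  "class_of hex a (nxt a) (nxt (nxt a)) d = Some I4 \<longleftrightarrow> d = nxt (nxt (nxt (nxt a)))"
  by (cases a; cases d; simp add: class_of_def class_of_bits_def)+

lemma class_of_hex_prv:
  "class_of hex a (prv a) (prv (prv a)) d = Some I3 \<longleftrightarrow> d = prv (prv (prv a))"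
  "class_of hex a (prv a) (prv (prv a)) d = Some I4 \<longleftrightarrow> d = prv (prv (prv (prv a)))"
  by (cases a; cases d; simp add: class_of_def class_of_bits_def)+

lemma hex_nxt_prv: "hex a (nxt a)" "hex a (prv a)" "hex a a"
  by (cases a; simp)+

definition chain :: "(six \<Rightarrow> six) \<Rightarrow> six list \<Rightarrow> bool" where
  "chain s xs = (case xs of [a,b,c,d,e,f] \<Rightarrow> b = s a \<and> c = s b \<and> d = s c \<and> e = s d \<and> f = s d | _ \<Rightarrow> False)"

lemma is_F49_hex:
  assumes "length xs = 6"
  shows "of_bool (is_F49 hex xs) = (of_bool (chain nxt xs) + of_bool (chain prv xs) :: real)"
proof -
  obtain a b c d e f where xs: "xs = [a,b,c,d,e,f]" using assms by (auto simp: length_numeral_conv)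
  have "nxt a \<noteq> prv a" by (cases a; simp)
  then show ?thesis
    by (auto simp: xs is_F49_def chain_def completes_F49_def p3_hex class_of_hex_nxt class_of_hex_prv hex_nxt_prv)
qed

text \<open>
  The F49 tuples in a blowup of the hexagon with part sizes x; they run through five consecutive parts in one
  of the two directions.
\<close>
definition hexpoly :: "(six \<Rightarrow> real) \<Rightarrow> real" where
  "hexpoly x = F49_sum UNIV x hex"

definition path4 :: "(six \<Rightarrow> six) \<Rightarrow> (six \<Rightarrow> real) \<Rightarrow> six \<Rightarrow> real" where
  "path4 s x a = x a * x (s a) * x (s (s a)) * x (s (s (s a)))"

lemma wsum_graph:
  assumes "length zs = n" and P: "\<And>a xs. length xs = n \<Longrightarrow> P (a # xs) \<longleftrightarrow> xs = map (\<lambda>f. f a) zs"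
  shows "wsum UNIV x (Suc n) (\<lambda>xs. of_bool (P xs)) = (\<Sum>a\<in>(UNIV :: six set). x a * (\<Prod>f\<leftarrow>zs. x (f a)))"
proof -
  have single: "wsum UNIV x (length ys) (\<lambda>xs. of_bool (xs = ys)) = prod_list (map x ys)" for ys :: "six list"
  proof (induction ys)
    case (Cons y ys)
    have "wsum UNIV x (length (y # ys)) (\<lambda>xs. of_bool (xs = y # ys))
        = (\<Sum>a\<in>UNIV. if a = y then x y * wsum UNIV x (length ys) (\<lambda>xs. of_bool (xs = ys)) else 0)"
      by (simp add: wsum_const, intro sum.cong refl) (auto simp: wsum_const)
    then show ?case by (simp add: sum.delta finite_six Cons.IH)
  qed simp
  have "wsum UNIV x n (\<lambda>xs. of_bool (P (a # xs))) = (\<Prod>f\<leftarrow>zs. x (f a))" for a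
  proof -
    have "wsum UNIV x n (\<lambda>xs. of_bool (P (a # xs))) = wsum UNIV x n (\<lambda>xs. of_bool (xs = map (\<lambda>f. f a) zs))"
      by (rule wsum_cong) (simp add: P)
    then show ?thesis using single[of "map (\<lambda>f. f a) zs"] assms(1) by (simp add: o_def)
  qed
  then show ?thesis by simp
qed

lemma chain_sum: "wsum UNIV x 6 (\<lambda>xs. of_bool (chain s xs)) = (\<Sum>a\<in>UNIV. path4 s x a * (x (s (s (s (s a)))))\<^sup>2)"
proof -
  let ?z = "[s, \<lambda>a. s (s a), \<lambda>a. s (s (s a)), \<lambda>a. s (s (s (s a))), \<lambda>a. s (s (s (s a)))]"
  have "wsum UNIV x (Suc 5) (\<lambda>xs. of_bool (chain s xs)) = (\<Sum>a\<in>UNIV. x a * (\<Prod>f\<leftarrow>?z. x (f a)))"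
    by (rule wsum_graph) (auto simp: length_numeral_conv chain_def)
  then show ?thesis by (simp add: path4_def power2_eq_square mult.assoc)
qed

lemma hexpoly_eq:
  "hexpoly x = (\<Sum>a\<in>UNIV. path4 nxt x a * (x (nxt (nxt (nxt (nxt a)))))\<^sup>2 + path4 prv x a * (x (prv (prv (prv (prv a)))))\<^sup>2)"
proof -
  have "hexpoly x = wsum UNIV x 6 (\<lambda>xs. of_bool (chain nxt xs) + of_bool (chain prv xs))"
    unfolding hexpoly_def by (rule wsum_cong) (rule is_F49_hex)
  then show ?thesis by (simp add: wsum_add chain_sum sum.distrib)
qed

definition hex_imbalance :: "(six \<Rightarrow> real) \<Rightarrow> real" where
  "hex_imbalance x = (\<Sum>a\<in>UNIV. (x a - x (nxt a))\<^sup>2)"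

lemma sector_hex:
  "sector_variation (sector UNIV hex x a (nxt a) (nxt (nxt a)) (nxt (nxt (nxt a)))) = hex_imbalance x"
  "sector_variation (sector UNIV hex x a (prv a) (prv (prv a)) (prv (prv (prv a)))) = hex_imbalance x"
  by (cases a; simp add: sector_variation_def next_sector_def hex_imbalance_def sector_def sum_six tflag_def power2_commute)+

lemma imbalance4_hex:
  "wsum UNIV x 4 (imbalance4 UNIV hex x) = (\<Sum>a\<in>UNIV. path4 nxt x a + path4 prv x a) * hex_imbalance x"
proof -
  define r where "r s xs = (case xs of [a,b,c,d] \<Rightarrow> b = s a \<and> c = s b \<and> d = s c | _ \<Rightarrow> False)" for s and xs :: "six list"
  have path: "wsum UNIV x 4 (\<lambda>xs. of_bool (r s xs)) = (\<Sum>a\<in>UNIV. path4 s x a)" for s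
  proof -
    let ?z = "[s, \<lambda>a. s (s a), \<lambda>a. s (s (s a))]"
    have "wsum UNIV x (Suc 3) (\<lambda>xs. of_bool (r s xs)) = (\<Sum>a\<in>UNIV. x a * (\<Prod>f\<leftarrow>?z. x (f a)))"
      by (rule wsum_graph) (auto simp: length_numeral_conv r_def)
    then show ?thesis by (simp add: path4_def mult.assoc)
  qed
  have "wsum UNIV x 4 (imbalance4 UNIV hex x) = wsum UNIV x 4 (\<lambda>xs. hex_imbalance x * (of_bool (r nxt xs) + of_bool (r prv xs)))"
  proof (rule wsum_cong)
    fix xs :: "six list" assume "length xs = 4"
    then obtain a b c d where xs: "xs = [a,b,c,d]" by (auto simp: length_numeral_conv)
    have "nxt a \<noteq> prv a" by (cases a; simp)
    then show "imbalance4 UNIV hex x xs = hex_imbalance x * (of_bool (r nxt xs) + of_bool (r prv xs))"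
      by (auto simp: xs imbalance4_def r_def p3_hex class_of_hex_nxt class_of_hex_prv sector_hex)
  qed
  then show ?thesis by (simp add: wsum_cmult wsum_add path sum.distrib)
qed

lemma path4_nonneg: "(\<And>i. 0 \<le> x i) \<Longrightarrow> 0 \<le> path4 s x a"
  by (simp add: path4_def)

text \<open>
  In the hexagon every induced path on four vertices sees the imbalance of all parts, and there are at least
  as many of these paths, by weight, as F49 tuples, because the total weight is 1. Hence the imbalance term of
  the key inequality is at least their product.
\<close>
lemma hexpoly_gap:
  assumes x: "\<And>i. 0 \<le> x i" and s: "sum x UNIV = 1"
  shows "hexpoly x * (116640 + hex_imbalance x) \<le> 30"
proof -
  have le1: "x i \<le> 1" for i
    using member_le_sum[of i UNIV x] x s by (simp add: finite_six)
  have "hexpoly x \<le> (\<Sum>a\<in>UNIV. path4 nxt x a + path4 prv x a)"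
    unfolding hexpoly_eq
    by (intro sum_mono add_mono mult_left_le path4_nonneg power_le_one x le1)
  moreover have "0 \<le> hex_imbalance x" by (simp add: hex_imbalance_def sum_nonneg)
  ultimately have "hexpoly x * hex_imbalance x \<le> wsum UNIV x 4 (imbalance4 UNIV hex x)"
    unfolding imbalance4_hex by (rule mult_right_mono)
  moreover have "0 \<le> misfit_sum UNIV x hex"
    by (rule wsum_nonneg) (simp_all add: x)
  ultimately show ?thesis
    using key_inequality[OF hex_sym hex_refl, of UNIV x] x s
    by (simp add: hexpoly_def[symmetric] algebra_simps)
qed

lemma hexpoly_const: "hexpoly (\<lambda>i. t) = 12 * t ^ 6"
  by (simp add: hexpoly_eq path4_def power2_eq_square eval_nat_numeral card_six)

lemma hexpoly_scale: "hexpoly (\<lambda>i. t * x i) = t ^ 6 * hexpoly x"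
proof -
  have "path4 s (\<lambda>i. t * x i) a * (t * y)\<^sup>2 = t ^ 6 * (path4 s x a * y\<^sup>2)" for s a y
    by (simp add: path4_def power2_eq_square eval_nat_numeral algebra_simps)
  then show ?thesis by (simp add: hexpoly_eq sum_distrib_left distrib_left)
qed

text \<open>
  Neighbouring parts differ by at most \<open>\<delta>\<close>, so any two of the six parts by at most
  \<open>5 * \<delta>\<close>.
\<close>
lemma hex_imbalance_spread:
  assumes "hex_imbalance x \<le> \<delta>\<^sup>2" "0 \<le> \<delta>" "sum x UNIV = 1"
  shows "\<bar>6 * x i - 1\<bar> \<le> 30 * \<delta>"
proof -
  have step: "\<bar>x a - x (nxt a)\<bar> \<le> \<delta>" for a
  proof -
    have "(x a - x (nxt a))\<^sup>2 \<le> hex_imbalance x"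
      unfolding hex_imbalance_def by (rule member_le_sum) (simp_all add: finite_six)
    then have "(x a - x (nxt a))\<^sup>2 \<le> \<delta>\<^sup>2" using assms(1) by linarith
    then have "\<bar>x a - x (nxt a)\<bar> \<le> \<bar>\<delta>\<bar>" by (simp only: abs_le_square_iff)
    then show ?thesis using assms(2) by linarith
  qed
  have up: "x a \<le> x (nxt a) + \<delta>" and lo: "x (nxt a) \<le> x a + \<delta>" for a
    using step[of a] by (auto simp: abs_le_iff)
  define y where "y k = x ((nxt ^^ k) i)" for k
  have up': "y 0 \<le> y k + real k * \<delta>" and lo': "y k \<le> y 0 + real k * \<delta>" for k
  proof (induction k)
    case (Suc k)
    have "y k \<le> y (Suc k) + \<delta>" "y (Suc k) \<le> y k + \<delta>" using up[of "(nxt ^^ k) i"] lo[of "(nxt ^^ k) i"] by (simp_all add: y_def)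
    moreover have "real (Suc k) * \<delta> = real k * \<delta> + \<delta>" by (simp add: algebra_simps)
    ultimately show "y 0 \<le> y (Suc k) + real (Suc k) * \<delta>" "y (Suc k) \<le> y 0 + real (Suc k) * \<delta>"
      using Suc by linarith+
  qed simp_all
  have orbit: "y 0 + y 1 + y 2 + y 3 + y 4 + y 5 = 1"
    using assms(3) by (cases i; simp add: y_def sum_six eval_nat_numeral)
  have "6 * y 0 - 1 \<le> 30 * \<delta>"
    using orbit up'[of 1] up'[of 2] up'[of 3] up'[of 4] up'[of 5] assms(2) by simp
  moreover have "- (6 * y 0 - 1) \<le> 30 * \<delta>"
    using orbit lo'[of 1] lo'[of 2] lo'[of 3] lo'[of 4] lo'[of 5] assms(2) by simp
  ultimately show ?thesis by (simp add: abs_le_iff y_def)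
qed

text \<open>
  The constant is \<open>233280 = 30 * 7776\<close>: by hexpoly_gap the product of the F49 sum and the imbalance
  is at most \<open>30 * \<delta>\<^sup>2 / 233280\<close>, and the F49 sum is at least \<open>1 / 7776\<close>,
  half its maximum. With \<open>\<delta> = 0\<close> this is the uniqueness of the maximiser.
\<close>
lemma hexpoly_near_max:
  assumes x: "\<And>i. 0 \<le> x i" and s: "sum x UNIV = 1" and \<delta>: "0 \<le> \<delta>" "\<delta> \<le> 1"
    and big: "hexpoly x \<ge> (1 - \<delta>\<^sup>2 / 233280) / 3888"
  shows "\<bar>6 * x i - 1\<bar> \<le> 30 * \<delta>"
proof (rule hex_imbalance_spread[OF _ \<delta>(1) s])
  have \<delta>2: "\<delta>\<^sup>2 \<le> 1" using \<delta> by (simp add: power_le_one)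
  have h: "hexpoly x * hex_imbalance x \<le> 30 - 116640 * hexpoly x" using hexpoly_gap[OF x s] by (simp add: algebra_simps)
  also have "\<dots> \<le> 30 * (\<delta>\<^sup>2 / 233280)" using big by (simp add: field_simps)
  finally have "hexpoly x * hex_imbalance x \<le> 30 * (\<delta>\<^sup>2 / 233280)" .
  moreover have "1 / 7776 \<le> hexpoly x" using big \<delta>2 by (simp add: field_simps)
  then have "1 / 7776 * hex_imbalance x \<le> hexpoly x * hex_imbalance x"
    by (rule mult_right_mono) (simp add: hex_imbalance_def sum_nonneg)
  ultimately show "hex_imbalance x \<le> \<delta>\<^sup>2" by (simp add: field_simps)
qed

lemma hexpoly_le: "(\<And>i. 0 \<le> x i) \<Longrightarrow> sum x UNIV = 1 \<Longrightarrow> hexpoly x \<le> 1 / 3888"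
proof -
  assume x: "\<And>i. 0 \<le> x i" and s: "sum x UNIV = 1"
  have "0 \<le> hexpoly x" unfolding hexpoly_def by (rule wsum_nonneg) (simp_all add: x)
  moreover have "0 \<le> hex_imbalance x" by (simp add: hex_imbalance_def sum_nonneg)
  ultimately have "0 \<le> hexpoly x * hex_imbalance x" by simp
  then show "hexpoly x \<le> 1 / 3888" using hexpoly_gap[OF x s] by (simp add: algebra_simps)
qed

lemma wsum_group:
  assumes "finite V"
  shows "wsum V w n (\<lambda>xs. f (map c xs)) = wsum UNIV (\<lambda>i::six. \<Sum>v\<in>{v\<in>V. c v = i}. w v) n f"
proof (induction n arbitrary: f)
  case (Suc n)
  have "wsum V w (Suc n) (\<lambda>xs. f (map c xs)) = (\<Sum>v\<in>V. w v * wsum V w n (\<lambda>xs. f (c v # map c xs)))" by simp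
  also have "\<dots> = (\<Sum>i\<in>UNIV. \<Sum>v\<in>{v\<in>V. c v = i}. w v * wsum V w n (\<lambda>xs. f (c v # map c xs)))"
    by (rule sum.group[symmetric]) (simp_all add: assms finite_six)
  also have "\<dots> = (\<Sum>i\<in>UNIV. (\<Sum>v\<in>{v\<in>V. c v = i}. w v) * wsum V w n (\<lambda>xs. f (i # map c xs)))"
    by (intro sum.cong refl) (simp add: sum_distrib_right)
  also have "\<dots> = (\<Sum>i\<in>UNIV. (\<Sum>v\<in>{v\<in>V. c v = i}. w v)
      * wsum UNIV (\<lambda>i. \<Sum>v\<in>{v\<in>V. c v = i}. w v) n (\<lambda>xs. f (i # xs)))"
    by (intro sum.cong refl arg_cong2[where f="(*)"] Suc.IH)
  finally show ?case by simp
qed simp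

section \<open>Counting copies of F49 by tuples\<close>

definition grel :: "'a graph \<Rightarrow> 'a \<Rightarrow> 'a \<Rightarrow> bool" where
  "grel G u v \<longleftrightarrow> u = v \<or> {u, v} \<in> edges G"

lemma grel_sym: "symp (grel G)"
  by (auto simp: symp_def grel_def insert_commute)

lemma grel_refl: "reflp (grel G)"
  by (simp add: reflp_def grel_def)

text \<open>
  The relation of F49 itself, with the vertices listed in the order of a tuple; \<open>F49_label\<close> gives
  their names in F49.
\<close>
primrec F49_rel :: "six \<Rightarrow> six \<Rightarrow> bool" where
  "F49_rel I0 j = select6 j True True False False False False"
| "F49_rel I1 j = select6 j True True True False False False"
| "F49_rel I2 j = select6 j False True True True False False"
| "F49_rel I3 j = select6 j False False True True True True"
| "F49_rel I4 j = select6 j False False False True True True"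
| "F49_rel I5 j = select6 j False False False True True True"

primrec F49_label :: "six \<Rightarrow> nat" where
  "F49_label I0 = 2" | "F49_label I1 = 1" | "F49_label I2 = 3" | "F49_label I3 = 0" | "F49_label I4 = 4" | "F49_label I5 = 5"

lemma F49_label_bij: "bij_betw F49_label UNIV {0..<6}"
proof -
  have "F49_label ` UNIV = {0..<6}" by (auto simp: UNIV_six)
  moreover have "inj F49_label"
  proof (rule injI)
    fix i j show "F49_label i = F49_label j \<Longrightarrow> i = j" by (cases i; cases j; simp)
  qed
  ultimately show ?thesis by (simp add: bij_betw_def)
qed

lemma F49_rel_label: "F49_rel i j \<longleftrightarrow> i = j \<or> {F49_label i, F49_label j} \<in> edges F49"
  by (cases i; cases j; simp add: F49_def doubleton_eq_iff)

lemma F49_no_loop: "{F49_label i} \<notin> edges F49"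
  by (cases i; simp add: F49_def doubleton_eq_iff)

lemma is_F49_iff_rel:
  assumes R: "symp R" "reflp R"
  shows "is_F49 R [x I0, x I1, x I2, x I3, x I4, x I5] \<longleftrightarrow> (\<forall>i j. R (x i) (x j) = F49_rel i j)"
proof -
  have s: "R u v = R v u" and r: "R u u" for u v using R by (auto dest: sympD reflpD)
  have "(\<forall>i j. R (x i) (x j) = F49_rel i j) \<longleftrightarrow> (\<forall>i\<in>{I0,I1,I2,I3,I4,I5}. \<forall>j\<in>{I0,I1,I2,I3,I4,I5}. R (x i) (x j) = F49_rel i j)"
    unfolding UNIV_six[symmetric] by simp
  also have "\<dots> \<longleftrightarrow> is_F49 R [x I0, x I1, x I2, x I3, x I4, x I5]"
    by (auto simp: is_F49_def p3_def completes_F49_def class_of_def class_of_bits_def r s[of "x I1" "x I0"] s[of "x I2" "x I0"] s[of "x I3" "x I0"]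
        s[of "x I4" "x I0"] s[of "x I5" "x I0"] s[of "x I2" "x I1"] s[of "x I3" "x I1"] s[of "x I4" "x I1"] s[of "x I5" "x I1"]
        s[of "x I3" "x I2"] s[of "x I4" "x I2"] s[of "x I5" "x I2"] s[of "x I4" "x I3"] s[of "x I5" "x I3"] s[of "x I5" "x I4"]
        split: if_splits)
  finally show ?thesis by simp
qed

text \<open>
  The points 4 and 5 are the only two with equal closed neighbourhoods, so that these are the only entries of a tuple
  that can coincide.
\<close>
lemma F49_rel_inj:
  assumes "reflp R" "\<forall>i j. R (x i) (x j) = F49_rel i j" "x I4 \<noteq> x I5"
  shows "inj x"
proof (rule injI)
  fix i j assume "x i = x j"
  then have "F49_rel i k = F49_rel j k" for k using assms(2) by metis
  from this[of I0] this[of I1] this[of I2] this[of I3] this[of I4] show "i = j"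
    using assms(3) \<open>x i = x j\<close> by (cases i; cases j; simp)
qed

lemma F49_rel_automorphisms:
  assumes t: "is_F49 F49_rel [i0,i1,i2,i3,i4,i5]" and ne: "i4 \<noteq> i5"
  shows "[i0,i1,i2,i3] = [I0,I1,I2,I3] \<and> {i4, i5} = {I4, I5}"
proof -
  let ?L = "[I0,I1,I2,I3,I4,I5]"
  have check: "list_all (\<lambda>a. list_all (\<lambda>b. list_all (\<lambda>c. if p3 F49_rel a b c then
      list_all (\<lambda>d. list_all (\<lambda>e. list_all (\<lambda>f. if is_F49 F49_rel [a,b,c,d,e,f] then
        (if e = f then True else a = I0 \<and> b = I1 \<and> c = I2 \<and> d = I3 \<and> (if e = I4 then f = I5 else e = I5 \<and> f = I4)) else True) ?L) ?L) ?L
      else True) ?L) ?L) ?L"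
    by code_simp
  have L: "i \<in> set ?L" for i by (cases i) simp_all
  have p: "p3 F49_rel i0 i1 i2" using t by (simp add: is_F49_def)
  note c1 = check[unfolded list_all_iff, rule_format, OF L[of i0] L[of i1] L[of i2], unfolded if_P[OF p], rule_format,
      OF L[of i3] L[of i4] L[of i5], unfolded if_P[OF t] if_not_P[OF ne]]
  then show ?thesis by (auto split: if_splits)
qed

definition copies :: "'a graph \<Rightarrow> 'a set set" where
  "copies G = {S. S \<subseteq> verts G \<and> card S = card (verts F49) \<and> isomorphic (induced G S) F49}"

definition tuples :: "'a graph \<Rightarrow> 'a list set" where
  "tuples G = {xs. set xs \<subseteq> verts G \<and> length xs = 6 \<and> is_F49 (grel G) xs \<and> xs ! 4 \<noteq> xs ! 5}"

lemma list_of_six: "length xs = 6 \<Longrightarrow> \<exists>x. xs = map x [I0,I1,I2,I3,I4,I5]"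
proof -
  assume "length xs = 6"
  then obtain a b c d e f where "xs = [a,b,c,d,e,f]" by (auto simp: length_numeral_conv)
  then show ?thesis by (intro exI[of _ "\<lambda>i. select6 i a b c d e f"]) simp
qed

lemma tuples_iff:
  "map x [I0,I1,I2,I3,I4,I5] \<in> tuples G \<longleftrightarrow>
     range x \<subseteq> verts G \<and> (\<forall>i j. grel G (x i) (x j) = F49_rel i j) \<and> x I4 \<noteq> x I5"
  using is_F49_iff_rel[OF grel_sym grel_refl, of G x] by (auto simp: tuples_def UNIV_six)

lemma tuple_copy:
  assumes "map x [I0,I1,I2,I3,I4,I5] \<in> tuples G"
    and nl: "\<And>v. {v} \<notin> edges G"
  shows "range x \<in> copies G"
proof -
  have x: "range x \<subseteq> verts G" "\<And>i j. grel G (x i) (x j) = F49_rel i j" "x I4 \<noteq> x I5"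
    using assms(1) unfolding tuples_iff by blast+
  have inj: "inj x" by (rule F49_rel_inj[OF grel_refl[of G]]) (use x in auto)
  let ?f = "F49_label \<circ> inv x"
  have "bij_betw (inv x) (range x) UNIV" using inj by (rule inj_imp_bij_betw_inv)
  then have "bij_betw ?f (range x) {0..<6}" using F49_label_bij by (rule bij_betw_trans)
  moreover have "{x i, x j} \<in> edges G \<longleftrightarrow> {F49_label i, F49_label j} \<in> edges F49" for i j
  proof (cases "i = j")
    case True then show ?thesis using nl F49_no_loop by simp
  next
    case False
    then have "x i \<noteq> x j" using inj by (auto dest: injD)
    then show ?thesis using x(2)[of i j] False by (simp add: grel_def F49_rel_label)
  qed
  ultimately have "graph_isomorphism (induced G (range x)) F49 ?f"
    using inj by (auto simp: graph_isomorphism_def induced_def F49_def)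
  moreover have "card (range x) = card (verts F49)"
    using inj by (simp add: card_image card_six F49_def)
  ultimately show ?thesis using x(1) by (auto simp: copies_def isomorphic_def)
qed

lemma copy_tuple:
  assumes "S \<in> copies G"
  shows "\<exists>x. map x [I0,I1,I2,I3,I4,I5] \<in> tuples G \<and> range x = S"
proof -
  obtain g where S: "S \<subseteq> verts G" and g: "graph_isomorphism (induced G S) F49 g"
    using assms by (auto simp: copies_def isomorphic_def)
  have bij: "bij_betw g S {0..<6}" and e: "\<And>x y. x \<in> S \<Longrightarrow> y \<in> S \<Longrightarrow> {x, y} \<in> edges G \<longleftrightarrow> {g x, g y} \<in> edges F49"
    using g by (auto simp: graph_isomorphism_def induced_def F49_def)
  define x where "x = inv_into S g \<circ> F49_label"
  have b: "bij_betw x UNIV S"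
    unfolding x_def using F49_label_bij bij_betw_inv_into[OF bij] by (rule bij_betw_trans)
  have gx: "g (x i) = F49_label i" for i
  proof -
    have "F49_label i \<in> {0..<6}" using F49_label_bij by (auto simp: bij_betw_def)
    then show ?thesis using bij_betw_inv_into_right[OF bij] by (simp add: x_def)
  qed
  have xS: "x i \<in> S" for i using b by (auto simp: bij_betw_def)
  have inj: "x i = x j \<longleftrightarrow> i = j" for i j using b by (auto simp: bij_betw_def dest: injD)
  have "grel G (x i) (x j) = F49_rel i j" for i j
    using e[OF xS xS, of i j] inj[of i j] by (simp add: grel_def F49_rel_label gx)
  then have "map x [I0,I1,I2,I3,I4,I5] \<in> tuples G"
    using S xS inj[of I4 I5] unfolding tuples_iff by auto
  then show ?thesis using b by (auto simp: bij_betw_def)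
qed

text \<open>
  The two tuples of a copy differ by the swap of the end vertices, the only automorphism of F49 but the
  identity.
\<close>
lemma copy_two_tuples:
  assumes "S \<in> copies G"
  shows "card {xs \<in> tuples G. set xs = S} = 2"
proof -
  obtain x where x: "map x [I0,I1,I2,I3,I4,I5] \<in> tuples G" "range x = S"
    using copy_tuple[OF assms] by blast
  have rel: "\<And>i j. grel G (x i) (x j) = F49_rel i j" "x I4 \<noteq> x I5" using x(1) unfolding tuples_iff by blast+
  have inj: "inj x" by (rule F49_rel_inj[OF grel_refl[of G]]) (use rel in auto)
  let ?y = "[x I0, x I1, x I2, x I3, x I5, x I4]"
  have "{xs \<in> tuples G. set xs = S} = {map x [I0,I1,I2,I3,I4,I5], ?y}"
  proof (intro equalityI subsetI)
    fix xs assume xs: "xs \<in> {xs \<in> tuples G. set xs = S}"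
    then have xt: "xs \<in> tuples G" "set xs = S" by auto
    then have "length xs = 6" by (simp add: tuples_def)
    then obtain y where y: "xs = map y [I0,I1,I2,I3,I4,I5]" using list_of_six by blast
    have "range y = S" using xt(2) y by (auto simp: UNIV_six)
    then have yS: "\<And>i. y i \<in> range x" using x(2) by blast
    define p where "p i = inv x (y i)" for i
    have yp: "y i = x (p i)" for i using yS by (simp add: p_def f_inv_into_f)
    have yr: "\<And>i j. grel G (y i) (y j) = F49_rel i j" "y I4 \<noteq> y I5"
      using xt(1) unfolding y tuples_iff by blast+
    have "\<forall>i j. F49_rel (p i) (p j) = F49_rel i j" using yr(1) unfolding yp rel(1) by blast
    moreover have "symp F49_rel" "reflp F49_rel"
    proof -
      show "symp F49_rel" by (rule sympI) (use sympD[OF grel_sym, of G] in \<open>simp add: rel(1)[symmetric]\<close>)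
      show "reflp F49_rel" by (rule reflpI) (use reflpD[OF grel_refl, of G] in \<open>simp add: rel(1)[symmetric]\<close>)
    qed
    ultimately have "is_F49 F49_rel [p I0, p I1, p I2, p I3, p I4, p I5]" using is_F49_iff_rel[of F49_rel p] by simp
    moreover have "p I4 \<noteq> p I5" using yr(2) unfolding yp by auto
    ultimately have "[p I0,p I1,p I2,p I3] = [I0,I1,I2,I3] \<and> {p I4, p I5} = {I4, I5}" by (rule F49_rel_automorphisms)
    then have "p I0 = I0" "p I1 = I1" "p I2 = I2" "p I3 = I3" "p I4 = I4 \<and> p I5 = I5 \<or> p I4 = I5 \<and> p I5 = I4"
      by (auto simp: doubleton_eq_iff)
    then show "xs \<in> {map x [I0,I1,I2,I3,I4,I5], ?y}" unfolding y list.map yp by auto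
  next
    fix xs assume xs: "xs \<in> {map x [I0,I1,I2,I3,I4,I5], ?y}"
    have "?y \<in> tuples G"
    proof -
      define z where "z i = x (if i = I4 then I5 else if i = I5 then I4 else i)" for i
      have "range z \<subseteq> verts G" using x(1) unfolding tuples_iff z_def by blast
      moreover have "grel G (z i) (z j) = F49_rel i j" for i j
        unfolding z_def rel(1) by (cases i; cases j; simp)
      ultimately have "map z [I0,I1,I2,I3,I4,I5] \<in> tuples G"
        unfolding tuples_iff using rel(2) by (auto simp: z_def)
      then show ?thesis by (simp add: z_def)
    qed
    moreover have "set ?y = S" "set (map x [I0,I1,I2,I3,I4,I5]) = S" using x(2) by (auto simp: UNIV_six)
    ultimately show "xs \<in> {xs \<in> tuples G. set xs = S}" using x(1) xs by (elim insertE emptyE) blast+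
  qed
  moreover have "map x [I0,I1,I2,I3,I4,I5] \<noteq> ?y" using rel(2) by simp
  ultimately show ?thesis by simp
qed

lemma simple_no_loop: "simple_graph G \<Longrightarrow> {v} \<notin> edges G"
  unfolding simple_graph_def by (auto simp: doubleton_eq_iff)

lemma card_tuples:
  assumes "simple_graph G"
  shows "card (tuples G) = 2 * card (copies G)"
proof -
  have fV: "finite (verts G)" using assms by (simp add: simple_graph_def)
  have fin: "finite (tuples G)"
    by (rule finite_subset[OF _ finite_lists_length_eq[OF fV, of 6]]) (auto simp: tuples_def)
  have finc: "finite (copies G)" by (rule finite_subset[of _ "Pow (verts G)"]) (auto simp: copies_def fV)
  have sub: "set ` tuples G \<subseteq> copies G"
  proof clarify
    fix xs assume xs: "xs \<in> tuples G"
    then obtain x where x: "xs = map x [I0,I1,I2,I3,I4,I5]" using list_of_six[of xs] by (auto simp: tuples_def)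
    have "set xs = range x" by (auto simp: x UNIV_six)
    then show "set xs \<in> copies G" using tuple_copy[of x G] xs x simple_no_loop[OF assms] by auto
  qed
  have "card (tuples G) = (\<Sum>xs\<in>tuples G. 1)" by simp
  also have "\<dots> = (\<Sum>S\<in>copies G. \<Sum>xs\<in>{xs \<in> tuples G. set xs = S}. 1)"
    by (rule sum.group[symmetric]) (rule fin finc sub)+
  also have "\<dots> = (\<Sum>S\<in>copies G. 2)" by (rule sum.cong[OF refl]) (simp add: copy_two_tuples)
  finally show ?thesis by simp
qed

definition repeat_last :: "'a list \<Rightarrow> 'a list" where
  "repeat_last ys = ys @ [last ys]"

abbreviation folded_sum :: "'a set \<Rightarrow> ('a \<Rightarrow> real) \<Rightarrow> 'a reln \<Rightarrow> real" where
  "folded_sum V w R \<equiv> wsum V w 5 (\<lambda>ys. of_bool (is_F49 R (repeat_last ys)))"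

text \<open>The tuples whose last two entries coincide are not copies and have to be subtracted.\<close>
lemma card_copies:
  assumes "simple_graph G"
  shows "real (card (copies G)) * 2 = F49_sum (verts G) (\<lambda>_. 1) (grel G)
      - folded_sum (verts G) (\<lambda>_. 1) (grel G)"
proof -
  have fV: "finite (verts G)" using assms by (simp add: simple_graph_def)
  let ?A = "{xs. set xs \<subseteq> verts G \<and> length xs = 6 \<and> is_F49 (grel G) xs}"
  let ?B = "{ys. set ys \<subseteq> verts G \<and> length ys = 5 \<and> is_F49 (grel G) (repeat_last ys)}"
  have finA: "finite ?A" by (rule finite_subset[OF _ finite_lists_length_eq[OF fV, of 6]]) auto
  have "?A = tuples G \<union> repeat_last ` ?B"
  proof (intro equalityI subsetI)
    fix xs assume xs: "xs \<in> ?A"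
    then obtain x where x: "xs = map x [I0,I1,I2,I3,I4,I5]" using list_of_six[of xs] by auto
    show "xs \<in> tuples G \<union> repeat_last ` ?B"
    proof (cases "x I4 = x I5")
      case True
      then have "xs = repeat_last [x I0,x I1,x I2,x I3,x I4]" by (simp add: x repeat_last_def)
      moreover have "[x I0,x I1,x I2,x I3,x I4] \<in> ?B" using xs calculation by (auto simp: x)
      ultimately show ?thesis by blast
    qed (use xs in \<open>auto simp: x tuples_def\<close>)
  next
    fix xs assume "xs \<in> tuples G \<union> repeat_last ` ?B"
    then show "xs \<in> ?A"
    proof
      assume "xs \<in> repeat_last ` ?B"
      then obtain ys where ys: "ys \<in> ?B" "xs = repeat_last ys" by blast
      then have "ys \<noteq> []" by auto
      then show ?thesis using ys last_in_set[of ys] by (auto simp: repeat_last_def)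
    qed (auto simp: tuples_def)
  qed
  moreover have "tuples G \<inter> repeat_last ` ?B = {}"
  proof -
    have "repeat_last ys ! 4 = repeat_last ys ! 5" if l5: "length ys = 5" for ys :: "'a list"
    proof -
      obtain a b c d e where "ys = [a,b,c,d,e]" using l5 by (auto simp: length_numeral_conv)
      then show ?thesis by (simp add: repeat_last_def)
    qed
    then show ?thesis by (auto simp: tuples_def)
  qed
  moreover have "inj_on repeat_last ?B" by (auto simp: inj_on_def repeat_last_def)
  ultimately have "card ?A = card (tuples G) + card ?B"
    using finA by (simp add: card_Un_disjoint card_image)
  then show ?thesis by (simp add: wsum_card[OF fV] card_tuples[OF assms])
qed

lemma density_copies: "density F49 G = real (card (copies G)) / real (card (verts G) choose 6)"
  by (simp add: density_def copies_def F49_def)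

primrec part_index :: "six \<Rightarrow> nat" where
  "part_index I0 = 0" | "part_index I1 = 1" | "part_index I2 = 2" | "part_index I3 = 3" | "part_index I4 = 4" | "part_index I5 = 5"

lemma part_index_inj: "part_index i = part_index j \<longleftrightarrow> i = j"
  by (cases i; cases j; simp)

lemma part_index_range: "range part_index = verts B49"
  by (auto simp: UNIV_six B49_def)

lemma hex_part_index: "hex i j \<longleftrightarrow> {part_index i, part_index j} \<in> edges B49"
  by (cases i; cases j; simp add: B49_def doubleton_eq_iff)

text \<open>Blowups of the hexagon, described by the map that sends each vertex to its part.\<close>
definition hexgraph :: "'a set \<Rightarrow> ('a \<Rightarrow> six) \<Rightarrow> 'a graph" where
  "hexgraph V c = (V, {{u, v} | u v. u \<in> V \<and> v \<in> V \<and> u \<noteq> v \<and> hex (c u) (c v)})"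

lemma hexgraph_simple: "finite V \<Longrightarrow> simple_graph (hexgraph V c)"
  by (auto simp: simple_graph_def hexgraph_def)

lemma hexgraph_verts: "verts (hexgraph V c) = V"
  by (simp add: hexgraph_def)

lemma hex_commute: "hex i j = hex j i"
  using hex_sym by (auto dest: sympD)

lemma grel_hexgraph: "u \<in> V \<Longrightarrow> v \<in> V \<Longrightarrow> grel (hexgraph V c) u v = hex (c u) (c v)"
  using hex_refl by (auto simp: grel_def hexgraph_def doubleton_eq_iff hex_commute dest: reflpD)

lemma hexgraph_blowup:
  assumes "finite V"
  shows "hexgraph V c \<in> blowup_family B49"
proof -
  define W where "W i = {v\<in>V. part_index (c v) = i}" for i
  have "blowup_parts B49 W"
    using assms by (auto simp: blowup_parts_def W_def disjoint_family_on_def)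
  moreover have "hexgraph V c = blowup B49 W"
  proof -
    have inB: "part_index i \<in> verts B49" for i using part_index_range by blast
    have "(\<Union>i\<in>verts B49. W i) = V" using inB by (auto simp: W_def)
    moreover have "{{u, v} | u v. u \<in> V \<and> v \<in> V \<and> u \<noteq> v \<and> hex (c u) (c v)}
       = {{x, y} | x y i j. i \<in> verts B49 \<and> j \<in> verts B49 \<and> x \<in> W i \<and> y \<in> W j \<and> x \<noteq> y \<and> {i, j} \<in> edges B49}"
      unfolding hex_part_index using inB by (fastforce simp: W_def)
    ultimately show ?thesis by (simp add: hexgraph_def blowup_def)
  qed
  ultimately show ?thesis unfolding blowup_family_def by blast
qed

lemma blowup_hexgraph:
  assumes "blowup_parts B49 W"
  shows "\<exists>V c. finite V \<and> blowup B49 W = hexgraph V c \<and> (\<forall>i. {v\<in>V. c v = i} = W (part_index i))"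
proof -
  define V where "V = (\<Union>i. W (part_index i))"
  define c where "c v = (SOME i. v \<in> W (part_index i))" for v
  have inB: "part_index i \<in> verts B49" for i using part_index_range by blast
  have disj: "W (part_index i) \<inter> W (part_index j) = {}" if "i \<noteq> j" for i j
    using assms that inB part_index_inj unfolding blowup_parts_def disjoint_family_on_def by metis
  have c: "c v = i" if "v \<in> W (part_index i)" for v i
    unfolding c_def using that disj by (intro some_equality) auto
  have cV: "v \<in> W (part_index (c v))" if "v \<in> V" for v using that c by (auto simp: V_def)
  have "finite V" using assms inB by (auto simp: V_def blowup_parts_def finite_six)
  moreover have parts: "{v\<in>V. c v = i} = W (part_index i)" for i
    using c cV by (auto simp: V_def)
  moreover have "blowup B49 W = hexgraph V c"
  proof -
    have "(\<Union>i\<in>verts B49. W i) = V" unfolding V_def part_index_range[symmetric] by simp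
    moreover have "{{x, y} | x y i j. i \<in> verts B49 \<and> j \<in> verts B49 \<and> x \<in> W i \<and> y \<in> W j \<and> x \<noteq> y \<and> {i, j} \<in> edges B49}
       = {{u, v} | u v. u \<in> V \<and> v \<in> V \<and> u \<noteq> v \<and> hex (c u) (c v)}" (is "?L = ?R")
    proof (intro equalityI subsetI)
      fix e assume "e \<in> ?L"
      then obtain x y i j where "e = {x, y}" "i \<in> verts B49" "j \<in> verts B49" "x \<in> W i" "y \<in> W j" "x \<noteq> y" "{i, j} \<in> edges B49"
        by blast
      moreover from this obtain i' j' where "i = part_index i'" "j = part_index j'" using part_index_range by blast
      ultimately have "e = {x, y}" "x \<in> V" "y \<in> V" "x \<noteq> y" "hex (c x) (c y)" using c by (auto simp: V_def hex_part_index)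
      then show "e \<in> ?R" by blast
    next
      fix e assume "e \<in> ?R"
      then obtain u v where "e = {u, v}" "u \<in> V" "v \<in> V" "u \<noteq> v" "hex (c u) (c v)" by blast
      then show "e \<in> ?L" using cV inB unfolding hex_part_index by blast
    qed
    ultimately show ?thesis by (simp add: hexgraph_def blowup_def)
  qed
  ultimately show ?thesis by blast
qed

lemma is_F49_cong:
  assumes "length xs = 6" "\<And>u v. u \<in> set xs \<Longrightarrow> v \<in> set xs \<Longrightarrow> R u v = R' u v"
  shows "is_F49 R xs = is_F49 R' xs"
proof -
  obtain a b c d e f where "xs = [a,b,c,d,e,f]" using assms(1) by (auto simp: length_numeral_conv)
  then show ?thesis using assms(2) by (simp add: is_F49_def p3_def completes_F49_def class_of_def)
qed

lemma is_F49_map: "is_F49 R (map c xs) = is_F49 (\<lambda>u v. R (c u) (c v)) xs"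
  by (auto simp: is_F49_def p3_def completes_F49_def class_of_def split: list.splits)

definition part_size :: "'a set \<Rightarrow> ('a \<Rightarrow> six) \<Rightarrow> six \<Rightarrow> real" where
  "part_size V c i = real (card {v\<in>V. c v = i})"

lemma sum_part_size: "finite V \<Longrightarrow> sum (part_size V c) UNIV = real (card V)"
proof -
  assume "finite V"
  then have "(\<Sum>i\<in>UNIV. \<Sum>v\<in>{v\<in>V. c v = i}. (1::real)) = (\<Sum>v\<in>V. 1)"
    by (intro sum.group) (auto simp: finite_six)
  then show ?thesis by (simp add: part_size_def)
qed

lemma wsum_hexgraph:
  assumes "finite V"
  shows "F49_sum V w (grel (hexgraph V c)) = hexpoly (\<lambda>i. \<Sum>v\<in>{v\<in>V. c v = i}. w v)"
proof -
  have "F49_sum V w (grel (hexgraph V c)) = wsum V w 6 (\<lambda>xs. of_bool (is_F49 hex (map c xs)))"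
  proof (rule wsum_cong)
    fix xs assume "set xs \<subseteq> V" "length xs = 6"
    then have "is_F49 (grel (hexgraph V c)) xs = is_F49 (\<lambda>u v. hex (c u) (c v)) xs"
      by (intro is_F49_cong) (auto intro!: grel_hexgraph)
    then show "(of_bool (is_F49 (grel (hexgraph V c)) xs) :: real) = of_bool (is_F49 hex (map c xs))"
      by (simp add: is_F49_map)
  qed
  then show ?thesis using wsum_group[OF assms, of w 6 "\<lambda>xs. of_bool (is_F49 hex xs)" c] by (simp add: hexpoly_def)
qed

lemma F49_sum_le:
  assumes "simple_graph G"
  shows "F49_sum (verts G) (\<lambda>_. 1) (grel G) \<le> real (card (verts G)) ^ 6 / 3888"
proof -
  have "0 \<le> misfit_sum (verts G) (\<lambda>_. 1) (grel G)" by (rule wsum_nonneg) auto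
  then have "0 \<le> real (card (verts G)) * misfit_sum (verts G) (\<lambda>_. 1) (grel G)" by simp
  moreover have "0 \<le> wsum (verts G) (\<lambda>_. 1) 4 (imbalance4 (verts G) (grel G) (\<lambda>_. 1))"
    by (rule wsum_nonneg) (auto simp: imbalance4_def sector_variation_def split: list.split)
  ultimately show ?thesis
    using key_inequality[OF grel_sym[of G] grel_refl[of G], of "verts G" "\<lambda>_. 1"] by simp
qed

lemma copies_le:
  assumes "simple_graph G"
  shows "2 * real (card (copies G)) \<le> F49_sum (verts G) (\<lambda>_. 1) (grel G)"
    "2 * real (card (copies G)) \<ge> F49_sum (verts G) (\<lambda>_. 1) (grel G) - real (card (verts G)) ^ 5"
proof -
  have "0 \<le> folded_sum (verts G) (\<lambda>_. 1) (grel G)" by (rule wsum_nonneg) auto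
  moreover have "folded_sum (verts G) (\<lambda>_. 1) (grel G) \<le> 1 * real (card (verts G)) ^ 5"
    by (rule wsum_le_const) auto
  ultimately show "2 * real (card (copies G)) \<le> F49_sum (verts G) (\<lambda>_. 1) (grel G)"
    "2 * real (card (copies G)) \<ge> F49_sum (verts G) (\<lambda>_. 1) (grel G) - real (card (verts G)) ^ 5"
    using card_copies[OF assms] by linarith+
qed

definition differ :: "'a reln \<Rightarrow> 'a reln \<Rightarrow> 'a \<Rightarrow> 'a \<Rightarrow> real" where
  "differ R R' x y = of_bool (R x y \<noteq> R' x y)"

text \<open>Any assignment c of the vertices to parts yields a candidate for the minimum.\<close>
lemma edit_distance_le:
  assumes "simple_graph G"
  shows "real (edit_distance G B49)
    \<le> (\<Sum>u\<in>verts G. \<Sum>v\<in>verts G. differ (grel G) (\<lambda>u v. hex (c u) (c v)) u v)"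
proof -
  let ?V = "verts G" and ?H = "hexgraph (verts G) c"
  let ?X = "(edges G - edges ?H) \<union> (edges ?H - edges G)"
  let ?D = "{(u,v). u \<in> ?V \<and> v \<in> ?V \<and> grel G u v \<noteq> hex (c u) (c v)}"
  have fV: "finite ?V" using assms by (simp add: simple_graph_def)
  have "isomorphic ?H ?H"
    unfolding isomorphic_def graph_isomorphism_def by (rule exI[of _ id]) simp
  then have "edit_distance G B49 \<le> card ?X"
    unfolding edit_distance_def
    by (intro Least_le exI[of _ ?H] conjI hexgraph_simple[OF fV] hexgraph_verts bexI[OF _ hexgraph_blowup[OF fV]] refl)
  also have "card ?X \<le> card ((\<lambda>(u,v). {u,v}) ` ?D)"
  proof (rule card_mono)
    have "finite ?D" by (rule finite_subset[of _ "?V \<times> ?V"]) (auto simp: fV)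
    then show "finite ((\<lambda>(u,v). {u,v}) ` ?D)" by simp
    show "?X \<subseteq> (\<lambda>(u,v). {u,v}) ` ?D"
    proof
      fix e assume e: "e \<in> ?X"
      have "e \<in> edges G \<or> e \<in> edges ?H" using e by blast
      then obtain u v where uv: "e = {u, v}" "u \<in> ?V" "v \<in> ?V" "u \<noteq> v"
        using assms unfolding simple_graph_def hexgraph_def by auto
      have "grel G u v \<noteq> grel ?H u v" using e uv by (auto simp: grel_def)
      then have "(u, v) \<in> ?D" using uv grel_hexgraph[of u ?V v c] by auto
      then show "e \<in> (\<lambda>(u,v). {u,v}) ` ?D" using uv(1) by (auto intro!: image_eqI[of _ _ "(u,v)"])
    qed
  qed
  also have "card ((\<lambda>(u,v). {u,v}) ` ?D) \<le> card ?D"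
    by (rule card_image_le, rule finite_subset[of _ "?V \<times> ?V"]) (auto simp: fV)
  also have "real (card ?D) = (\<Sum>u\<in>?V. \<Sum>v\<in>?V. differ (grel G) (\<lambda>u v. hex (c u) (c v)) u v)"
  proof -
    have "?D = (SIGMA u:?V. {v\<in>?V. grel G u v \<noteq> hex (c u) (c v)})" by auto
    then have "card ?D = (\<Sum>u\<in>?V. card {v\<in>?V. grel G u v \<noteq> hex (c u) (c v)})" using fV by simp
    moreover have "real (card {v\<in>?V. grel G u v \<noteq> hex (c u) (c v)}) = (\<Sum>v\<in>?V. differ (grel G) (\<lambda>u v. hex (c u) (c v)) u v)" for u
    proof -
      have "(\<Sum>v\<in>?V. differ (grel G) (\<lambda>u v. hex (c u) (c v)) u v) = (\<Sum>v\<in>?V. if grel G u v \<noteq> hex (c u) (c v) then 1 else 0)"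
        by (intro sum.cong) (auto simp: differ_def)
      then show ?thesis using fV by (simp add: sum.If_cases Int_def)
    qed
    ultimately show ?thesis by simp
  qed
  finally show ?thesis by simp
qed

lemma finite_densities:
  "finite {density F49 G | G :: nat graph. simple_graph G \<and> card (verts G) = n}"
proof -
  have "{density F49 G | G :: nat graph. simple_graph G \<and> card (verts G) = n}
      \<subseteq> (\<lambda>k. real k / real (n choose 6)) ` {..2 ^ n}"
  proof clarify
    fix G :: "nat graph" assume G: "simple_graph G" "n = card (verts G)"
    have fV: "finite (verts G)" using G by (simp add: simple_graph_def)
    have "card (copies G) \<le> card (Pow (verts G))" by (rule card_mono) (auto simp: copies_def fV)
    then have "card (copies G) \<le> 2 ^ n" using fV G by (simp add: card_Pow)
    then show "density F49 G \<in> (\<lambda>k. real k / real (card (verts G) choose 6)) ` {..2 ^ card (verts G)}"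
      using G by (auto simp: density_copies)
  qed
  then show ?thesis by (rule finite_subset) simp
qed

lemma density_le_max:
  fixes H :: "nat graph"
  assumes "simple_graph H" "card (verts H) = n"
  shows "density F49 H \<le> max_density F49 n"
  unfolding max_density_def by (rule Max_ge[OF finite_densities]) (use assms in blast)

lemma max_density_attained: "\<exists>G :: nat graph. simple_graph G \<and> card (verts G) = n \<and> max_density F49 n = density F49 G"
proof -
  have "simple_graph (hexgraph {..<n} (\<lambda>_. I0))" "card (verts (hexgraph {..<n} (\<lambda>_. I0))) = n"
    by (simp_all add: hexgraph_simple hexgraph_verts)
  then have "{density F49 G | G :: nat graph. simple_graph G \<and> card (verts G) = n} \<noteq> {}" by blast
  from Max_in[OF finite_densities this] show ?thesis unfolding max_density_def by blast
qed

section \<open>Stability\<close>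

text \<open>If no pair of entries is one on which R and R' differ, the two relations agree on the tuple.\<close>
lemma pair_sum_differ_zero:
  "pair_sum (differ R R') xs < 1 \<Longrightarrow> i < j \<Longrightarrow> j < length xs \<Longrightarrow> R (xs ! i) (xs ! j) = R' (xs ! i) (xs ! j)"
proof (induction xs arbitrary: i j)
  case (Cons x xs)
  have nn: "0 \<le> lsum (differ R R' x) xs" "0 \<le> pair_sum (differ R R') xs"
    by (auto intro!: lsum_nonneg pair_sum_nonneg simp: differ_def)
  show ?case
  proof (cases i)
    case 0
    then have "differ R R' x ((x # xs) ! j) \<le> lsum (differ R R' x) xs"
      using Cons.prems by (intro lsum_member) (auto simp: differ_def nth_Cons' )
    then have "differ R R' x ((x # xs) ! j) < 1" using Cons.prems(1) nn by simp
    then show ?thesis using 0 by (simp add: differ_def split: if_splits)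
  next
    case (Suc i')
    then obtain j' where j: "j = Suc j'" using Cons.prems(2) by (cases j) auto
    have "pair_sum (differ R R') xs < 1" using Cons.prems(1) nn by simp
    then show ?thesis using Cons.IH[of i' j'] Cons.prems Suc j by simp
  qed
qed simp

lemma is_F49_diff:
  assumes "symp R" "symp R'" "length xs = 6"
  shows "\<bar>of_bool (is_F49 R xs) - of_bool (is_F49 R' xs)\<bar> \<le> pair_sum (differ R R') xs"
proof (cases "pair_sum (differ R R') xs < 1")
  case True
  obtain a b c d e f where xs: "xs = [a,b,c,d,e,f]" using assms(3) by (auto simp: length_numeral_conv)
  note l = pair_sum_differ_zero[OF True]
  have "R a b = R' a b" "R b c = R' b c" "R a c = R' a c" "R a d = R' a d" "R b d = R' b d" "R c d = R' c d"
    "R a e = R' a e" "R b e = R' b e" "R c e = R' c e" "R d e = R' d e"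
    "R a f = R' a f" "R b f = R' b f" "R c f = R' c f" "R d f = R' d f" "R e f = R' e f"
    using l[of 0 1] l[of 1 2] l[of 0 2] l[of 0 3] l[of 1 3] l[of 2 3] l[of 0 4] l[of 1 4] l[of 2 4] l[of 3 4]
      l[of 0 5] l[of 1 5] l[of 2 5] l[of 3 5] l[of 4 5] by (simp_all add: xs)
  then have "is_F49 R xs = is_F49 R' xs" by (simp add: xs is_F49_def p3_def completes_F49_def class_of_def)
  then show ?thesis by (auto intro!: pair_sum_nonneg simp: differ_def)
next
  case False
  then show ?thesis by (auto simp: of_bool_def)
qed

lemma repeat_last_diff:
  assumes "symp R" "symp R'" "reflp R" "reflp R'" "length ys = 5"
  shows "\<bar>of_bool (is_F49 R (repeat_last ys)) - of_bool (is_F49 R' (repeat_last ys))\<bar> \<le> pair_sum (differ R R') ys"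
proof (cases "pair_sum (differ R R') ys < 1")
  case True
  obtain a b c d e where ys: "ys = [a,b,c,d,e]" using assms(5) by (auto simp: length_numeral_conv)
  note l = pair_sum_differ_zero[OF True]
  have "R a b = R' a b" "R b c = R' b c" "R a c = R' a c" "R a d = R' a d" "R b d = R' b d" "R c d = R' c d"
    "R a e = R' a e" "R b e = R' b e" "R c e = R' c e" "R d e = R' d e" "R e e = R' e e"
    using l[of 0 1] l[of 1 2] l[of 0 2] l[of 0 3] l[of 1 3] l[of 2 3] l[of 0 4] l[of 1 4] l[of 2 4] l[of 3 4]
      assms(3,4) by (simp_all add: ys reflpD)
  then have "is_F49 R (repeat_last ys) = is_F49 R' (repeat_last ys)" by (simp add: ys repeat_last_def is_F49_def p3_def completes_F49_def class_of_def)
  then show ?thesis by (auto intro!: pair_sum_nonneg simp: differ_def)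
next
  case False
  then show ?thesis by (auto simp: of_bool_def)
qed

definition P3_count :: "'a set \<Rightarrow> 'a reln \<Rightarrow> real" where
  "P3_count V R = wsum V (\<lambda>_. 1) 3 (\<lambda>us. of_bool (case us of [a,b,c] \<Rightarrow> p3 R a b c | _ \<Rightarrow> False))"

definition misfit_count :: "'a set \<Rightarrow> 'a reln \<Rightarrow> 'a \<Rightarrow> 'a \<Rightarrow> 'a \<Rightarrow> real" where
  "misfit_count V R a b c = (\<Sum>e\<in>V. \<Sum>f\<in>V. of_bool (misfit (class_of R a b c e) (class_of R a b c f) (R e f)))"

text \<open>
  Vertices whose class is not a corner of the hexagon are put into part 0. All their pairs are misfits, so any
  choice would do.
\<close>
definition part_of :: "'a reln \<Rightarrow> 'a \<Rightarrow> 'a \<Rightarrow> 'a \<Rightarrow> 'a \<Rightarrow> six" where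
  "part_of R a b c v = (case class_of R a b c v of None \<Rightarrow> I0 | Some i \<Rightarrow> i)"

lemma differ_le_misfit_count:
  "(\<Sum>u\<in>V. \<Sum>v\<in>V. differ R (\<lambda>u v. hex (part_of R a b c u) (part_of R a b c v)) u v) \<le> misfit_count V R a b c"
  unfolding misfit_count_def
proof (intro sum_mono)
  fix u v
  show "differ R (\<lambda>u v. hex (part_of R a b c u) (part_of R a b c v)) u v
      \<le> of_bool (misfit (class_of R a b c u) (class_of R a b c v) (R u v))"
    by (auto simp: differ_def part_of_def misfit_def split: option.splits)
qed

lemma F49_sum_le_P3_count:
  "F49_sum V (\<lambda>_. 1) R \<le> P3_count V R * real (card V) ^ 3"
proof -
  have "wsum V (\<lambda>_. 1) (3 + 3) (\<lambda>xs. of_bool (is_F49 R xs))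
      = wsum V (\<lambda>_. 1) 3 (\<lambda>us. wsum V (\<lambda>_. 1) 3 (\<lambda>xs. of_bool (is_F49 R (us @ xs))))" by (rule wsum_append)
  also have "\<dots> \<le> wsum V (\<lambda>_. 1) 3 (\<lambda>us. real (card V) ^ 3 * of_bool (case us of [a,b,c] \<Rightarrow> p3 R a b c | _ \<Rightarrow> False))"
  proof (rule wsum_mono)
    fix us assume "set us \<subseteq> V" "length us = 3"
    then obtain a b c where us: "us = [a,b,c]" by (auto simp: length_numeral_conv)
    have "wsum V (\<lambda>_. 1) 3 (\<lambda>xs. of_bool (is_F49 R (us @ xs))) \<le> of_bool (p3 R a b c) * real (card V) ^ 3"
      by (rule wsum_le_const) (auto simp: us is_F49_def split: list.splits)
    then show "wsum V (\<lambda>_. 1) 3 (\<lambda>xs. of_bool (is_F49 R (us @ xs)))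
        \<le> real (card V) ^ 3 * of_bool (case us of [a,b,c] \<Rightarrow> p3 R a b c | _ \<Rightarrow> False)" by (simp add: us mult.commute)
  qed simp
  finally show ?thesis by (simp add: P3_count_def wsum_cmult mult.commute)
qed

lemma misfit5_ge:
  assumes "\<And>a b c. a \<in> V \<Longrightarrow> b \<in> V \<Longrightarrow> c \<in> V \<Longrightarrow> p3 R a b c \<Longrightarrow> m \<le> misfit_count V R a b c"
  shows "P3_count V R * m \<le> misfit_sum V (\<lambda>_. 1) R"
proof -
  have "P3_count V R * m = wsum V (\<lambda>_. 1) 3 (\<lambda>us. m * of_bool (case us of [a,b,c] \<Rightarrow> p3 R a b c | _ \<Rightarrow> False))"
    by (simp add: P3_count_def wsum_cmult mult.commute)
  also have "\<dots> \<le> wsum V (\<lambda>_. 1) 3 (\<lambda>us. wsum V (\<lambda>_. 1) 2 (\<lambda>ys. of_bool (misfit5 R (us @ ys))))"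
  proof (rule wsum_mono)
    fix us assume "set us \<subseteq> V" "length us = 3"
    then obtain a b c where us: "us = [a,b,c]" and V: "a \<in> V" "b \<in> V" "c \<in> V" by (auto simp: length_numeral_conv)
    have "wsum V (\<lambda>_. 1) 2 (\<lambda>ys. of_bool (misfit5 R (us @ ys))) = of_bool (p3 R a b c) * misfit_count V R a b c"
      by (simp add: wsum2 us misfit5_def misfit_count_def)
    then show "m * of_bool (case us of [a,b,c] \<Rightarrow> p3 R a b c | _ \<Rightarrow> False)
        \<le> wsum V (\<lambda>_. 1) 2 (\<lambda>ys. of_bool (misfit5 R (us @ ys)))"
      using assms[OF V] by (simp add: us)
  qed simp
  also have "\<dots> = wsum V (\<lambda>_. 1) (3 + 2) (\<lambda>xs. of_bool (misfit5 R xs))" by (rule wsum_append[symmetric])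
  finally show ?thesis by simp
qed

lemma power6_perturb: "0 \<le> \<theta> \<Longrightarrow> \<theta> \<le> 1 / 100 \<Longrightarrow> (1 + \<theta>) ^ 6 - 1 \<le> 7 * (\<theta>::real)"
proof -
  assume t: "0 \<le> \<theta>" "\<theta> \<le> 1 / 100"
  have e: "(1 + \<theta>) ^ 6 - 1 = \<theta> * (6 + \<theta> * (15 + \<theta> * (20 + \<theta> * (15 + \<theta> * (6 + \<theta>)))))"
    by (simp add: eval_nat_numeral algebra_simps)
  have "\<theta> * (6 + \<theta>) \<le> 1/100 * (6 + 1/100)" using t by (intro mult_mono) auto
  then have "\<theta> * (15 + \<theta> * (6 + \<theta>)) \<le> 1/100 * 16" using t by (intro mult_mono) auto
  then have "\<theta> * (20 + \<theta> * (15 + \<theta> * (6 + \<theta>))) \<le> 1/100 * 21" using t by (intro mult_mono) auto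
  then have "\<theta> * (15 + \<theta> * (20 + \<theta> * (15 + \<theta> * (6 + \<theta>)))) \<le> 1/100 * 16" using t by (intro mult_mono) auto
  then have "\<theta> * (6 + \<theta> * (15 + \<theta> * (20 + \<theta> * (15 + \<theta> * (6 + \<theta>))))) \<le> \<theta> * 7" using t by (intro mult_left_mono) auto
  then show ?thesis by (simp add: e)
qed

lemma power5_perturb: "0 \<le> \<theta> \<Longrightarrow> \<theta> \<le> 1 / 100 \<Longrightarrow> (1 + \<theta>) ^ 5 - 1 \<le> 1 / (2::real)"
proof -
  assume t: "0 \<le> \<theta>" "\<theta> \<le> 1 / 100"
  have "(1 + \<theta>) ^ 5 \<le> (1 + \<theta>) ^ 6" using t by (intro power_increasing) auto
  then show ?thesis using power6_perturb[OF t] t by linarith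
qed

text \<open>
  The constants are determined from the end of the proof of stability backwards. In suitable weights the gain
  is \<open>2 * gain_rate * n^4 * D\<close>: there are at least \<open>n^3 / 7776\<close> induced paths with D
  misfits each, and the weights lose at most half of them. Weights within \<open>weight_tol\<close> of 1
  change at most \<open>7 * weight_tol * 15 * n^4 * D\<close>, half of the gain. They exist if the parts have
  relative error \<open>30 * part_tol\<close>, which hexpoly_near_max grants if the F49 sum has relative
  deficit at most \<open>deficit_tol\<close>. The factor in \<open>cutoff\<close> accounts for the passage from
  the given graph to the blowup, whose F49 sums differ by at most \<open>15 * n^4 * D\<close>, where D is at
  most \<open>15 * 7776 * cutoff * n^2\<close>.
\<close>
definition gain_rate :: real where "gain_rate = 1 / (2 * 116640 * 7776)"

definition weight_tol :: real where "weight_tol = gain_rate / 105"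

definition part_tol :: real where "part_tol = weight_tol / 60"

definition deficit_tol :: real where "deficit_tol = part_tol\<^sup>2 / 233280"

definition cutoff :: real where "cutoff = deficit_tol / (1 + 3888 * 225 * 7776)"

lemma constant_facts: "0 < gain_rate" "0 < weight_tol" "weight_tol \<le> 1 / 100" "0 < part_tol" "part_tol \<le> 1" "30 * part_tol = weight_tol / 2" "0 < deficit_tol" "0 < cutoff" "cutoff \<le> 1 / 2"
  by (simp_all add: gain_rate_def weight_tol_def part_tol_def deficit_tol_def cutoff_def power2_eq_square)

text \<open>
  The gain in copies is compared with the blowup of the hexagon that the best induced path suggests, not with
  an optimal graph. The reweighting makes this blowup optimal, so that its surplus over G is visible in the
  key inequality for G, although both F49 sums may be far below \<open>n^6 / 3888\<close> compared with
  \<open>n^4 * D\<close>.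
\<close>
lemma stability:
  fixes G :: "'a graph"
  assumes sG: "simple_graph G" and n: "n = card (verts G)" "0 < n" "20 / gain_rate \<le> real n"
    and big: "(1 - cutoff) * real n ^ 6 / 3888 \<le> F49_sum (verts G) (\<lambda>_. 1) (grel G)"
  shows "\<exists>c. gain_rate / 4 * real n ^ 4 * real (edit_distance G B49)
      \<le> real (card (copies (hexgraph (verts G) c))) - real (card (copies G))"
proof -
  let ?V = "verts G" and ?R = "grel G" and ?n = "real n" and ?one = "\<lambda>_::'a. 1::real"
  have fV: "finite ?V" using sG by (simp add: simple_graph_def)
  have npos: "0 < ?n" using n by simp
  define P where "P = F49_sum ?V ?one ?R"
  have Pbig: "(1 - cutoff) * ?n ^ 6 / 3888 \<le> P" using big by (simp add: P_def)
  have Phalf: "?n ^ 6 / 7776 \<le> P"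
  proof -
    have "1 / 2 * ?n ^ 6 \<le> (1 - cutoff) * ?n ^ 6" using constant_facts(9) npos by (intro mult_right_mono) auto
    then show ?thesis using Pbig by simp
  qed
  \<comment> \<open>An F49 tuple starts with an induced path and has only \<open>n^3\<close> continuations, so these paths abound.\<close>
  have T: "?n ^ 3 / 7776 \<le> P3_count ?V ?R"
  proof -
    have "?n ^ 3 / 7776 * ?n ^ 3 \<le> P3_count ?V ?R * ?n ^ 3"
      using Phalf F49_sum_le_P3_count[of ?V ?R] n(1) by (simp add: P_def power_add[symmetric])
    then show ?thesis by (rule mult_right_le_imp_le) (use npos in simp)
  qed
  define A where "A = {(a,b,c). a \<in> ?V \<and> b \<in> ?V \<and> c \<in> ?V \<and> p3 ?R a b c}"
  have finA: "finite A" by (rule finite_subset[of _ "?V \<times> ?V \<times> ?V"]) (auto simp: A_def fV)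
  have "A \<noteq> {}"
  proof
    assume "A = {}"
    then have "P3_count ?V ?R = wsum ?V ?one 3 (\<lambda>us. 0)"
      unfolding P3_count_def by (intro wsum_cong) (auto simp: A_def split: list.splits)
    then have "P3_count ?V ?R = 0" by (simp add: wsum_const)
    moreover have "0 < ?n ^ 3 / 7776" using npos by simp
    ultimately show False using T by linarith
  qed
  then have "Min ((\<lambda>(a,b,c). misfit_count ?V ?R a b c) ` A) \<in> (\<lambda>(a,b,c). misfit_count ?V ?R a b c) ` A"
    using finA by (intro Min_in) auto
  then obtain a b c where abc: "(a,b,c) \<in> A" "misfit_count ?V ?R a b c = Min ((\<lambda>(a,b,c). misfit_count ?V ?R a b c) ` A)"
    by auto
  have least: "misfit_count ?V ?R a b c \<le> misfit_count ?V ?R a' b' c'" if "a' \<in> ?V" "b' \<in> ?V" "c' \<in> ?V" "p3 ?R a' b' c'" for a' b' c'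
  proof -
    have "(a',b',c') \<in> A" using that by (simp add: A_def)
    then have "misfit_count ?V ?R a' b' c' \<in> (\<lambda>(a,b,c). misfit_count ?V ?R a b c) ` A" by force
    then show ?thesis unfolding abc(2) using finA by (intro Min_le) auto
  qed
  \<comment> \<open>The partition comes from a path with the fewest misfits, so every induced path has at least D of them.\<close>
  define p where "p = part_of ?R a b c"
  define H where "H = hexgraph ?V p"
  define R' where "R' = (\<lambda>u v. hex (p u) (p v))"
  define D where "D = (\<Sum>u\<in>?V. \<Sum>v\<in>?V. differ ?R R' u v)"
  have R': "symp R'" "reflp R'"
    using hex_sym hex_refl by (auto simp: R'_def symp_def reflp_def)
  have D0: "0 \<le> D" by (simp add: D_def sum_nonneg differ_def)
  have Dw: "D \<le> misfit_count ?V ?R a b c" unfolding D_def R'_def p_def by (rule differ_le_misfit_count)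
  define B where "B w = misfit_sum ?V w ?R" for w
  have B1: "P3_count ?V ?R * D \<le> B ?one"
    unfolding B_def by (rule misfit5_ge) (use Dw least order_trans in blast)
  have B2: "?n ^ 3 / 7776 * D \<le> B ?one"
    using mult_right_mono[OF T D0] B1 by linarith
  have imb: "0 \<le> wsum ?V w 4 (imbalance4 ?V ?R w)" if "\<And>x. x \<in> ?V \<Longrightarrow> 0 \<le> w x" for w
    by (rule wsum_nonneg[OF that]) (auto simp: imbalance4_def sector_variation_def split: list.split)
  have key: "116640 * F49_sum ?V w ?R + 2 * sum w ?V * B w \<le> 30 * sum w ?V ^ 6"
    if w: "\<And>x. x \<in> ?V \<Longrightarrow> 0 \<le> w x" for w
    using key_inequality[OF grel_sym[of G] grel_refl[of G], of ?V w, OF w] imb[of w, OF w] unfolding B_def by simp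
  \<comment> \<open>Near the optimum, the key inequality with all weights 1 leaves little room for misfits.\<close>
  have Dsmall: "D \<le> 15 * 7776 * cutoff * ?n\<^sup>2"
  proof -
    have "116640 * P + 2 * ?n * B ?one \<le> 30 * ?n ^ 6" using key[of ?one] n(1) by (simp add: P_def)
    then have "2 * ?n * B ?one \<le> 30 * cutoff * ?n ^ 6" using Pbig by (simp add: algebra_simps)
    moreover have "2 * ?n * (?n ^ 3 / 7776 * D) \<le> 2 * ?n * B ?one" using B2 npos by (intro mult_left_mono) auto
    ultimately have "2 * ?n * (?n ^ 3 / 7776 * D) \<le> 30 * cutoff * ?n ^ 6" by linarith
    then have "?n ^ 4 * D \<le> ?n ^ 4 * (15 * 7776 * cutoff * ?n\<^sup>2)"
      by (simp add: eval_nat_numeral algebra_simps)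
    then show ?thesis using npos by (simp add: mult_le_cancel_left)
  qed
  \<comment> \<open>The gain in F49 tuples from G to H, which only tuples containing one of the D pairs contribute to.\<close>
  define f where "f xs = (of_bool (is_F49 R' xs) - of_bool (is_F49 ?R xs) :: real)" for xs
  have fH: "F49_sum ?V w (grel H) = F49_sum ?V w R'" for w
  proof (rule wsum_cong)
    fix xs assume "set xs \<subseteq> ?V" "length xs = 6"
    then have "is_F49 (grel H) xs = is_F49 R' xs"
      unfolding H_def R'_def by (intro is_F49_cong) (auto intro!: grel_hexgraph)
    then show "(of_bool (is_F49 (grel H) xs) :: real) = of_bool (is_F49 R' xs)" by simp
  qed
  have fdiff: "wsum ?V w 6 f = F49_sum ?V w (grel H) - F49_sum ?V w ?R" for w
    unfolding fH f_def by (rule wsum_diff)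
  have fabs: "wsum ?V ?one 6 (\<lambda>xs. \<bar>f xs\<bar>) \<le> 15 * ?n ^ 4 * D"
  proof -
    have "wsum ?V ?one 6 (\<lambda>xs. \<bar>f xs\<bar>) \<le> wsum ?V ?one 6 (pair_sum (differ ?R R'))"
    proof (rule wsum_mono)
      fix xs :: "'a list" assume "length xs = 6"
      from is_F49_diff[OF grel_sym R'(1) this, of G] show "\<bar>f xs\<bar> \<le> pair_sum (differ ?R R') xs"
        by (simp add: f_def abs_minus_commute)
    qed simp
    then show ?thesis using n(1) by (simp add: wsum_pair_sum D_def choose_two)
  qed
  have PH: "F49_sum ?V ?one (grel H) = hexpoly (part_size ?V p)"
    unfolding H_def wsum_hexgraph[OF fV] by (simp add: part_size_def[abs_def])
  define x where "x i = part_size ?V p i / ?n" for i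
  have x0: "0 \<le> x i" for i by (simp add: x_def part_size_def)
  have x1: "sum x UNIV = 1" using sum_part_size[OF fV, of p] npos n(1) by (simp add: x_def sum_divide_distrib[symmetric])
  have hx: "hexpoly (part_size ?V p) = ?n ^ 6 * hexpoly x"
    using hexpoly_scale[of ?n x] npos by (simp add: x_def)
  \<comment> \<open>H has nearly as many tuples as G, so its parts are nearly equal.\<close>
  have near: "\<bar>6 * x i - 1\<bar> \<le> weight_tol / 2" for i
  proof -
    have "P - 15 * ?n ^ 4 * D \<le> hexpoly (part_size ?V p)"
      using wsum_abs_le[of ?V ?one 6 f] fabs fdiff[of ?one] unfolding P_def PH by linarith
    moreover have "15 * ?n ^ 4 * D \<le> 15 * ?n ^ 4 * (15 * 7776 * cutoff * ?n\<^sup>2)"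
      using Dsmall by (intro mult_left_mono) auto
    ultimately have "(1 - cutoff) * ?n ^ 6 / 3888 - 15 * ?n ^ 4 * (15 * 7776 * cutoff * ?n\<^sup>2) \<le> ?n ^ 6 * hexpoly x"
      using Pbig unfolding hx by linarith
    then have "?n ^ 6 * ((1 - cutoff) / 3888 - 225 * 7776 * cutoff) \<le> ?n ^ 6 * hexpoly x"
      by (simp add: eval_nat_numeral algebra_simps)
    then have "(1 - cutoff) / 3888 - 225 * 7776 * cutoff \<le> hexpoly x" using npos by (simp add: mult_le_cancel_left)
    moreover have "(1 - cutoff) / 3888 - 225 * 7776 * cutoff = (1 - part_tol\<^sup>2 / 233280) / 3888"
      by (simp add: cutoff_def deficit_tol_def field_simps)
    ultimately have "(1 - part_tol\<^sup>2 / 233280) / 3888 \<le> hexpoly x" by argo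
    then have "\<bar>6 * x i - 1\<bar> \<le> 30 * part_tol"
      by (intro hexpoly_near_max[OF x0 x1] less_imp_le[OF constant_facts(4)] constant_facts(5))
    then show ?thesis using constant_facts(6) by simp
  qed
  have xpos: "1 / 2 \<le> 6 * x i" for i using near[of i] constant_facts(3) by linarith
  \<comment> \<open>The reweighting: each part of H receives weight exactly n/6, so that H attains the maximum.\<close>
  define w where "w v = 1 / (6 * x (p v))" for v
  have w0: "0 \<le> w v" for v using xpos[of "p v"] by (simp add: w_def)
  have w1: "\<bar>w v - 1\<bar> \<le> weight_tol" for v
  proof -
    have y: "0 < 6 * x (p v)" using xpos[of "p v"] by linarith
    then have "w v - 1 = (1 - 6 * x (p v)) / (6 * x (p v))" by (simp add: w_def field_simps)
    then have "\<bar>w v - 1\<bar> = \<bar>6 * x (p v) - 1\<bar> / (6 * x (p v))" using y by (simp add: abs_divide abs_minus_commute)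
    also have "\<dots> \<le> (weight_tol / 2) / (1 / 2)" using near xpos constant_facts(2) by (intro frac_le) auto
    finally show ?thesis by simp
  qed
  have wpart: "(\<Sum>v\<in>{v\<in>?V. p v = i}. w v) = ?n / 6" for i
  proof -
    have "(\<Sum>v\<in>{v\<in>?V. p v = i}. w v) = part_size ?V p i * (1 / (6 * x i))" by (simp add: w_def part_size_def)
    also have "\<dots> = ?n / 6" using xpos[of i] npos by (simp add: x_def field_simps)
    finally show ?thesis .
  qed
  have wsumV: "sum w ?V = ?n"
  proof -
    have "sum w ?V = (\<Sum>i\<in>UNIV. \<Sum>v\<in>{v\<in>?V. p v = i}. w v)"
      by (rule sum.group[symmetric]) (auto simp: fV finite_six)
    then show ?thesis by (simp add: wpart card_six)
  qed
  have PHw: "F49_sum ?V w (grel H) = ?n ^ 6 / 3888"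
    unfolding H_def wsum_hexgraph[OF fV] wpart hexpoly_const by (simp add: power_divide)
  have Bw: "B ?one / 2 \<le> B w"
  proof -
    have "\<bar>B w - B ?one\<bar> \<le> ((1 + weight_tol) ^ 5 - 1) * wsum ?V ?one 5 (\<lambda>xs. \<bar>of_bool (misfit5 ?R xs)\<bar>)"
      unfolding B_def by (rule wsum_perturb) (use w1 constant_facts(2) in auto)
    also have "\<dots> \<le> 1 / 2 * B ?one"
    proof -
      have "0 \<le> B ?one" unfolding B_def by (rule wsum_nonneg) auto
      then have "((1 + weight_tol) ^ 5 - 1) * B ?one \<le> 1 / 2 * B ?one"
        by (intro mult_right_mono power5_perturb less_imp_le[OF constant_facts(2)] constant_facts(3))
      then show ?thesis unfolding B_def by simp
    qed
    finally show ?thesis by linarith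
  qed
  \<comment> \<open>The misfits of G are now a lower bound for the distance of its F49 sum from that of H.\<close>
  have gain_w: "2 * gain_rate * ?n ^ 4 * D \<le> wsum ?V w 6 f"
  proof -
    have "116640 * F49_sum ?V w ?R + 2 * ?n * B w \<le> 30 * ?n ^ 6"
      using key[of w] w0 unfolding wsumV by simp
    then have "2 * ?n * B w \<le> 116640 * wsum ?V w 6 f" unfolding fdiff PHw by simp
    moreover have "2 * ?n * ((?n ^ 3 / 7776 * D) / 2) \<le> 2 * ?n * B w"
      using Bw B2 npos by (intro mult_left_mono) auto
    ultimately have "2 * ?n * ((?n ^ 3 / 7776 * D) / 2) \<le> 116640 * wsum ?V w 6 f" by linarith
    then show ?thesis by (simp add: gain_rate_def eval_nat_numeral algebra_simps)
  qed
  \<comment> \<open>Back to weights 1, at the expense of half of the gain.\<close>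
  have gain: "gain_rate * ?n ^ 4 * D \<le> wsum ?V ?one 6 f"
  proof -
    have "\<bar>wsum ?V w 6 f - wsum ?V ?one 6 f\<bar> \<le> ((1 + weight_tol) ^ 6 - 1) * wsum ?V ?one 6 (\<lambda>xs. \<bar>f xs\<bar>)"
      by (rule wsum_perturb) (use w1 constant_facts(2) in auto)
    also have "\<dots> \<le> (7 * weight_tol) * (15 * ?n ^ 4 * D)"
    proof (rule mult_mono[OF power6_perturb fabs])
      show "0 \<le> wsum ?V ?one 6 (\<lambda>xs. \<bar>f xs\<bar>)" by (rule wsum_nonneg) auto
    qed (use constant_facts(2,3) in auto)
    also have "\<dots> = gain_rate * ?n ^ 4 * D" by (simp add: weight_tol_def)
    finally show ?thesis using gain_w by linarith
  qed
  \<comment> \<open>The tuples that are no copies change by an order of magnitude less.\<close>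
  have loss: "folded_sum ?V ?one (grel H) - folded_sum ?V ?one ?R
     \<le> 10 * ?n ^ 3 * D"
  proof -
    have "folded_sum ?V ?one (grel H) = folded_sum ?V ?one R'"
    proof (rule wsum_cong)
      fix ys assume ys: "set ys \<subseteq> ?V" "length ys = 5"
      then have "ys \<noteq> []" by auto
      then have "set (repeat_last ys) \<subseteq> ?V" using ys last_in_set[of ys] by (auto simp: repeat_last_def)
      then have "is_F49 (grel H) (repeat_last ys) = is_F49 R' (repeat_last ys)"
        using ys unfolding H_def R'_def by (intro is_F49_cong) (auto simp: repeat_last_def intro!: grel_hexgraph)
      then show "(of_bool (is_F49 (grel H) (repeat_last ys)) :: real) = of_bool (is_F49 R' (repeat_last ys))" by simp
    qed
    then have "folded_sum ?V ?one (grel H) - folded_sum ?V ?one ?R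
        = wsum ?V ?one 5 (\<lambda>ys. of_bool (is_F49 R' (repeat_last ys)) - of_bool (is_F49 ?R (repeat_last ys)))"
      by (simp add: wsum_diff)
    also have "\<dots> \<le> wsum ?V ?one 5 (pair_sum (differ ?R R'))"
    proof (rule wsum_mono)
      fix ys :: "'a list" assume "length ys = 5"
      from repeat_last_diff[OF grel_sym R'(1) grel_refl R'(2) this, of G]
      show "of_bool (is_F49 R' (repeat_last ys)) - of_bool (is_F49 ?R (repeat_last ys)) \<le> pair_sum (differ ?R R') ys" by linarith
    qed simp
    also have "\<dots> = 10 * ?n ^ 3 * D" using n(1) by (simp add: wsum_pair_sum D_def choose_two)
    finally show ?thesis .
  qed
  have "simple_graph H" unfolding H_def by (rule hexgraph_simple[OF fV])
  then have "real (card (copies H)) * 2 - real (card (copies G)) * 2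
     = wsum ?V ?one 6 f - (folded_sum ?V ?one (grel H) - folded_sum ?V ?one ?R)"
    using card_copies[of H] card_copies[OF sG] unfolding fdiff by (simp add: H_def hexgraph_verts)
  also have "\<dots> \<ge> gain_rate * ?n ^ 4 * D - 10 * ?n ^ 3 * D" using gain loss by linarith
  also have "gain_rate * ?n ^ 4 * D - 10 * ?n ^ 3 * D \<ge> gain_rate / 2 * ?n ^ 4 * D"
  proof -
    have "20 \<le> gain_rate * ?n" using n(3) constant_facts(1) by (simp add: divide_le_eq mult.commute)
    then have "20 * (?n ^ 3 * D) \<le> gain_rate * ?n * (?n ^ 3 * D)" using D0 by (intro mult_right_mono) auto
    then show ?thesis by (simp add: eval_nat_numeral algebra_simps)
  qed
  finally have "gain_rate / 4 * ?n ^ 4 * D \<le> real (card (copies H)) - real (card (copies G))" by simp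
  moreover have "real (edit_distance G B49) \<le> D"
    using edit_distance_le[OF sG, of p] by (simp add: D_def R'_def)
  then have "gain_rate / 4 * ?n ^ 4 * real (edit_distance G B49) \<le> gain_rate / 4 * ?n ^ 4 * D"
    using constant_facts(1) by (intro mult_left_mono) auto
  ultimately show ?thesis unfolding H_def by (intro exI[of _ p]) linarith
qed

section \<open>Limits and the main result\<close>

lemma choose6: "6 \<le> n \<Longrightarrow> real (n choose 6) * 720
   = real n * (real n - 1) * (real n - 2) * (real n - 3) * (real n - 4) * (real n - 5)"
proof -
  have "real (n choose 6) = real n gchoose 6" by (rule binomial_gbinomial)
  also have "\<dots> = (\<Prod>i = 0..<6. real n - real i) / fact 6" by (rule gbinomial_prod_rev)
  finally show ?thesis by (simp add: eval_nat_numeral fact_numeral)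
qed

lemma choose6_limit: "(\<lambda>n. real n ^ 6 / real (n choose 6)) \<longlonglongrightarrow> 720"
proof -
  have "(\<lambda>n. 720 * real n ^ 6 / (real n * (real n - 1) * (real n - 2) * (real n - 3) * (real n - 4) * (real n - 5))) \<longlonglongrightarrow> 720"
    by real_asymp
  moreover have "eventually (\<lambda>n. 720 * real n ^ 6 / (real n * (real n - 1) * (real n - 2) * (real n - 3) * (real n - 4) * (real n - 5))
     = real n ^ 6 / real (n choose 6)) sequentially"
  proof (rule eventually_sequentiallyI)
    fix n :: nat assume "6 \<le> n"
    from choose6[OF this] show "720 * real n ^ 6 / (real n * (real n - 1) * (real n - 2) * (real n - 3) * (real n - 4) * (real n - 5))
     = real n ^ 6 / real (n choose 6)" unfolding choose6[OF \<open>6 \<le> n\<close>, symmetric] by simp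
  qed
  ultimately show ?thesis by (simp add: tendsto_cong)
qed

lemma choose6_le: "real (n choose 6) \<le> real n ^ 6 / 720"
proof -
  have "real ((n choose 6) * fact 6) \<le> real (n ^ 6)" unfolding of_nat_le_iff by (rule binomial_fact_pow)
  then show ?thesis by (simp add: fact_numeral eval_nat_numeral)
qed

lemma hexpoly_tendsto:
  assumes "\<And>i. (\<lambda>n. y n i) \<longlonglongrightarrow> x i"
  shows "(\<lambda>n. hexpoly (y n)) \<longlonglongrightarrow> hexpoly x"
  unfolding hexpoly_eq path4_def by (intro tendsto_intros assms)

lemma hexgraph_density_limit:
  fixes V :: "nat \<Rightarrow> 'a set"
  assumes fin: "\<And>n. finite (V n)" and lim: "\<And>i. (\<lambda>n. part_size (V n) (c n) i / real n) \<longlonglongrightarrow> x i"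
    and x1: "sum x UNIV = 1"
  shows "(\<lambda>n. density F49 (hexgraph (V n) (c n))) \<longlonglongrightarrow> 360 * hexpoly x"
proof -
  define N where "N n = card (V n)" for n
  \<comment> \<open>The F49 tuples of the n-th blowup that are not tuples of copies; there are only \<open>O(n^5)\<close>.\<close>
  define e where "e n = hexpoly (part_size (V n) (c n)) - 2 * real (card (copies (hexgraph (V n) (c n))))" for n
  have e: "0 \<le> e n" "e n \<le> real (N n) ^ 5" for n
    using copies_le[OF hexgraph_simple[OF fin[of n]], of "c n"] wsum_hexgraph[OF fin[of n], of "\<lambda>_. 1" "c n"]
    by (simp_all add: e_def hexgraph_verts N_def part_size_def[abs_def])
  have Nn: "(\<lambda>n. real (N n) / real n) \<longlonglongrightarrow> 1"
  proof -
    have "(\<lambda>n. \<Sum>i\<in>UNIV. part_size (V n) (c n) i / real n) \<longlonglongrightarrow> sum x UNIV" by (intro tendsto_sum lim)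
    then show ?thesis by (simp add: sum_divide_distrib[symmetric] sum_part_size[OF fin] N_def x1)
  qed
  have "filterlim (\<lambda>n. real (N n) / real n * real n) at_top sequentially"
    by (rule filterlim_tendsto_pos_mult_at_top[OF Nn]) (auto intro: filterlim_real_sequentially)
  moreover have "eventually (\<lambda>n. real (N n) / real n * real n = real (N n)) sequentially"
    by (rule eventually_sequentiallyI[of 1]) simp
  ultimately have "filterlim (\<lambda>n. real (N n)) at_top sequentially"
    by (rule filterlim_cong[OF refl refl, THEN iffD1, rotated])
  then have Ninf: "filterlim N at_top sequentially" by (simp add: filterlim_sequentially_iff_filterlim_real)
  have A: "(\<lambda>n. hexpoly (\<lambda>i. part_size (V n) (c n) i / real n)) \<longlonglongrightarrow> hexpoly x"
    by (rule hexpoly_tendsto) (rule lim)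
  have B: "(\<lambda>n. e n / real n ^ 6) \<longlonglongrightarrow> 0"
  proof (rule tendsto_sandwich[of "\<lambda>_. 0"])
    have "(\<lambda>n. (real (N n) / real n) ^ 5 * (1 / real n)) \<longlonglongrightarrow> 1 ^ 5 * 0"
      by (intro tendsto_mult tendsto_power Nn lim_1_over_n)
    then show "(\<lambda>n. (real (N n) / real n) ^ 5 * (1 / real n)) \<longlonglongrightarrow> 0" by simp
    show "eventually (\<lambda>n. e n / real n ^ 6 \<le> (real (N n) / real n) ^ 5 * (1 / real n)) sequentially"
    proof (rule eventually_sequentiallyI)
      fix n :: nat
      have "e n / real n ^ 6 \<le> real (N n) ^ 5 / real n ^ 6" using e[of n] by (intro divide_right_mono) auto
      then show "e n / real n ^ 6 \<le> (real (N n) / real n) ^ 5 * (1 / real n)"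
        by (simp add: power_divide eval_nat_numeral)
    qed
  qed (use e in \<open>auto intro!: always_eventually\<close>)
  have C: "(\<lambda>n. real (N n) ^ 6 / real (N n choose 6)) \<longlonglongrightarrow> 720"
    using filterlim_compose[OF choose6_limit Ninf] .
  have D: "(\<lambda>n. 1 / (real (N n) / real n) ^ 6) \<longlonglongrightarrow> 1 / 1 ^ 6"
    by (intro tendsto_divide tendsto_const tendsto_power Nn) simp
  have "(\<lambda>n. (hexpoly (\<lambda>i. part_size (V n) (c n) i / real n) - e n / real n ^ 6) / 2
       * (1 / (real (N n) / real n) ^ 6) * (real (N n) ^ 6 / real (N n choose 6)))
     \<longlonglongrightarrow> (hexpoly x - 0) / 2 * (1 / 1 ^ 6) * 720"
    by (intro tendsto_mult tendsto_divide tendsto_diff A B C D tendsto_const) simp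
  moreover have "eventually (\<lambda>n. (hexpoly (\<lambda>i. part_size (V n) (c n) i / real n) - e n / real n ^ 6) / 2
       * (1 / (real (N n) / real n) ^ 6) * (real (N n) ^ 6 / real (N n choose 6))
     = density F49 (hexgraph (V n) (c n))) sequentially"
  proof -
    have "eventually (\<lambda>n. 6 \<le> N n) sequentially" using Ninf by (simp add: filterlim_at_top)
    moreover have "eventually (\<lambda>n. 0 < n) sequentially" by (rule eventually_gt_at_top)
    ultimately show ?thesis
    proof eventually_elim
      case (elim n)
      have h: "hexpoly (part_size (V n) (c n)) = real n ^ 6 * hexpoly (\<lambda>i. part_size (V n) (c n) i / real n)"
        using hexpoly_scale[of "real n" "\<lambda>i. part_size (V n) (c n) i / real n"] elim by simp
      have pos: "0 < real (N n choose 6)" using elim by simp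
      have "2 * real (card (copies (hexgraph (V n) (c n))))
          = real n ^ 6 * (hexpoly (\<lambda>i. part_size (V n) (c n) i / real n) - e n / real n ^ 6)"
      proof -
        have "real n ^ 6 * (e n / real n ^ 6) = e n" using elim by simp
        then show ?thesis unfolding right_diff_distrib h[symmetric] by (simp add: e_def)
      qed
      then have "real (card (copies (hexgraph (V n) (c n))))
          = real n ^ 6 * (hexpoly (\<lambda>i. part_size (V n) (c n) i / real n) - e n / real n ^ 6) / 2"
        by (metis nonzero_mult_div_cancel_left zero_neq_numeral)
      then have "density F49 (hexgraph (V n) (c n))
          = real n ^ 6 * (hexpoly (\<lambda>i. part_size (V n) (c n) i / real n) - e n / real n ^ 6) / 2 / real (N n choose 6)"
        by (simp only: density_copies hexgraph_verts N_def)
      then show ?case using elim pos by (simp add: power_divide)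
    qed
  qed
  ultimately show ?thesis by (simp add: tendsto_cong)
qed

lemma blowup_limit:
  assumes x: "x \<in> prob_simplex 6"
    and W: "\<forall>n. blowup_parts B49 (W n)" "\<forall>i\<in>verts B49. (\<lambda>n. real (card (W n i)) / real n) \<longlonglongrightarrow> x i"
  shows "(\<lambda>n. density F49 (blowup B49 (W n :: nat \<Rightarrow> 'a set))) \<longlonglongrightarrow> 360 * hexpoly (\<lambda>i. x (part_index i))"
proof -
  have "\<forall>n. \<exists>V c. finite V \<and> blowup B49 (W n) = hexgraph V c \<and> (\<forall>i. {v\<in>V. c v = i} = W n (part_index i))"
    using W(1) blowup_hexgraph by blast
  then obtain V c where Vc: "\<And>n. finite (V n)" "\<And>n. blowup B49 (W n) = hexgraph (V n) (c n)"
    "\<And>n i. {v\<in>V n. c n v = i} = W n (part_index i)" by metis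
  have "sum (\<lambda>i. x (part_index i)) UNIV = 1"
    using x by (simp add: prob_simplex_def sum_six eval_nat_numeral)
  moreover have "(\<lambda>n. part_size (V n) (c n) i / real n) \<longlonglongrightarrow> x (part_index i)" for i
    using W(2) part_index_range unfolding part_size_def Vc(3) by blast
  ultimately show ?thesis unfolding Vc(2) using Vc(1) by (intro hexgraph_density_limit) auto
qed

lemma floor_ratio_limit: 
  assumes "0 \<le> a" shows "(\<lambda>n. real (nat \<lfloor>a * real n\<rfloor>) / real n) \<longlonglongrightarrow> a"
proof -
  have "(\<lambda>n. real_of_int \<lfloor>a * real n\<rfloor> / real n) \<longlonglongrightarrow> a" by real_asymp
  then show ?thesis using assms by simp
qed

text \<open>
  Blowups with prescribed limit proportions exist; without them the limit density of a blowup would not be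
  determined by its definition. The part i lies in the interval from \<open>i * n\<close> to \<open>(i + 1) *
  n\<close>, which makes the parts disjoint.
\<close>
lemma parts_exist:
  assumes x: "x \<in> prob_simplex 6"
  shows "\<exists>W :: nat \<Rightarrow> nat \<Rightarrow> nat set. (\<forall>n. blowup_parts B49 (W n))
     \<and> (\<forall>i\<in>verts B49. (\<lambda>n. real (card (W n i)) / real n) \<longlonglongrightarrow> x i)"
proof -
  have B: "verts B49 = {..<6}" by (auto simp: B49_def)
  have x0: "0 \<le> x i" and x1: "x i \<le> 1" if "i < 6" for i
  proof -
    show "0 \<le> x i" using x that by (simp add: prob_simplex_def)
    have "x i \<le> (\<Sum>i<6. x i)" using x that by (intro member_le_sum) (auto simp: prob_simplex_def)
    then show "x i \<le> 1" using x by (simp add: prob_simplex_def)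
  qed
  define W where "W n i = {i * n ..< i * n + nat \<lfloor>x i * real n\<rfloor>}" for n i
  have "blowup_parts B49 (W n)" for n
  proof -
    have sub: "v div n = i" if "i < 6" "v \<in> W n i" for i v
    proof -
      have "x i * real n \<le> 1 * real n" using x1[OF that(1)] by (rule mult_right_mono) simp
      moreover have "0 \<le> x i * real n" using x0[OF that(1)] by simp
      ultimately have "nat \<lfloor>x i * real n\<rfloor> \<le> n" by linarith
      then have "i * n \<le> v" "v < i * n + n" using that(2) by (auto simp: W_def)
      then show ?thesis by (intro div_nat_eqI) (simp_all add: mult.commute)
    qed
    have "W n i \<inter> W n j = {}" if "i < 6" "j < 6" "i \<noteq> j" for i j
      using sub[OF that(1)] sub[OF that(2)] that(3) by blast
    then show ?thesis unfolding blowup_parts_def disjoint_family_on_def B by (auto simp: W_def)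
  qed
  moreover have "(\<lambda>n. real (card (W n i)) / real n) \<longlonglongrightarrow> x i" if "i \<in> verts B49" for i
    using floor_ratio_limit[of "x i"] x0[of i] that by (simp add: W_def B)
  ultimately show ?thesis by blast
qed

lemma blowup_density_eq:
  assumes x: "x \<in> prob_simplex 6"
  shows "blowup_density F49 B49 x = 360 * hexpoly (\<lambda>i. x (part_index i))"
  unfolding blowup_density_def
proof (rule the_equality)
  show "\<forall>W :: nat \<Rightarrow> nat \<Rightarrow> nat set. (\<forall>n. blowup_parts B49 (W n)) \<and>
        (\<forall>i\<in>verts B49. (\<lambda>n. real (card (W n i)) / real n) \<longlonglongrightarrow> x i)
        \<longrightarrow> (\<lambda>n. density F49 (blowup B49 (W n))) \<longlonglongrightarrow> 360 * hexpoly (\<lambda>i. x (part_index i))"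
    using blowup_limit[OF x] by blast
  fix L
  assume L: "\<forall>W :: nat \<Rightarrow> nat \<Rightarrow> nat set. (\<forall>n. blowup_parts B49 (W n)) \<and>
        (\<forall>i\<in>verts B49. (\<lambda>n. real (card (W n i)) / real n) \<longlonglongrightarrow> x i)
        \<longrightarrow> (\<lambda>n. density F49 (blowup B49 (W n))) \<longlonglongrightarrow> L"
  obtain W :: "nat \<Rightarrow> nat \<Rightarrow> nat set" where W: "\<forall>n. blowup_parts B49 (W n)"
    "\<forall>i\<in>verts B49. (\<lambda>n. real (card (W n i)) / real n) \<longlonglongrightarrow> x i" using parts_exist[OF x] by blast
  show "L = 360 * hexpoly (\<lambda>i. x (part_index i))"
    using L W blowup_limit[OF x W] LIMSEQ_unique by blast
qed

lemma uniform_unique_maximiser: "unique_maximiser_up_to_aut F49 B49 6 (\<lambda>i. 1 / 6)"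
proof -
  let ?u = "\<lambda>i::nat. 1 / 6 :: real"
  have u: "?u \<in> prob_simplex 6" by (simp add: prob_simplex_def)
  have bu: "blowup_density F49 B49 ?u = 5 / 54"
    unfolding blowup_density_eq[OF u] hexpoly_const by (simp add: eval_nat_numeral)
  have nonneg: "0 \<le> y (part_index i)" and total: "sum (\<lambda>i. y (part_index i)) UNIV = 1" if "y \<in> prob_simplex 6" for y i
  proof -
    show "0 \<le> y (part_index i)" using that by (cases i; simp add: prob_simplex_def)
    show "sum (\<lambda>i. y (part_index i)) UNIV = 1" using that by (simp add: prob_simplex_def sum_six eval_nat_numeral)
  qed
  have le: "blowup_density F49 B49 y \<le> 5 / 54" if y: "y \<in> prob_simplex 6" for y
    unfolding blowup_density_eq[OF y] using hexpoly_le[OF nonneg[OF y] total[OF y]] by simp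
  have max: "is_arg_max (blowup_density F49 B49) (\<lambda>y. y \<in> prob_simplex 6) ?u"
    unfolding is_arg_max_def bu using u le by (auto simp: not_less)
  have uniq: "\<exists>f. automorphism B49 f \<and> (\<forall>i<6. y i = ?u (f i))"
    if y: "is_arg_max (blowup_density F49 B49) (\<lambda>z. z \<in> prob_simplex 6) y" for y
  proof -
    have ys: "y \<in> prob_simplex 6" and "\<not> blowup_density F49 B49 y < blowup_density F49 B49 ?u"
      using y u unfolding is_arg_max_def by blast+
    then have "1 / 3888 \<le> hexpoly (\<lambda>i. y (part_index i))" unfolding bu blowup_density_eq[OF ys] by simp
    then have "\<bar>6 * y (part_index i) - 1\<bar> \<le> 30 * 0" for i
      using hexpoly_near_max[OF nonneg[OF ys] total[OF ys], of 0 i] by simp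
    then have "6 * y (part_index i) - 1 = 0" for i by simp
    then have eq: "y (part_index i) = 1 / 6" for i by (metis eq_divide_eq_numeral1(1) eq_iff_diff_eq_0 mult.commute zero_neq_numeral)
    have "y i = 1 / 6" if "i < 6" for i
    proof -
      have "i \<in> range part_index" unfolding part_index_range using that by (simp add: B49_def)
      then show ?thesis using eq by auto
    qed
    moreover have "automorphism B49 id" by (simp add: automorphism_def graph_isomorphism_def)
    ultimately show ?thesis by (intro exI[of _ id]) simp
  qed
  show ?thesis unfolding unique_maximiser_up_to_aut_def using max uniq by blast
qed

lemma div_ratio_limit: "(\<lambda>n. real (n div 6) / real n) \<longlonglongrightarrow> 1 / 6"
proof -
  have "nat \<lfloor>1 / 6 * real n\<rfloor> = n div 6" for n
  proof -
    have "\<lfloor>real n / real 6\<rfloor> = int (n div 6)" by (rule floor_divide_of_nat_eq)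
    then show ?thesis by simp
  qed
  then show ?thesis using floor_ratio_limit[of "1/6"] by simp
qed

lemma max_density_lower: "\<exists>d. d \<longlonglongrightarrow> 5 / 54 \<and> (\<forall>n. d n \<le> max_density F49 n)"
proof -
  \<comment> \<open>Five parts of size \<open>n div 6\<close>; the last part takes the remainder.\<close>
  define c :: "nat \<Rightarrow> nat \<Rightarrow> six" where "c n v = (let q = n div 6 in if v < q then I0 else if v < 2 * q then I1
    else if v < 3 * q then I2 else if v < 4 * q then I3 else if v < 5 * q then I4 else I5)" for n v
  have parts: "{v\<in>{..<n}. c n v = I0} = {..<n div 6}" "{v\<in>{..<n}. c n v = I1} = {n div 6..<2 * (n div 6)}"
    "{v\<in>{..<n}. c n v = I2} = {2 * (n div 6)..<3 * (n div 6)}" "{v\<in>{..<n}. c n v = I3} = {3 * (n div 6)..<4 * (n div 6)}"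
    "{v\<in>{..<n}. c n v = I4} = {4 * (n div 6)..<5 * (n div 6)}" "{v\<in>{..<n}. c n v = I5} = {5 * (n div 6)..<n}" for n
    by (auto simp: c_def Let_def split: if_splits)
  have lim: "(\<lambda>n. part_size {..<n} (c n) i / real n) \<longlonglongrightarrow> 1 / 6" for i
  proof (cases "i = I5")
    case True
    have "(\<lambda>n. real n / real n - 5 * (real (n div 6) / real n)) \<longlonglongrightarrow> 1 - 5 * (1 / 6)"
    proof (intro tendsto_diff tendsto_mult tendsto_const div_ratio_limit)
      show "(\<lambda>n. real n / real n) \<longlonglongrightarrow> 1"
        by (rule tendsto_eventually, rule eventually_sequentiallyI[of 1]) simp
    qed
    moreover have "part_size {..<n} (c n) i / real n = real n / real n - 5 * (real (n div 6) / real n)" for n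
    proof -
      have "5 * (n div 6) \<le> n" by simp
      moreover have "part_size {..<n} (c n) I5 = real (n - 5 * (n div 6))" unfolding part_size_def parts by simp
      ultimately show ?thesis using True by (simp add: of_nat_diff diff_divide_distrib)
    qed
    ultimately show ?thesis by simp
  next
    case False
    then have "part_size {..<n} (c n) i = real (n div 6)" for n
      unfolding part_size_def by (cases i) (simp_all only: parts, simp_all)
    then show ?thesis using div_ratio_limit by simp
  qed
  have "(\<lambda>n. density F49 (hexgraph {..<n} (c n))) \<longlonglongrightarrow> 360 * hexpoly (\<lambda>i. 1 / 6)"
    by (rule hexgraph_density_limit) (use lim in \<open>auto simp: card_six\<close>)
  then have "(\<lambda>n. density F49 (hexgraph {..<n} (c n))) \<longlonglongrightarrow> 5 / 54"
    by (simp add: hexpoly_const eval_nat_numeral)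
  moreover have "density F49 (hexgraph {..<n} (c n)) \<le> max_density F49 n" for n
    by (rule density_le_max) (simp_all add: hexgraph_simple hexgraph_verts)
  ultimately show ?thesis by blast
qed

lemma density_upper:
  assumes "simple_graph G" "F49_sum (verts G) (\<lambda>_. 1) (grel G) \<le> t * real (card (verts G)) ^ 6"
  shows "density F49 G \<le> t / 2 * (real (card (verts G)) ^ 6 / real (card (verts G) choose 6))"
proof -
  have "real (card (copies G)) \<le> t / 2 * real (card (verts G)) ^ 6"
    using copies_le(1)[OF assms(1)] assms(2) by simp
  then have "density F49 G \<le> t / 2 * real (card (verts G)) ^ 6 / real (card (verts G) choose 6)"
    unfolding density_copies by (rule divide_right_mono) simp
  then show ?thesis by simp
qed

lemma max_density_limit: "max_density F49 \<longlonglongrightarrow> 5 / 54"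
proof -
  obtain d where d: "d \<longlonglongrightarrow> 5 / 54" "\<And>n. d n \<le> max_density F49 n" using max_density_lower by blast
  have "(\<lambda>n. 1 / 3888 / 2 * (real n ^ 6 / real (n choose 6))) \<longlonglongrightarrow> 1 / 3888 / 2 * 720"
    by (intro tendsto_mult tendsto_const choose6_limit)
  then have u: "(\<lambda>n. 1 / 3888 / 2 * (real n ^ 6 / real (n choose 6))) \<longlonglongrightarrow> 5 / 54" by simp
  have le: "max_density F49 n \<le> 1 / 3888 / 2 * (real n ^ 6 / real (n choose 6))" for n
  proof -
    obtain G :: "nat graph" where G: "simple_graph G" "card (verts G) = n" "max_density F49 n = density F49 G"
      using max_density_attained by blast
    show ?thesis using density_upper[OF G(1), of "1 / 3888"] F49_sum_le[OF G(1)] G by simp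
  qed
  show ?thesis
    by (rule tendsto_sandwich[OF _ _ d(1) u]) (use d(2) le in \<open>auto intro!: always_eventually\<close>)
qed

text \<open>
  Graphs with a nearly optimal F49 sum are treated by the lemma stability. All others have a density below the
  maximum by a constant, so that the trivial bound \<open>n\<^sup>2\<close> for the edit distance suffices.
\<close>
lemma perfectly_stable_F49: "perfectly_stable F49 B49"
proof -
  define gap where "gap n = max_density F49 n - (1 - cutoff) / 3888 / 2 * (real n ^ 6 / real (n choose 6))" for n
  have "gap \<longlonglongrightarrow> 5 / 54 - (1 - cutoff) / 3888 / 2 * 720"
    unfolding gap_def by (intro tendsto_diff max_density_limit tendsto_mult tendsto_const choose6_limit)
  moreover have "5 / 54 * (cutoff / 2) < 5 / 54 - (1 - cutoff) / 3888 / 2 * 720"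
  proof -
    have "5 / 54 - (1 - cutoff) / 3888 / 2 * 720 = 5 / 54 * cutoff" by argo
    then show ?thesis using constant_facts(8) by linarith
  qed
  ultimately have "eventually (\<lambda>n. 5 / 54 * (cutoff / 2) < gap n) sequentially" by (rule order_tendstoD(1))
  then obtain n0 where n0: "\<And>n. n0 \<le> n \<Longrightarrow> 5 / 54 * (cutoff / 2) < gap n" unfolding eventually_sequentially by blast
  \<comment> \<open>A sum of lower bounds on C: for the gap above, for the lemma stability, and for the two cases below.\<close>
  define C where "C = real n0 + 20 / gain_rate + 6 + 1 / (180 * gain_rate) + 108 / (5 * cutoff)"
  have pos: "0 < 20 / gain_rate" "0 < 1 / (180 * gain_rate)" "0 < 108 / (5 * cutoff)" using constant_facts(1,8) by auto
  have C: "0 < C" "real n0 \<le> C" "20 / gain_rate \<le> C" "6 \<le> C" "1 / (180 * gain_rate) \<le> C" "108 / (5 * cutoff) \<le> C"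
    using pos unfolding C_def by linarith+
  show ?thesis
    unfolding perfectly_stable_def
  proof (intro exI[of _ C] conjI C(1) allI impI, elim conjE)
    fix G :: "nat graph" assume sG: "simple_graph G" and big: "C \<le> real (card (verts G))"
    define n where "n = card (verts G)"
    have n: "real n0 \<le> real n" "20 / gain_rate \<le> real n" "6 \<le> real n" using big C unfolding n_def by linarith+
    then have n': "n0 \<le> n" "6 \<le> n" by simp_all
    define def where "def = max_density F49 n - density F49 G"
    have def0: "0 \<le> def" using density_le_max[OF sG] by (simp add: def_def n_def)
    have "real (edit_distance G B49) \<le> C * def * (real n)\<^sup>2"
    proof (cases "(1 - cutoff) * real n ^ 6 / 3888 \<le> F49_sum (verts G) (\<lambda>_. 1) (grel G)")
      case True
      obtain c where c: "gain_rate / 4 * real n ^ 4 * real (edit_distance G B49)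
          \<le> real (card (copies (hexgraph (verts G) c))) - real (card (copies G))"
        using stability[OF sG n_def _ n(2) True] n' by auto
      let ?H = "hexgraph (verts G) c"
      have fV: "finite (verts G)" using sG by (simp add: simple_graph_def)
      have ch: "0 < real (n choose 6)" using n' by simp
      have "density F49 ?H - density F49 G \<le> def"
        unfolding def_def using density_le_max[of ?H n] hexgraph_simple[OF fV] by (simp add: hexgraph_verts n_def)
      moreover have "density F49 ?H - density F49 G = (real (card (copies ?H)) - real (card (copies G))) / real (n choose 6)"
        by (simp add: density_copies hexgraph_verts n_def diff_divide_distrib)
      ultimately have "real (card (copies ?H)) - real (card (copies G)) \<le> def * real (n choose 6)"
        using ch by (simp add: divide_le_eq)
      also have "\<dots> \<le> def * (real n ^ 6 / 720)" using def0 choose6_le by (rule mult_left_mono[rotated])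
      finally have "gain_rate / 4 * real n ^ 4 * real (edit_distance G B49) \<le> def * (real n ^ 6 / 720)" using c by linarith
      then have "real n ^ 4 * real (edit_distance G B49) \<le> real n ^ 4 * (1 / (180 * gain_rate) * def * (real n)\<^sup>2)"
        using constant_facts(1) by (simp add: field_simps eval_nat_numeral)
      then have "real (edit_distance G B49) \<le> 1 / (180 * gain_rate) * def * (real n)\<^sup>2"
        by (rule mult_left_le_imp_le) (use n' in simp)
      also have "\<dots> \<le> C * def * (real n)\<^sup>2" using C(5) def0 by (intro mult_right_mono) auto
      finally show ?thesis .
    next
      case False
      then have "density F49 G \<le> (1 - cutoff) / 3888 / 2 * (real n ^ 6 / real (n choose 6))"
        unfolding n_def by (intro density_upper[OF sG]) simp
      then have d: "5 / 54 * (cutoff / 2) \<le> def" using n0[OF n'(1)] unfolding gap_def def_def by linarith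
      have "real (edit_distance G B49) \<le> (\<Sum>u\<in>verts G. \<Sum>v\<in>verts G. differ (grel G) (\<lambda>u v. hex I0 I0) u v)"
        using edit_distance_le[OF sG, of "\<lambda>_. I0"] .
      also have "\<dots> \<le> (\<Sum>u\<in>verts G. \<Sum>v\<in>verts G. 1)" by (intro sum_mono) (simp add: differ_def)
      also have "\<dots> = (real n)\<^sup>2" by (simp add: n_def power2_eq_square)
      finally have e: "real (edit_distance G B49) \<le> 1 * (real n)\<^sup>2" by simp
      have "1 = 108 / (5 * cutoff) * (5 / 54 * (cutoff / 2))" using constant_facts(8) by simp
      also have "\<dots> \<le> C * def"
        by (intro mult_mono C(6) d less_imp_le[OF C(1)]) (use constant_facts(8) in simp)
      finally have "1 * (real n)\<^sup>2 \<le> C * def * (real n)\<^sup>2" by (rule mult_right_mono) simp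
      with e show ?thesis by linarith
    qed
    then show "real (edit_distance G B49)
       \<le> C * (max_density F49 (card (verts G)) - density F49 G) * (real (card (verts G)))\<^sup>2"
      by (simp add: def_def n_def)
  qed
qed

theorem theorem3p19:
  shows "max_density F49 \<longlonglongrightarrow> 5 / 54
    \<and> perfectly_stable F49 B49
    \<and> unique_maximiser_up_to_aut F49 B49 6 (\<lambda>i. 1 / 6)"
  using max_density_limit perfectly_stable_F49 uniform_unique_maximiser by blast

end
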